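(* Let $v$ be a normal weight and let $\mathcal{Y}\subset H(\mathbb{D})$ be a Banach space whose closed unit ball is compact with respect to the compact open topology $co$. (i) Let $T\colon H_v^\infty\to\mathcal{Y}$ be a linear operator whose restriction to the closed unit ball $B_{H_v^\infty}$ of $H_v^\infty$ is $co$-$co$-continuous. Then $T\colon H_v^\infty\to\mathcal{Y}$ is compact if and only if it is weakly compact. (ii) Let $T\colon\mathcal{B}_v^\infty\to\mathcal{Y}$ be a linear operator whose restriction to the closed unit ball $B_{\mathcal{B}_v^\infty}$ of $\mathcal{B}_v^\infty$ is $co$-$co$-continuous. Then $T\colon\mathcal{B}_v^\infty\to\mathcal{Y}$ is compact if and only if it is weakly compact.
   Context: $\mathbb{D}$ is the open unit disc and $H(\mathbb{D})$ the space of analytic functions on $\mathbb{D}$; $co$ denotes the compact open topology (uniform convergence on compact subsets of $\mathbb{D}$), and $co$-$co$-continuous means continuous when both domain and range carry $co$. A weight is a continuous strictly positive function $v\colon\mathbb{D}\to\mathbb{R}$ with $\lim_{|z|\to1}v(z)=0$. It is normal if $v(z)=v(|z|)$ for all $z$, $v$ is non-increasing in $|z|$, $\inf_{k\in\mathbb{N}}\limsup_{n\to\infty}\frac{v(1-2^{-n-k})}{v(1-2^{-n})}<1$ and $\sup_{n\in\mathbb{N}}\frac{v(1-2^{-n})}{v(1-2^{-n-1})}<\infty$. $H_v^\infty=\{f\in H(\mathbb{D}):\|f\|_{H_v^\infty}=\sup_{z}v(z)|f(z)|<\infty\}$ and $\mathcal{B}_v^\infty=\{f\in H(\mathbb{D}):\|f\|_{\mathcal{B}_v^\infty}=|f(0)|+\sup_z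 v(z)|f'(z)|<\infty\}$. *)

theory Defs
  imports "HOL-Complex_Analysis.Complex_Analysis"
begin

text \<open>A function on the unit disc is represented by its extension by \<open>0\<close> to the whole complex
  plane, so that two members of \<open>HD\<close> are equal iff they agree on the disc.  Vector space
  operations are pointwise with complex scalars.\<close>

abbreviation disc :: "complex set" where
  "disc \<equiv> ball 0 1"

definition HD :: "(complex \<Rightarrow> complex) set" where
  "HD = {f. f holomorphic_on disc \<and> (\<forall>z. z \<notin> disc \<longrightarrow> f z = 0)}"

definition co_open :: "(complex \<Rightarrow> complex) set \<Rightarrow> bool" where
  "co_open U \<longleftrightarrow> U \<subseteq> HD \<and>
     (\<forall>f\<in>U. \<exists>K e. compact K \<and> K \<subseteq> disc \<and> e > 0 \<and>
        {g\<in>HD. \<forall>z\<in>K. cmod (g z - f z) < e} \<subseteq> U)"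

definition co_topology :: "(complex \<Rightarrow> complex) topology" where
  "co_topology = topology co_open"

lemma istopology_co_open: "istopology co_open"
  unfolding istopology_def
proof (intro conjI allI impI)
  fix U V assume U: "co_open U" and V: "co_open V"
  show "co_open (U \<inter> V)"
    unfolding co_open_def
  proof (intro conjI ballI)
    show "U \<inter> V \<subseteq> HD" using U by (auto simp: co_open_def)
  next
    fix f assume f: "f \<in> U \<inter> V"
    obtain K e where K: "compact K" "K \<subseteq> disc" "e > 0"
        "{g\<in>HD. \<forall>z\<in>K. cmod (g z - f z) < e} \<subseteq> U"
      using U f unfolding co_open_def by blast
    obtain L d where L: "compact L" "L \<subseteq> disc" "d > 0"
        "{g\<in>HD. \<forall>z\<in>L. cmod (g z - f z) < d} \<subseteq> V"
      using V f unfolding co_open_def by blast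
    have "{g\<in>HD. \<forall>z\<in>K \<union> L. cmod (g z - f z) < min e d} \<subseteq> U \<inter> V"
      using K(4) L(4) by auto
    with K L show "\<exists>K e. compact K \<and> K \<subseteq> disc \<and> e > 0 \<and>
        {g\<in>HD. \<forall>z\<in>K. cmod (g z - f z) < e} \<subseteq> U \<inter> V"
      by (intro exI[of _ "K \<union> L"] exI[of _ "min e d"]) (simp add: compact_Un)
  qed
next
  fix \<U> assume *: "\<forall>U\<in>\<U>. co_open U"
  show "co_open (\<Union>\<U>)"
    unfolding co_open_def
  proof (intro conjI ballI)
    show "\<Union>\<U> \<subseteq> HD" using * by (auto simp: co_open_def)
  next
    fix f assume "f \<in> \<Union>\<U>"
    then obtain U where "U \<in> \<U>" and "f \<in> U" by blast
    have "co_open U" using * \<open>U \<in> \<U>\<close> by blast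
    with \<open>f \<in> U\<close> obtain K e where K: "compact K" "K \<subseteq> disc" "e > 0"
        "{g\<in>HD. \<forall>z\<in>K. cmod (g z - f z) < e} \<subseteq> U"
      unfolding co_open_def by blast
    have "{g\<in>HD. \<forall>z\<in>K. cmod (g z - f z) < e} \<subseteq> \<Union>\<U>"
      using K(4) \<open>U \<in> \<U>\<close> by (meson Union_upper subset_trans)
    with K show "\<exists>K e. compact K \<and> K \<subseteq> disc \<and> e > 0 \<and>
        {g\<in>HD. \<forall>z\<in>K. cmod (g z - f z) < e} \<subseteq> \<Union>\<U>"
      by (intro exI[of _ K] exI[of _ e]) simp
  qed
qed

lemma openin_co_topology: "openin co_topology = co_open"
  by (simp add: co_topology_def istopology_co_open)

lemma topspace_co_topology: "topspace co_topology = HD"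
proof -
  have "co_open HD"
    unfolding co_open_def
    by (intro conjI ballI exI[of _ "{} :: complex set"] exI[of _ "1 :: real"]) auto
  moreover have "U \<subseteq> HD" if "co_open U" for U
    using that by (simp add: co_open_def)
  ultimately show ?thesis
    unfolding topspace_def openin_co_topology by blast
qed

lemma limitin_co_topology:
  "limitin co_topology F f G \<longleftrightarrow>
     f \<in> HD \<and> (\<forall>\<^sub>F n in G. F n \<in> HD) \<and>
     (\<forall>K. compact K \<and> K \<subseteq> disc \<longrightarrow> uniform_limit K F f G)"
proof (intro iffI conjI allI impI)
  assume lim: "limitin co_topology F f G"
  then show f: "f \<in> HD" by (simp add: limitin_def topspace_co_topology)
  have "openin co_topology HD" using openin_topspace topspace_co_topology by metis
  with lim f show "\<forall>\<^sub>F n in G. F n \<in> HD" by (simp add: limitin_def)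
  fix K :: "complex set" assume K: "compact K \<and> K \<subseteq> disc"
  show "uniform_limit K F f G"
  proof (rule uniform_limitI)
    fix e :: real assume e: "e > 0"
    define U where "U = {g\<in>HD. \<exists>d<e. \<forall>z\<in>K. cmod (g z - f z) \<le> d}"
    have "co_open U"
      unfolding co_open_def
    proof (intro conjI ballI)
      fix g assume "g \<in> U"
      then obtain d where d: "d < e" "\<forall>z\<in>K. cmod (g z - f z) \<le> d" by (auto simp: U_def)
      have "{h\<in>HD. \<forall>z\<in>K. cmod (h z - g z) < (e - d) / 2} \<subseteq> U"
      proof
        fix h assume h: "h \<in> {h\<in>HD. \<forall>z\<in>K. cmod (h z - g z) < (e - d) / 2}"
        have "cmod (h z - f z) \<le> (e + d) / 2" if "z \<in> K" for z
        proof -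
          have "cmod (h z - f z) \<le> cmod (h z - g z) + cmod (g z - f z)"
            using norm_triangle_ineq[of "h z - g z" "g z - f z"] by simp
          also have "\<dots> \<le> (e - d) / 2 + d" using h d that by (intro add_mono) (auto intro: less_imp_le)
          finally show ?thesis by (simp add: field_simps)
        qed
        moreover have "(e + d) / 2 < e" using d by simp
        ultimately show "h \<in> U" using h unfolding U_def by blast
      qed
      then show "\<exists>K e. compact K \<and> K \<subseteq> disc \<and> e > 0 \<and>
          {h\<in>HD. \<forall>z\<in>K. cmod (h z - g z) < e} \<subseteq> U"
        using K d by (intro exI[of _ K] exI[of _ "(e - d) / 2"]) simp
    qed (auto simp: U_def)
    moreover have "f \<in> U" using f e by (auto simp: U_def intro!: exI[of _ 0])
    ultimately have "\<forall>\<^sub>F n in G. F n \<in> U"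
      using lim by (simp add: limitin_def openin_co_topology)
    then show "\<forall>\<^sub>F n in G. \<forall>z\<in>K. dist (F n z) (f z) < e"
      by eventually_elim (force simp: U_def dist_norm)
  qed
next
  assume *: "f \<in> HD \<and> (\<forall>\<^sub>F n in G. F n \<in> HD) \<and>
     (\<forall>K. compact K \<and> K \<subseteq> disc \<longrightarrow> uniform_limit K F f G)"
  show "limitin co_topology F f G"
    unfolding limitin_def topspace_co_topology openin_co_topology
  proof (intro conjI allI impI)
    show "f \<in> HD" using * by blast
    fix U assume "co_open U \<and> f \<in> U"
    then have "co_open U" "f \<in> U" by auto
    then obtain K e where K: "compact K" "K \<subseteq> disc" "e > 0"
        "{g\<in>HD. \<forall>z\<in>K. cmod (g z - f z) < e} \<subseteq> U"
      unfolding co_open_def by blast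
    have "uniform_limit K F f G" using * K(1,2) by simp
    then have "\<forall>\<^sub>F n in G. \<forall>z\<in>K. dist (F n z) (f z) < e"
      using K(3) by (rule uniform_limitD)
    moreover have "\<forall>\<^sub>F n in G. F n \<in> HD" using * by simp
    ultimately show "\<forall>\<^sub>F n in G. F n \<in> U"
      by eventually_elim (use K(4) in \<open>auto simp: dist_norm\<close>)
  qed
qed

text \<open>The filter below is \<open>|z| \<rightarrow> 1\<close> from inside the disc.\<close>

definition weight :: "(complex \<Rightarrow> real) \<Rightarrow> bool" where
  "weight v \<longleftrightarrow> continuous_on disc v \<and> (\<forall>z\<in>disc. v z > 0) \<and>
     (v \<longlongrightarrow> 0) (filtercomap cmod (at_left 1))"

definition normal_weight :: "(complex \<Rightarrow> real) \<Rightarrow> bool" where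
  "normal_weight v \<longleftrightarrow> weight v \<and>
     (\<forall>z\<in>disc. v z = v (of_real (cmod z))) \<and>
     (\<forall>z\<in>disc. \<forall>w\<in>disc. cmod z \<le> cmod w \<longrightarrow> v w \<le> v z) \<and>
     (INF k. limsup (\<lambda>n. ereal (v (1 - (1/2) ^ (n + k)) / v (1 - (1/2) ^ n)))) < 1 \<and>
     (SUP n. ereal (v (1 - (1/2) ^ n) / v (1 - (1/2) ^ (n + 1)))) < \<infinity>"

definition Hv :: "(complex \<Rightarrow> real) \<Rightarrow> (complex \<Rightarrow> complex) set" where
  "Hv v = {f\<in>HD. bdd_above ((\<lambda>z. v z * cmod (f z)) ` disc)}"

definition Hv_norm :: "(complex \<Rightarrow> real) \<Rightarrow> (complex \<Rightarrow> complex) \<Rightarrow> real" where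
  "Hv_norm v f = (SUP z\<in>disc. v z * cmod (f z))"

definition Bv :: "(complex \<Rightarrow> real) \<Rightarrow> (complex \<Rightarrow> complex) set" where
  "Bv v = {f\<in>HD. bdd_above ((\<lambda>z. v z * cmod (deriv f z)) ` disc)}"

definition Bv_norm :: "(complex \<Rightarrow> real) \<Rightarrow> (complex \<Rightarrow> complex) \<Rightarrow> real" where
  "Bv_norm v f = cmod (f 0) + (SUP z\<in>disc. v z * cmod (deriv f z))"

locale normed_fun_space =
  fixes X :: "(complex \<Rightarrow> complex) set" and N :: "(complex \<Rightarrow> complex) \<Rightarrow> real"
  assumes zero_mem: "(\<lambda>z. 0) \<in> X"
    and add_mem: "f \<in> X \<Longrightarrow> g \<in> X \<Longrightarrow> (\<lambda>z. f z + g z) \<in> X"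
    and scale_mem: "f \<in> X \<Longrightarrow> (\<lambda>z. c * f z) \<in> X"
    and norm_nonneg: "f \<in> X \<Longrightarrow> 0 \<le> N f"
    and norm_eq_zero: "f \<in> X \<Longrightarrow> N f = 0 \<longleftrightarrow> f = (\<lambda>z. 0)"
    and norm_scale: "f \<in> X \<Longrightarrow> N (\<lambda>z. c * f z) = cmod c * N f"
    and norm_triangle: "f \<in> X \<Longrightarrow> g \<in> X \<Longrightarrow> N (\<lambda>z. f z + g z) \<le> N f + N g"

text \<open>\<^locale>\<open>Metric_space\<close> demands nonnegativity and symmetry also outside the carrier, hence the
  case distinction.\<close>

definition norm_dist ::
    "(complex \<Rightarrow> complex) set \<Rightarrow> ((complex \<Rightarrow> complex) \<Rightarrow> real) \<Rightarrow>
     (complex \<Rightarrow> complex) \<Rightarrow> (complex \<Rightarrow> complex) \<Rightarrow> real" where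
  "norm_dist X N f g = (if f \<in> X \<and> g \<in> X then N (\<lambda>z. f z - g z) else 0)"

context normed_fun_space
begin

lemma diff_mem: "f \<in> X \<Longrightarrow> g \<in> X \<Longrightarrow> (\<lambda>z. f z - g z) \<in> X"
  using add_mem[of f "\<lambda>z. (-1) * g z"] scale_mem[of g "-1"] by simp

lemma Metric_space_norm_dist: "Metric_space X (norm_dist X N)"
proof
  show "0 \<le> norm_dist X N f g" for f g
    by (simp add: norm_dist_def diff_mem norm_nonneg)
  show "norm_dist X N f g = norm_dist X N g f" for f g
    using norm_scale[of "\<lambda>z. f z - g z" "-1"] by (auto simp: norm_dist_def diff_mem)
  show "norm_dist X N f g = 0 \<longleftrightarrow> f = g" if "f \<in> X" "g \<in> X" for f g
    using that by (simp add: norm_dist_def diff_mem norm_eq_zero fun_eq_iff)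
  show "norm_dist X N f h \<le> norm_dist X N f g + norm_dist X N g h"
    if "f \<in> X" "g \<in> X" "h \<in> X" for f g h
    using that norm_triangle[of "\<lambda>z. f z - g z" "\<lambda>z. g z - h z"]
    by (simp add: norm_dist_def diff_mem)
qed

end

locale banach_fun_space = normed_fun_space +
  assumes complete: "Metric_space.mcomplete X (norm_dist X N)"

definition norm_topology ::
    "(complex \<Rightarrow> complex) set \<Rightarrow> ((complex \<Rightarrow> complex) \<Rightarrow> real) \<Rightarrow>
     (complex \<Rightarrow> complex) topology" where
  "norm_topology X N = Metric_space.mtopology X (norm_dist X N)"

definition unit_ball ::
    "(complex \<Rightarrow> complex) set \<Rightarrow> ((complex \<Rightarrow> complex) \<Rightarrow> real) \<Rightarrow>
     (complex \<Rightarrow> complex) set" where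
  "unit_ball X N = {f\<in>X. N f \<le> 1}"

definition dual ::
    "(complex \<Rightarrow> complex) set \<Rightarrow> ((complex \<Rightarrow> complex) \<Rightarrow> real) \<Rightarrow>
     ((complex \<Rightarrow> complex) \<Rightarrow> complex) set" where
  "dual X N = {\<phi>.
     (\<forall>f\<in>X. \<forall>g\<in>X. \<phi> (\<lambda>z. f z + g z) = \<phi> f + \<phi> g) \<and>
     (\<forall>f\<in>X. \<forall>c. \<phi> (\<lambda>z. c * f z) = c * \<phi> f) \<and>
     (\<exists>C. \<forall>f\<in>X. cmod (\<phi> f) \<le> C * N f)}"

definition weak_topology ::
    "(complex \<Rightarrow> complex) set \<Rightarrow> ((complex \<Rightarrow> complex) \<Rightarrow> real) \<Rightarrow>
     (complex \<Rightarrow> complex) topology" where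
  "weak_topology X N =
     topology_generated_by {{f\<in>X. \<phi> f \<in> U} | \<phi> U. \<phi> \<in> dual X N \<and> open U}"

lemma (in normed_fun_space) topspace_norm_topology: "topspace (norm_topology X N) = X"
  unfolding norm_topology_def
  by (rule Metric_space.topspace_mtopology[OF Metric_space_norm_dist])

lemma (in normed_fun_space) topspace_weak_topology: "topspace (weak_topology X N) = X"
proof -
  have "(\<lambda>f. 0) \<in> dual X N"
    unfolding dual_def by (auto intro!: exI[of _ 0])
  then have "{f\<in>X. (\<lambda>f. 0) f \<in> (UNIV :: complex set)} \<in>
      {{f\<in>X. \<phi> f \<in> U} | \<phi> U. \<phi> \<in> dual X N \<and> open U}"
    by blast
  then show ?thesis
    unfolding weak_topology_def topology_generated_by_topspace by auto
qed

definition linear_operator ::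
    "(complex \<Rightarrow> complex) set \<Rightarrow> (complex \<Rightarrow> complex) set \<Rightarrow>
     ((complex \<Rightarrow> complex) \<Rightarrow> (complex \<Rightarrow> complex)) \<Rightarrow> bool" where
  "linear_operator X Y T \<longleftrightarrow> T ` X \<subseteq> Y \<and>
     (\<forall>f\<in>X. \<forall>g\<in>X. T (\<lambda>z. f z + g z) = (\<lambda>z. T f z + T g z)) \<and>
     (\<forall>f\<in>X. \<forall>c. T (\<lambda>z. c * f z) = (\<lambda>z. c * T f z))"

text \<open>Closures are taken in \<open>Y\<close>.  Boundedness of the operator is not assumed separately;
  it follows from relative (weak) compactness of the image of the unit ball.\<close>

definition compact_operator ::
    "(complex \<Rightarrow> complex) set \<Rightarrow> ((complex \<Rightarrow> complex) \<Rightarrow> real) \<Rightarrow>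
     (complex \<Rightarrow> complex) set \<Rightarrow> ((complex \<Rightarrow> complex) \<Rightarrow> real) \<Rightarrow>
     ((complex \<Rightarrow> complex) \<Rightarrow> (complex \<Rightarrow> complex)) \<Rightarrow> bool" where
  "compact_operator X NX Y NY T \<longleftrightarrow>
     compactin (norm_topology Y NY) (norm_topology Y NY closure_of (T ` unit_ball X NX))"

definition weakly_compact_operator ::
    "(complex \<Rightarrow> complex) set \<Rightarrow> ((complex \<Rightarrow> complex) \<Rightarrow> real) \<Rightarrow>
     (complex \<Rightarrow> complex) set \<Rightarrow> ((complex \<Rightarrow> complex) \<Rightarrow> real) \<Rightarrow>
     ((complex \<Rightarrow> complex) \<Rightarrow> (complex \<Rightarrow> complex)) \<Rightarrow> bool" where
  "weakly_compact_operator X NX Y NY T \<longleftrightarrow>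
     compactin (weak_topology Y NY) (weak_topology Y NY closure_of (T ` unit_ball X NX))"

end

theory Submission
  imports Defs
begin

text \<open>
  Compactness always implies weak compactness, since the weak topology is coarser than the norm
  topology and Hausdorff. The content is the converse. It holds because, for a normal weight, both
  spaces look like \<open>\<ell>\<^sup>\<infinity>\<close>: there is a linear map \<open>P\<close> from the bounded families
  of complex numbers onto the space that maps the unit cube into the unit ball, covers the
  unit ball up to a constant factor, and is continuous from the product topology of the cube to \<open>co\<close>
  (\<open>cube_quotient\<close>). Composing with \<open>P\<close> reduces the theorem to a statement about a
  linear map \<open>F = T \<circ> P\<close> on bounded families that is continuous from the cube to the topology of
  pointwise convergence and maps the cube into a weakly compact set.

  Such an \<open>F\<close> has norm totally bounded image (locale \<open>weakly_compact_cube_image\<close>).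
  Every functional that vanishes on the values of \<open>F\<close> at finitely supported families vanishes on
  the whole image, because on a weakly compact set the weak topology is the pointwise one; by the
  Hahn-Banach theorem the finitely supported values are norm dense in the image, which is
  therefore norm separable. Norm balls of \<open>Y\<close> are closed for pointwise convergence, the unit ball
  being \<open>co\<close>-compact. So the cube is covered by countably many closed sets on which \<open>F\<close> varies
  by at most \<open>\<epsilon>\<close>, and by Baire's theorem one of them contains a whole cylinder; subtracting
  two of its points, \<open>F\<close> is small on all families in the cube that vanish at finitely many
  prescribed indices. Up to \<open>\<epsilon>\<close> the image is thus that of a finite-dimensional cube.
  This takes the place of the Orlicz-Pettis theorem, respectively of the Schur property of
  \<open>\<ell>\<^sup>1\<close>.

  The map \<open>P\<close> for \<open>H\<^sub>v\<^sup>\<infinity>\<close> comes from a dyadic decomposition. A Taylor series is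
  split into differences of de la Vallee Poussin means, the \<open>k\<close>-th of which is a polynomial with
  frequencies comparable to \<open>2\<^sup>k\<close>. On the circle of radius \<open>\<rho>\<^sub>k = 1 - 2\<^sup>-\<^sup>k\<^sup>-\<^sup>1\<close> it
  is bounded by a multiple of \<open>1 / v(\<rho>\<^sub>k)\<close>, and it is recovered from its
  values at equidistant points of that circle by a kernel whose absolute values have bounded mean. The
  values, multiplied by \<open>v(\<rho>\<^sub>k)\<close>, are the coordinates; the translated
  kernels are the atoms. The series of atoms is dominated by
  \<open>\<Sum>\<^sub>k |z|\<^bsup>m(k)\<^esup> / v(\<rho>\<^sub>k)\<close> with \<open>m(k)\<close> of order \<open>2\<^sup>k\<close>, and the two
  conditions of normality say exactly what is needed to bound this by a multiple of \<open>1 / v(z)\<close>.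
  For the Bloch-type space one integrates and adds one coordinate for the value at \<open>0\<close>.
\<close>

section \<open>The Hahn-Banach theorem\<close>

context normed_fun_space
begin

text \<open>Homogeneity is required as an inequality, which is easier to verify for infima; equality follows
  by applying it to the inverse scalar.\<close>

definition sublinear :: "((complex \<Rightarrow> complex) \<Rightarrow> real) \<Rightarrow> bool" where
  "sublinear q \<longleftrightarrow> (\<forall>f\<in>X. \<forall>g\<in>X. q (\<lambda>z. f z + g z) \<le> q f + q g) \<and>
     (\<forall>f\<in>X. \<forall>c>0. q (\<lambda>z. complex_of_real c * f z) \<le> c * q f)"

lemma sublinear_add: "sublinear q \<Longrightarrow> f \<in> X \<Longrightarrow> g \<in> X \<Longrightarrow> q (\<lambda>z. f z + g z) \<le> q f + q g"
  by (simp add: sublinear_def)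

lemma sublinear_scale:
  assumes "sublinear q" "f \<in> X" "c > 0"
  shows "q (\<lambda>z. complex_of_real c * f z) = c * q f"
proof (rule antisym)
  show "q (\<lambda>z. complex_of_real c * f z) \<le> c * q f"
    using assms by (simp add: sublinear_def)
  have "q (\<lambda>z. complex_of_real (1 / c) * (complex_of_real c * f z))
      \<le> (1 / c) * q (\<lambda>z. complex_of_real c * f z)"
    using assms scale_mem[of f "complex_of_real c"] unfolding sublinear_def
    by (metis zero_less_divide_1_iff)
  moreover have "(\<lambda>z. complex_of_real (1 / c) * (complex_of_real c * f z)) = f"
    using assms by (auto simp: fun_eq_iff)
  ultimately show "c * q f \<le> q (\<lambda>z. complex_of_real c * f z)"
    using assms by (simp add: field_simps)
qed

lemma sublinear_zero: "sublinear q \<Longrightarrow> q (\<lambda>z. 0) = 0"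
  using sublinear_scale[of q "\<lambda>z. 0" 2] zero_mem by simp

lemma sublinear_lower:
  assumes "sublinear q" "f \<in> X"
  shows "- q (\<lambda>z. - f z) \<le> q f"
  using sublinear_add[OF assms, of "\<lambda>z. - f z"] scale_mem[OF assms(2), of "-1"]
    sublinear_zero[OF assms(1)] by simp

text \<open>With \<open>s = 1 / t\<close> this is the infimum of \<open>(q (h + s f) - q h) / s\<close>, the one-sided derivative of
  \<open>q\<close> at \<open>h\<close> in direction \<open>f\<close>. It serves both halves of the Hahn-Banach theorem: it is again
  sublinear and below \<open>q\<close>, and its value at \<open>-h\<close> is at most \<open>- q h\<close>.\<close>

definition slope :: "((complex \<Rightarrow> complex) \<Rightarrow> real) \<Rightarrow> (complex \<Rightarrow> complex) \<Rightarrow>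
    (complex \<Rightarrow> complex) \<Rightarrow> real" where
  "slope q h f = (INF t\<in>{0<..}. q (\<lambda>z. f z + complex_of_real t * h z) - t * q h)"

lemma slope_bound:
  assumes q: "sublinear q" and "h \<in> X" "f \<in> X" "t > 0"
  shows "- q (\<lambda>z. - f z) \<le> q (\<lambda>z. f z + complex_of_real t * h z) - t * q h"
proof -
  have m: "(\<lambda>z. - f z) \<in> X" "(\<lambda>z. complex_of_real t * h z) \<in> X"
    using scale_mem[OF assms(3), of "-1"] scale_mem[OF assms(2)] by auto
  have "q (\<lambda>z. (f z + complex_of_real t * h z) + - f z)
      \<le> q (\<lambda>z. f z + complex_of_real t * h z) + q (\<lambda>z. - f z)"
    using m assms by (intro sublinear_add add_mem)
  then show ?thesis using sublinear_scale[OF q assms(2,4)] by (simp add: algebra_simps)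
qed

lemma slope_le:
  assumes "sublinear q" "h \<in> X" "f \<in> X" "t > 0"
  shows "slope q h f \<le> q (\<lambda>z. f z + complex_of_real t * h z) - t * q h"
  unfolding slope_def
  by (rule cINF_lower) (use slope_bound[OF assms(1-3)] assms in \<open>auto intro!: bdd_belowI2\<close>)

lemma slope_ge:
  assumes "\<And>t. t > 0 \<Longrightarrow> c \<le> q (\<lambda>z. f z + complex_of_real t * h z) - t * q h"
  shows "c \<le> slope q h f"
  unfolding slope_def by (rule cINF_greatest) (use assms in \<open>auto intro: exI[of _ 1]\<close>)

lemma sublinear_slope:
  assumes q: "sublinear q" and h: "h \<in> X"
  shows "sublinear (slope q h)"
  unfolding sublinear_def
proof (intro conjI ballI allI impI)
  fix f g assume f: "f \<in> X" and g: "g \<in> X"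
  have *: "slope q h (\<lambda>z. f z + g z) \<le> (q (\<lambda>z. f z + complex_of_real t * h z) - t * q h)
      + (q (\<lambda>z. g z + complex_of_real s * h z) - s * q h)" if "t > 0" "s > 0" for t s
  proof -
    have "slope q h (\<lambda>z. f z + g z) \<le> q (\<lambda>z. (f z + g z) + complex_of_real (t + s) * h z) - (t + s) * q h"
      using that f g h q by (intro slope_le add_mem) auto
    also have "(\<lambda>z. (f z + g z) + complex_of_real (t + s) * h z)
        = (\<lambda>z. (f z + complex_of_real t * h z) + (g z + complex_of_real s * h z))"
      by (auto simp: algebra_simps)
    also have "q \<dots> \<le> q (\<lambda>z. f z + complex_of_real t * h z) + q (\<lambda>z. g z + complex_of_real s * h z)"
      by (intro sublinear_add q add_mem f g scale_mem h)
    finally show ?thesis by (simp add: algebra_simps)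
  qed
  have "slope q h (\<lambda>z. f z + g z) - (q (\<lambda>z. f z + complex_of_real t * h z) - t * q h) \<le> slope q h g"
    if "t > 0" for t
    by (rule slope_ge) (use *[OF that] in \<open>simp add: algebra_simps\<close>)
  then have "slope q h (\<lambda>z. f z + g z) - slope q h g \<le> slope q h f"
    by (intro slope_ge) (simp add: algebra_simps)
  then show "slope q h (\<lambda>z. f z + g z) \<le> slope q h f + slope q h g" by simp
next
  fix f and c :: real assume f: "f \<in> X" and c: "c > 0"
  have "slope q h (\<lambda>z. complex_of_real c * f z) / c
      \<le> q (\<lambda>z. f z + complex_of_real t * h z) - t * q h" if "t > 0" for t
  proof -
    have "slope q h (\<lambda>z. complex_of_real c * f z)
        \<le> q (\<lambda>z. complex_of_real c * f z + complex_of_real (c * t) * h z) - (c * t) * q h"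
      using that c f h q by (intro slope_le scale_mem) auto
    also have "(\<lambda>z. complex_of_real c * f z + complex_of_real (c * t) * h z)
        = (\<lambda>z. complex_of_real c * (f z + complex_of_real t * h z))"
      by (auto simp: algebra_simps)
    also have "q \<dots> = c * q (\<lambda>z. f z + complex_of_real t * h z)"
      using c f h by (intro sublinear_scale q add_mem scale_mem)
    finally show ?thesis using c by (simp add: field_simps)
  qed
  then have "slope q h (\<lambda>z. complex_of_real c * f z) / c \<le> slope q h f"
    by (rule slope_ge)
  then show "slope q h (\<lambda>z. complex_of_real c * f z) \<le> c * slope q h f"
    using c by (simp add: field_simps)
qed

lemma slope_le_self:
  assumes "sublinear q" "h \<in> X" "f \<in> X"
  shows "slope q h f \<le> q f"
  using slope_le[OF assms, of 1] sublinear_add[OF assms(1,3,2)] by simp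

lemma slope_neg:
  assumes "sublinear q" "h \<in> X"
  shows "slope q h (\<lambda>z. - h z) \<le> - q h"
  using slope_le[OF assms scale_mem[OF assms(2), of "-1"], of 1] sublinear_zero[OF assms(1)] by simp

text \<open>Zorn's lemma: the pointwise infimum of a chain of sublinear functionals is sublinear, and
  stays finite because \<open>q f \<ge> - p (- f)\<close> for each member \<open>q\<close>. The functionals are set to \<open>0\<close>
  outside of the space to make the pointwise order antisymmetric.\<close>

lemma ex_minimal_sublinear:
  assumes p: "sublinear p"
  shows "\<exists>l. sublinear l \<and> (\<forall>f\<in>X. l f \<le> p f) \<and>
     (\<forall>q. sublinear q \<longrightarrow> (\<forall>f\<in>X. q f \<le> l f) \<longrightarrow> (\<forall>f\<in>X. q f = l f))"
proof -
  define A where "A = {q. sublinear q \<and> (\<forall>f\<in>X. q f \<le> p f) \<and> (\<forall>f. f \<notin> X \<longrightarrow> q f = 0)}"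
  define P where "P q q' \<longleftrightarrow> (\<forall>f\<in>X. q' f \<le> (q f :: real))" for q q' :: "(complex \<Rightarrow> complex) \<Rightarrow> real"
  have restr: "sublinear (\<lambda>f. if f \<in> X then q f else 0)" if "sublinear q" for q
    using that by (auto simp: sublinear_def add_mem scale_mem)
  have "\<exists>m\<in>A. \<forall>a\<in>A. P m a \<longrightarrow> a = m"
  proof (rule predicate_Zorn)
    show "partial_order_on A (relation_of P A)"
    proof (rule partial_order_on_relation_ofI)
      show "P a a" for a by (simp add: P_def)
      show "P a c" if "P a b" "P b c" for a b c
        using that unfolding P_def by (meson order_trans)
      show "a = b" if "a \<in> A" "b \<in> A" "P a b" "P b a" for a b
      proof
        show "a f = b f" for f
          using that unfolding P_def A_def by (cases "f \<in> X") (auto intro: antisym)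
      qed
    qed
    fix C assume C: "C \<in> Chains (relation_of P A)"
    have CA: "C \<subseteq> A" using C by (auto simp: Chains_def relation_of_def)
    have tot: "P q r \<or> P r q" if "q \<in> C" "r \<in> C" for q r
      using C that by (auto simp: Chains_def relation_of_def)
    show "\<exists>u\<in>A. \<forall>a\<in>C. P a u"
    proof (cases "C = {}")
      case True
      have "(\<lambda>f. if f \<in> X then p f else 0) \<in> A"
        using restr[OF p] by (auto simp: A_def)
      then show ?thesis using True by auto
    next
      case False
      define u where "u f = (INF q\<in>C. q f)" for f
      have bd: "- p (\<lambda>z. - f z) \<le> q f" if "f \<in> X" "q \<in> C" for f q
      proof -
        have "- q (\<lambda>z. - f z) \<le> q f" using that CA by (intro sublinear_lower) (auto simp: A_def)
        moreover have "q (\<lambda>z. - f z) \<le> p (\<lambda>z. - f z)"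
          using that CA scale_mem[OF that(1), of "-1"] by (auto simp: A_def)
        ultimately show ?thesis by simp
      qed
      have le: "u f \<le> q f" if "f \<in> X" "q \<in> C" for f q
        unfolding u_def using that bd by (intro cINF_lower bdd_belowI2) auto
      have ge: "c \<le> u f" if "\<And>q. q \<in> C \<Longrightarrow> c \<le> q f" for c f
        unfolding u_def using False that by (rule cINF_greatest)
      have "sublinear u"
        unfolding sublinear_def
      proof (intro conjI ballI allI impI)
        fix f g assume f: "f \<in> X" and g: "g \<in> X"
        have *: "u (\<lambda>z. f z + g z) \<le> q f + r g" if q: "q \<in> C" and r: "r \<in> C" for q r
        proof -
          \<comment> \<open>The smaller of the two members of the chain serves both summands.\<close>
          obtain s where s: "s \<in> C" "s f \<le> q f" "s g \<le> r g"
            using tot[OF q r] f g q r unfolding P_def by auto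
          have "u (\<lambda>z. f z + g z) \<le> s (\<lambda>z. f z + g z)"
            using f g s by (intro le add_mem)
          also have "\<dots> \<le> s f + s g"
            using f g s CA by (intro sublinear_add) (auto simp: A_def)
          finally show ?thesis using s by simp
        qed
        have "u (\<lambda>z. f z + g z) - q f \<le> u g" if "q \<in> C" for q
          by (rule ge) (use *[OF that] in \<open>simp add: algebra_simps\<close>)
        then have "u (\<lambda>z. f z + g z) - u g \<le> u f"
          by (intro ge) (simp add: algebra_simps)
        then show "u (\<lambda>z. f z + g z) \<le> u f + u g" by simp
      next
        fix f and c :: real assume f: "f \<in> X" and c: "c > 0"
        have "u (\<lambda>z. complex_of_real c * f z) / c \<le> q f" if q: "q \<in> C" for q
        proof -
          have "u (\<lambda>z. complex_of_real c * f z) \<le> q (\<lambda>z. complex_of_real c * f z)"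
            using f q by (intro le scale_mem)
          also have "\<dots> = c * q f"
            using f q c CA by (intro sublinear_scale) (auto simp: A_def)
          finally show ?thesis using c by (simp add: field_simps)
        qed
        then have "u (\<lambda>z. complex_of_real c * f z) / c \<le> u f" by (rule ge)
        then show "u (\<lambda>z. complex_of_real c * f z) \<le> c * u f"
          using c by (simp add: field_simps)
      qed
      moreover have "u f \<le> p f" if f: "f \<in> X" for f
      proof -
        obtain q where q: "q \<in> C" using False by blast
        have "u f \<le> q f" using f q by (rule le)
        also have "\<dots> \<le> p f" using q CA f by (auto simp: A_def)
        finally show ?thesis .
      qed
      ultimately have "(\<lambda>f. if f \<in> X then u f else 0) \<in> A"
        using restr by (simp add: A_def)
      then show ?thesis
        by (rule rev_bexI) (simp add: P_def le)
    qed
  qed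
  then obtain l where l: "l \<in> A" "\<And>a. a \<in> A \<Longrightarrow> P l a \<Longrightarrow> a = l" by blast
  show ?thesis
  proof (intro exI[of _ l] conjI allI impI)
    show "sublinear l" "\<forall>f\<in>X. l f \<le> p f" using l by (auto simp: A_def)
    fix q assume q: "sublinear q" "\<forall>f\<in>X. q f \<le> l f"
    have "(\<lambda>f. if f \<in> X then q f else 0) \<in> A"
      using restr[OF q(1)] q(2) l(1) by (auto simp: A_def intro: order_trans)
    then have "(\<lambda>f. if f \<in> X then q f else 0) = l"
      by (rule l(2)) (use q(2) in \<open>auto simp: P_def\<close>)
    then show "\<forall>f\<in>X. q f = l f" by (metis (mono_tags, lifting))
  qed
qed

text \<open>A minimal sublinear functional equals its slope at every point \<open>g\<close>, and this gives
  \<open>l f + l g \<le> l (f + g)\<close>, so that it is additive. Minimising below the slope of \<open>p\<close> at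
  \<open>h\<close> forces \<open>l h = p h\<close>.\<close>

lemma hahn_banach_sublinear:
  assumes p: "sublinear p" and h: "h \<in> X"
  shows "\<exists>l. (\<forall>f\<in>X. \<forall>g\<in>X. l (\<lambda>z. f z + g z) = l f + l g) \<and>
     (\<forall>f\<in>X. \<forall>c. l (\<lambda>z. complex_of_real c * f z) = c * l f) \<and>
     (\<forall>f\<in>X. l f \<le> p f) \<and> l h = p h"
proof -
  obtain l where l: "sublinear l" "\<And>f. f \<in> X \<Longrightarrow> l f \<le> slope p h f"
    and min: "\<And>q f. sublinear q \<Longrightarrow> \<forall>f\<in>X. q f \<le> l f \<Longrightarrow> f \<in> X \<Longrightarrow> q f = l f"
    using ex_minimal_sublinear[OF sublinear_slope[OF p h]] by metis
  have add: "l (\<lambda>z. f z + g z) = l f + l g" if f: "f \<in> X" and g: "g \<in> X" for f g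
  proof (rule antisym)
    show "l (\<lambda>z. f z + g z) \<le> l f + l g" using l f g by (intro sublinear_add)
    have "slope l g f = l f"
      using sublinear_slope[OF l(1) g] slope_le_self[OF l(1) g] f by (intro min) auto
    then show "l f + l g \<le> l (\<lambda>z. f z + g z)"
      using slope_le[OF l(1) g f, of 1] by simp
  qed
  have neg: "l (\<lambda>z. - f z) = - l f" if f: "f \<in> X" for f
    using add[OF f, of "\<lambda>z. - f z"] scale_mem[OF f, of "-1"] sublinear_zero[OF l(1)] by simp
  have scale: "l (\<lambda>z. complex_of_real c * f z) = c * l f" if f: "f \<in> X" for f c
  proof (cases c "0 :: real" rule: linorder_cases)
    case less
    have "l (\<lambda>z. complex_of_real (- c) * f z) = (- c) * l f"
      using less f l by (intro sublinear_scale) auto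
    then show ?thesis using neg[OF scale_mem[OF f, of "complex_of_real c"]] by simp
  qed (use sublinear_scale[OF l(1) f] sublinear_zero[OF l(1)] in auto)
  have le: "l f \<le> p f" if "f \<in> X" for f
    using l(2)[OF that] slope_le_self[OF p h that] by simp
  have "l (\<lambda>z. - h z) \<le> - p h"
    using l(2)[of "\<lambda>z. - h z"] slope_neg[OF p h] scale_mem[OF h, of "-1"] by simp
  then have "l h = p h" using neg[OF h] le[OF h] by simp
  with add scale le show ?thesis by blast
qed

text \<open>The distance to \<open>M\<close> is a sublinear functional that is dominated by the norm and vanishes on
  \<open>M\<close>. The complex functional with a given real part is \<open>l f - \<i> l (\<i> f)\<close>.\<close>

lemma separating_functional:
  assumes M: "M \<subseteq> X" "(\<lambda>z. 0) \<in> M"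
    and add: "\<And>f g. f \<in> M \<Longrightarrow> g \<in> M \<Longrightarrow> (\<lambda>z. f z + g z) \<in> M"
    and scale: "\<And>f c. f \<in> M \<Longrightarrow> (\<lambda>z. c * f z) \<in> M"
    and h: "h \<in> X" and e: "e > 0" "\<And>m. m \<in> M \<Longrightarrow> e \<le> N (\<lambda>z. h z - m z)"
  shows "\<exists>\<phi>\<in>dual X N. (\<forall>m\<in>M. \<phi> m = 0) \<and> \<phi> h \<noteq> 0"
proof -
  define p where "p f = (INF m\<in>M. N (\<lambda>z. f z - m z))" for f
  have lower: "p f \<le> N (\<lambda>z. f z - m z)" if "f \<in> X" "m \<in> M" for f m
    unfolding p_def using that M by (intro cINF_lower bdd_belowI2[of _ 0] norm_nonneg diff_mem) auto
  have greatest: "c \<le> p f" if "\<And>m. m \<in> M \<Longrightarrow> c \<le> N (\<lambda>z. f z - m z)" for c f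
    unfolding p_def using M(2) that by (intro cINF_greatest) auto
  have "sublinear p"
    unfolding sublinear_def
  proof (intro conjI ballI allI impI)
    fix f g assume f: "f \<in> X" and g: "g \<in> X"
    have *: "p (\<lambda>z. f z + g z) \<le> N (\<lambda>z. f z - m z) + N (\<lambda>z. g z - n z)"
      if m: "m \<in> M" and n: "n \<in> M" for m n
    proof -
      have "p (\<lambda>z. f z + g z) \<le> N (\<lambda>z. (f z + g z) - (m z + n z))"
        using f g m n by (intro lower add_mem add)
      also have "(\<lambda>z. (f z + g z) - (m z + n z)) = (\<lambda>z. (f z - m z) + (g z - n z))"
        by auto
      also have "N \<dots> \<le> N (\<lambda>z. f z - m z) + N (\<lambda>z. g z - n z)"
        using f g m n M by (intro norm_triangle diff_mem) auto
      finally show ?thesis .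
    qed
    have "p (\<lambda>z. f z + g z) - N (\<lambda>z. f z - m z) \<le> p g" if "m \<in> M" for m
      by (rule greatest) (use *[OF that] in \<open>simp add: algebra_simps\<close>)
    then have "p (\<lambda>z. f z + g z) - p g \<le> p f"
      by (intro greatest) (simp add: algebra_simps)
    then show "p (\<lambda>z. f z + g z) \<le> p f + p g" by simp
  next
    fix f and c :: real assume f: "f \<in> X" and c: "c > 0"
    have "p (\<lambda>z. complex_of_real c * f z) / c \<le> N (\<lambda>z. f z - m z)" if m: "m \<in> M" for m
    proof -
      have "p (\<lambda>z. complex_of_real c * f z)
          \<le> N (\<lambda>z. complex_of_real c * f z - complex_of_real c * m z)"
        using f m by (intro lower scale_mem scale)
      also have "\<dots> = N (\<lambda>z. complex_of_real c * (f z - m z))"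
        by (simp add: algebra_simps)
      also have "\<dots> = c * N (\<lambda>z. f z - m z)"
        using f m M c by (subst norm_scale) (auto intro: diff_mem)
      finally show ?thesis using c by (simp add: field_simps)
    qed
    then have "p (\<lambda>z. complex_of_real c * f z) / c \<le> p f" by (rule greatest)
    then show "p (\<lambda>z. complex_of_real c * f z) \<le> c * p f"
      using c by (simp add: field_simps)
  qed
  then obtain l where l_add: "\<And>f g. f \<in> X \<Longrightarrow> g \<in> X \<Longrightarrow> l (\<lambda>z. f z + g z) = l f + l g"
    and l_scale: "\<And>f c. f \<in> X \<Longrightarrow> l (\<lambda>z. complex_of_real c * f z) = c * l f"
    and l_le: "\<And>f. f \<in> X \<Longrightarrow> l f \<le> p f" and lh: "l h = p h"
    using hahn_banach_sublinear[OF _ h, of p] by blast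
  have ph: "p h \<ge> e" using e(2) by (rule greatest)
  have l_neg: "l (\<lambda>z. - f z) = - l f" if "f \<in> X" for f
    using l_scale[OF that, of "-1"] by simp
  have abs_l: "\<bar>l f\<bar> \<le> N f" if f: "f \<in> X" for f
  proof -
    have mf: "(\<lambda>z. - f z) \<in> X" using scale_mem[OF f, of "-1"] by simp
    have "N (\<lambda>z. - f z) = N f" using norm_scale[OF f, of "-1"] by simp
    then show ?thesis
      using l_le[OF f] l_le[OF mf] lower[OF f M(2)] lower[OF mf M(2)] l_neg[OF f] by simp
  qed
  have lM: "l m = 0" if m: "m \<in> M" for m
  proof -
    have "l f \<le> 0" if f: "f \<in> M" for f
      using l_le[of f] lower[of f f] f M(1) norm_eq_zero[OF zero_mem] by auto
    from this[OF m] this[OF scale[OF m, of "-1"]] show ?thesis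
      using l_neg[of m] m M(1) by auto
  qed
  have iX: "(\<lambda>z. \<i> * f z) \<in> X" if "f \<in> X" for f using that by (rule scale_mem)
  define \<phi> where "\<phi> f = Complex (l f) (- l (\<lambda>z. \<i> * f z))" for f
  have "\<phi> \<in> dual X N"
    unfolding dual_def mem_Collect_eq
  proof (intro conjI ballI allI exI[of _ 2])
    fix f g assume f: "f \<in> X" and g: "g \<in> X"
    have "l (\<lambda>z. \<i> * (f z + g z)) = l (\<lambda>z. \<i> * f z) + l (\<lambda>z. \<i> * g z)"
      using l_add[OF iX[OF f] iX[OF g]] by (simp add: algebra_simps)
    then show "\<phi> (\<lambda>z. f z + g z) = \<phi> f + \<phi> g"
      by (simp add: \<phi>_def l_add[OF f g] complex_eq_iff)
  next
    fix f c assume f: "f \<in> X"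
    have lin: "l (\<lambda>z. complex_of_real a * f z + complex_of_real b * (\<i> * f z))
        = a * l f + b * l (\<lambda>z. \<i> * f z)" for a b
      using l_add[OF scale_mem[OF f, of a] scale_mem[OF iX[OF f], of b]]
        l_scale[OF f] l_scale[OF iX[OF f]] by simp
    have "(\<lambda>z. c * f z)
        = (\<lambda>z. complex_of_real (Re c) * f z + complex_of_real (Im c) * (\<i> * f z))"
      by (subst complex_eq[of c]) (simp add: algebra_simps)
    moreover have "(\<lambda>z. \<i> * (c * f z))
        = (\<lambda>z. complex_of_real (- Im c) * f z + complex_of_real (Re c) * (\<i> * f z))"
      by (subst complex_eq[of c]) (simp add: algebra_simps)
    ultimately show "\<phi> (\<lambda>z. c * f z) = c * \<phi> f"
      unfolding \<phi>_def by (simp only: lin) (simp add: complex_eq_iff algebra_simps)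
  next
    fix f assume f: "f \<in> X"
    have "cmod (\<phi> f) \<le> \<bar>l f\<bar> + \<bar>l (\<lambda>z. \<i> * f z)\<bar>"
      unfolding \<phi>_def using cmod_le[of "Complex (l f) (- l (\<lambda>z. \<i> * f z))"] by simp
    also have "\<dots> \<le> N f + N (\<lambda>z. \<i> * f z)" by (intro add_mono abs_l f iX)
    finally show "cmod (\<phi> f) \<le> 2 * N f" using norm_scale[OF f, of "\<i>"] by simp
  qed
  moreover have "\<phi> m = 0" if "m \<in> M" for m
    using lM[OF that] lM[OF scale[OF that, of "\<i>"]] by (simp add: \<phi>_def complex_eq_iff)
  moreover have "\<phi> h \<noteq> 0" using lh ph e(1) by (simp add: \<phi>_def complex_eq_iff)
  ultimately show ?thesis by blast
qed

end

section \<open>Norm, weak and pointwise topologies\<close>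

lemma Hausdorff_pointwise: "Hausdorff_space (euclidean :: ('a \<Rightarrow> complex) topology)"
  unfolding euclidean_product_topology[symmetric] by (simp add: Hausdorff_space_product_topology)

lemma compact_imp_closed_pointwise:
  fixes S :: "('a \<Rightarrow> complex) set"
  shows "compact S \<Longrightarrow> closed S"
  using compactin_imp_closedin[OF Hausdorff_pointwise] by simp

context normed_fun_space
begin

lemma unit_ball_scaled:
  assumes "f \<in> X" "N f \<le> r" "r > 0"
  shows "(\<lambda>z. complex_of_real (1 / r) * f z) \<in> unit_ball X N"
proof -
  have "N (\<lambda>z. complex_of_real (1 / r) * f z) = N f / r"
    using assms norm_scale[of f "complex_of_real (1 / r)"] by (simp del: of_real_divide)
  then show ?thesis using assms by (simp add: unit_ball_def scale_mem del: of_real_divide)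
qed

lemma dual_diff:
  assumes "\<phi> \<in> dual X N" "f \<in> X" "g \<in> X"
  shows "\<phi> (\<lambda>z. f z - g z) = \<phi> f - \<phi> g"
proof -
  have g: "(\<lambda>z. (-1) * g z) \<in> X" by (rule scale_mem[OF assms(3)])
  have add: "\<forall>f\<in>X. \<forall>g\<in>X. \<phi> (\<lambda>z. f z + g z) = \<phi> f + \<phi> g"
    and scale: "\<forall>f\<in>X. \<forall>c. \<phi> (\<lambda>z. c * f z) = c * \<phi> f"
    using assms(1) by (simp_all add: dual_def)
  show ?thesis
    using add[rule_format, OF assms(2) g] scale[rule_format, OF assms(3), of "-1"] by simp
qed

lemma continuous_map_dual_weak:
  assumes "\<phi> \<in> dual X N"
  shows "continuous_map (weak_topology X N) euclidean \<phi>"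
  unfolding continuous_map topspace_weak_topology
proof (intro conjI allI impI)
  fix U :: "complex set" assume "openin euclidean U"
  then have "{f\<in>X. \<phi> f \<in> U} \<in> {{f\<in>X. \<phi> f \<in> U} | \<phi> U. \<phi> \<in> dual X N \<and> open U}"
    using assms by auto
  then show "openin (weak_topology X N) {f\<in>X. \<phi> f \<in> U}"
    unfolding weak_topology_def by (rule topology_generated_by_Basis)
qed auto

lemma continuous_map_norm_weak:
  "continuous_map (norm_topology X N) (weak_topology X N) id"
  unfolding weak_topology_def
proof (rule continuous_on_generated_topo)
  interpret Metric_space X "norm_dist X N" by (rule Metric_space_norm_dist)
  fix V assume "V \<in> {{f\<in>X. \<phi> f \<in> U} | \<phi> U. \<phi> \<in> dual X N \<and> open U}"
  then obtain \<phi> U where \<phi>: "\<phi> \<in> dual X N" and U: "open U" and V: "V = {f\<in>X. \<phi> f \<in> U}"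
    by blast
  obtain C where C: "\<And>f. f \<in> X \<Longrightarrow> cmod (\<phi> f) \<le> C * N f"
    using \<phi> unfolding dual_def by blast
  have "openin mtopology V"
    unfolding openin_mtopology
  proof (intro conjI allI impI)
    fix f assume f: "f \<in> V"
    then obtain e where e: "e > 0" "ball (\<phi> f) e \<subseteq> U"
      using U V by (auto elim: openE)
    have "mball f (e / (\<bar>C\<bar> + 1)) \<subseteq> V"
    proof
      fix g assume g: "g \<in> mball f (e / (\<bar>C\<bar> + 1))"
      then have gX: "g \<in> X" and fX: "f \<in> X" by auto
      have "cmod (\<phi> f - \<phi> g) = cmod (\<phi> (\<lambda>z. f z - g z))"
        using dual_diff[OF \<phi> fX gX] by simp
      also have "\<dots> \<le> C * N (\<lambda>z. f z - g z)" by (intro C diff_mem fX gX)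
      also have "\<dots> \<le> (\<bar>C\<bar> + 1) * N (\<lambda>z. f z - g z)"
        by (intro mult_right_mono norm_nonneg diff_mem fX gX) auto
      also have "\<dots> < e"
        using g gX fX by (simp add: norm_dist_def field_simps)
      finally show "g \<in> V" using e gX V by (auto simp: dist_norm)
    qed
    then show "\<exists>r>0. mball f r \<subseteq> V"
      using e by (intro exI[of _ "e / (\<bar>C\<bar> + 1)"]) auto
  qed (use V in auto)
  moreover have "id -` V \<inter> topspace (norm_topology X N) = V"
    using V by (auto simp: topspace_norm_topology)
  ultimately show "openin (norm_topology X N) (id -` V \<inter> topspace (norm_topology X N))"
    by (simp add: norm_topology_def)
next
  show "id ` topspace (norm_topology X N) \<subseteq> \<Union>{{f\<in>X. \<phi> f \<in> U} | \<phi> U. \<phi> \<in> dual X N \<and> open U}"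
    using topspace_weak_topology
    unfolding weak_topology_def topology_generated_by_topspace topspace_norm_topology by auto
qed

end

text \<open>Compactness for pointwise convergence, which follows from compactness in the compact open topology
  and is meant for two things: point evaluations are bounded, and norm balls are closed under
  pointwise limits.\<close>

locale compact_ball_space = banach_fun_space +
  assumes compact_ball: "compact (unit_ball X N)"
begin

text \<open>A coordinate is bounded on the compact unit ball.\<close>

lemma eval_dual: "(\<lambda>f. f z) \<in> dual X N"
proof -
  have "compact ((\<lambda>f. f z) ` unit_ball X N)"
    by (intro compact_continuous_image compact_ball continuous_on_product_coordinates[THEN continuous_on_subset]) auto
  then obtain C where C: "\<And>f. f \<in> unit_ball X N \<Longrightarrow> cmod (f z) \<le> C"
    by (meson bounded_iff compact_imp_bounded imageI)
  have "cmod (f z) \<le> C * N f" if f: "f \<in> X" for f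
  proof (cases "N f = 0")
    case True
    then show ?thesis using norm_eq_zero[OF f] by simp
  next
    case False
    then have pos: "N f > 0" using norm_nonneg[OF f] by simp
    then show ?thesis
      using C[OF unit_ball_scaled[OF f order_refl pos]] by (simp add: norm_mult norm_divide field_simps)
  qed
  then show ?thesis unfolding dual_def by auto
qed

text \<open>Hence weakly compact sets are closed under pointwise limits, and the weak topology is Hausdorff.\<close>

lemma continuous_map_weak_pointwise: "continuous_map (weak_topology X N) euclidean id"
  unfolding euclidean_product_topology[symmetric] continuous_map_componentwise_UNIV
  using continuous_map_dual_weak[OF eval_dual] by simp

lemma Hausdorff_weak: "Hausdorff_space (weak_topology X N)"
  by (rule Hausdorff_space_injective_preimage[OF Hausdorff_pointwise continuous_map_weak_pointwise]) auto

text \<open>The norm closure is weakly compact, hence weakly closed, so it contains the weak closure.\<close>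

lemma compact_imp_weakly_compact:
  assumes S: "S \<subseteq> X" and "compactin (norm_topology X N) (norm_topology X N closure_of S)"
  shows "compactin (weak_topology X N) (weak_topology X N closure_of S)"
proof -
  define K where "K = norm_topology X N closure_of S"
  have "compactin (weak_topology X N) (id ` K)"
    using image_compactin[OF _ continuous_map_norm_weak] assms(2) by (simp add: K_def)
  then have K: "compactin (weak_topology X N) K" by simp
  have "S \<subseteq> K"
    unfolding K_def using S by (intro closure_of_subset) (simp add: topspace_norm_topology)
  then have "weak_topology X N closure_of S \<subseteq> K"
    using compactin_imp_closedin[OF Hausdorff_weak K] by (rule closure_of_minimal)
  then show ?thesis
    by (rule closed_compactin[OF K]) simp
qed

text \<open>The centres of the nets are taken from the whole space; moving each of them to a nearby point of
  \<open>S\<close> costs a factor in the radius.\<close>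

lemma totally_bounded_imp_compact:
  assumes "S \<subseteq> X"
    and "\<And>e. e > 0 \<Longrightarrow> \<exists>K. finite K \<and> K \<subseteq> X \<and> (\<forall>f\<in>S. \<exists>g\<in>K. N (\<lambda>z. g z - f z) \<le> e)"
  shows "compactin (norm_topology X N) (norm_topology X N closure_of S)"
proof -
  interpret Metric_space X "norm_dist X N" by (rule Metric_space_norm_dist)
  have "mtotally_bounded S"
    unfolding mtotally_bounded_def
  proof (intro allI impI)
    fix e :: real assume e: "e > 0"
    then have "\<exists>K. finite K \<and> K \<subseteq> X \<and> (\<forall>f\<in>S. \<exists>g\<in>K. N (\<lambda>z. g z - f z) \<le> e / 3)"
      by (intro assms(2)) simp
    then obtain K where K: "finite K" "K \<subseteq> X" "\<forall>f\<in>S. \<exists>g\<in>K. N (\<lambda>z. g z - f z) \<le> e / 3"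
      by blast
    define G where "G = {g\<in>K. \<exists>f\<in>S. N (\<lambda>z. g z - f z) \<le> e / 3}"
    have "\<forall>g\<in>G. \<exists>f. f \<in> S \<and> N (\<lambda>z. g z - f z) \<le> e / 3"
      unfolding G_def by blast
    then obtain c where c: "\<And>g. g \<in> G \<Longrightarrow> c g \<in> S \<and> N (\<lambda>z. g z - c g z) \<le> e / 3"
      by (auto dest!: bchoice)
    have "S \<subseteq> (\<Union>x\<in>c ` G. mball x e)"
    proof
      fix f assume f: "f \<in> S"
      then obtain g where g: "g \<in> K" "N (\<lambda>z. g z - f z) \<le> e / 3" using K by blast
      then have gG: "g \<in> G" using f by (auto simp: G_def)
      have X: "g \<in> X" "f \<in> X" "c g \<in> X" using g(1) K f c[OF gG] assms(1) by auto
      have "norm_dist X N (c g) f \<le> norm_dist X N g (c g) + norm_dist X N g f"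
        using triangle[OF X(3,1,2)] commute by metis
      also have "\<dots> < e" using c[OF gG] g X e by (simp add: norm_dist_def)
      finally show "f \<in> (\<Union>x\<in>c ` G. mball x e)" using gG X by auto
    qed
    then show "\<exists>K. finite K \<and> K \<subseteq> S \<and> S \<subseteq> (\<Union>x\<in>K. mball x e)"
      using K(1) c by (intro exI[of _ "c ` G"]) (auto simp: G_def)
  qed
  then show ?thesis
    using mtotally_bounded_eq_compact_closure_of[OF complete] by (simp add: norm_topology_def)
qed

end

section \<open>The cube of bounded families\<close>

definition bounded_family :: "('i \<Rightarrow> complex) \<Rightarrow> bool" where
  "bounded_family a \<longleftrightarrow> (\<exists>R. \<forall>i. cmod (a i) \<le> R)"

definition cube :: "('i \<Rightarrow> complex) set" where
  "cube = {a. \<forall>i. cmod (a i) \<le> 1}"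

definition cut :: "'i set \<Rightarrow> ('i \<Rightarrow> complex) \<Rightarrow> 'i \<Rightarrow> complex" where
  "cut A a i = (if i \<in> A then a i else 0)"

definition unit_coord :: "'i \<Rightarrow> 'i \<Rightarrow> complex" where
  "unit_coord i j = (if j = i then 1 else 0)"

lemma bounded_family_scale:
  assumes "bounded_family a"
  shows "bounded_family (\<lambda>i. c * a i)"
proof -
  obtain R where R: "\<And>i. cmod (a i) \<le> R" using assms by (auto simp: bounded_family_def)
  have "cmod (c * a i) \<le> cmod c * R" for i
    by (simp add: norm_mult R mult_left_mono)
  then show ?thesis by (auto simp: bounded_family_def)
qed

lemma bounded_family_cube: "a \<in> cube \<Longrightarrow> bounded_family a"
  by (auto simp: bounded_family_def cube_def)

lemma bounded_family_finite_support:
  assumes "finite {i. a i \<noteq> 0}"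
  shows "bounded_family a"
proof -
  have "cmod (a i) \<le> (\<Sum>j\<in>{j. a j \<noteq> 0}. cmod (a j))" for i
    by (cases "a i = 0") (auto intro: sum_nonneg member_le_sum assms)
  then show ?thesis by (auto simp: bounded_family_def)
qed

lemma cut_cube: "a \<in> cube \<Longrightarrow> cut A a \<in> cube"
  by (auto simp: cube_def cut_def)

lemma finite_support_cut: "finite A \<Longrightarrow> finite {i. cut A a i \<noteq> 0}"
  by (rule finite_subset[of _ A]) (auto simp: cut_def)

lemma compact_product:
  fixes S :: "'i \<Rightarrow> 'b::topological_space set"
  assumes "\<And>i. compact (S i)"
  shows "compact (Pi UNIV S)"
proof -
  have "compact_space (product_topology (\<lambda>i. top_of_set (S i)) UNIV)"
    using assms by (simp add: compact_space_product_topology compact_space_subtopology)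
  then have "compactin (product_topology (\<lambda>i. euclidean) UNIV) (PiE UNIV S)"
    by (simp add: compactin_subspace subtopology_product_topology)
  then show ?thesis by (simp add: euclidean_product_topology PiE_UNIV_domain)
qed

lemma compact_cube: "compact (cube :: ('i \<Rightarrow> complex) set)"
proof -
  have "cube = Pi UNIV (\<lambda>i::'i. cball 0 1)" by (auto simp: cube_def)
  then show ?thesis using compact_product[of "\<lambda>i::'i. cball (0::complex) 1"] by simp
qed

lemma closed_cube: "closed (cube :: ('i \<Rightarrow> complex) set)"
  by (rule compact_imp_closed_pointwise[OF compact_cube])

lemma open_finite_coordinates:
  fixes U :: "('i \<Rightarrow> 'b::topological_space) set"
  assumes "open U" "a \<in> U"
  shows "\<exists>A. finite A \<and> (\<forall>b. (\<forall>i\<in>A. b i = a i) \<longrightarrow> b \<in> U)"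
proof -
  obtain V where V: "a \<in> PiE UNIV V" "finite {i. V i \<noteq> topspace (euclidean :: 'b topology)}" "PiE UNIV V \<subseteq> U"
    using product_topology_open_contains_basis[of "\<lambda>i. euclidean" UNIV U a] assms
    by (auto simp: open_fun_def)
  have "b \<in> U" if "\<forall>i\<in>{i. V i \<noteq> UNIV}. b i = a i" for b
  proof -
    have "b i \<in> V i" for i using that V(1) by (cases "V i = UNIV") (auto simp: PiE_iff)
    then show ?thesis using V(3) by (auto simp: PiE_iff)
  qed
  then show ?thesis using V(2) by auto
qed

text \<open>A neighbourhood of \<open>a\<close> in the product topology only constrains finitely many coordinates, so it
  contains a finite section \<open>cut A a\<close>.\<close>

lemma finite_sections_dense:
  fixes a :: "'i \<Rightarrow> complex" and C :: "('b::topological_space) set"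
  assumes F: "continuous_on cube F" and C: "closed C"
    and a: "a \<in> cube" and fin: "\<And>A. finite A \<Longrightarrow> F (cut A a) \<in> C"
  shows "F a \<in> C"
proof (rule ccontr)
  assume n: "F a \<notin> C"
  have "closed (cube \<inter> F -` C)"
    using continuous_closed_preimage[OF F closed_cube C] by (simp add: Int_commute)
  then have "open (- (cube \<inter> F -` C))" by (simp only: open_Compl)
  then obtain A where A: "finite A" "\<And>b. (\<forall>i\<in>A. b i = a i) \<Longrightarrow> b \<in> - (cube \<inter> F -` C)"
    using open_finite_coordinates[of _ a] n by blast
  have "cut A a \<in> - (cube \<inter> F -` C)" by (rule A(2)) (simp add: cut_def)
  then show False using fin[OF A(1)] cut_cube[OF a] by auto
qed

text \<open>Baire's theorem in the compact Hausdorff space \<open>cube\<close>, with an interior point replaced by the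
  cylinder of all points of the cube that agree with it at finitely many indices.\<close>

lemma Baire_cube:
  fixes E :: "'d \<Rightarrow> ('i \<Rightarrow> complex) set"
  assumes D: "countable D" and E: "\<And>d. d \<in> D \<Longrightarrow> closed (E d) \<and> E d \<subseteq> cube"
    and cover: "cube \<subseteq> (\<Union>d\<in>D. E d)"
  shows "\<exists>d\<in>D. \<exists>a\<in>cube. \<exists>A. finite A \<and> (\<forall>b\<in>cube. (\<forall>i\<in>A. b i = a i) \<longrightarrow> b \<in> E d)"
proof -
  let ?X = "top_of_set (cube :: ('i \<Rightarrow> complex) set)"
  have comp: "compact_space ?X"
    by (simp add: compact_space_subtopology compact_cube)
  have H: "Hausdorff_space ?X"
    by (rule Hausdorff_space_subtopology[OF Hausdorff_pointwise])
  have "\<exists>d\<in>D. ?X interior_of E d \<noteq> {}"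
  proof (rule ccontr)
    assume "\<not> ?thesis"
    then have "?X interior_of \<Union> (E ` D) = {}"
      using comp H D E
      by (intro Baire_category_alt)
        (auto simp: compact_imp_locally_compact_space compact_Hausdorff_imp_regular_space
          closedin_closed_eq[OF closed_cube])
    moreover have "\<Union> (E ` D) = topspace ?X" using cover E by auto
    ultimately have "topspace ?X = {}" using interior_of_topspace by metis
    moreover have "(\<lambda>i. 0) \<in> topspace ?X" by (simp add: cube_def)
    ultimately show False by blast
  qed
  then obtain d a where d: "d \<in> D" and a: "a \<in> ?X interior_of E d" by blast
  obtain U where U: "open U" "?X interior_of E d = cube \<inter> U"
    using openin_interior_of[of ?X "E d"] unfolding openin_open by blast
  obtain A where A: "finite A" "\<And>b. (\<forall>i\<in>A. b i = a i) \<Longrightarrow> b \<in> U"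
    using open_finite_coordinates[OF U(1), of a] a U(2) by blast
  have "b \<in> E d" if "b \<in> cube" "\<forall>i\<in>A. b i = a i" for b
    using A(2)[of b] that U(2) interior_of_subset[of ?X "E d"] by blast
  then show ?thesis using d a U(2) A(1) by blast
qed

section \<open>Weakly compact images of the cube\<close>

text \<open>The situation to which the theorem is reduced. A countable index type has countably many finite
  subsets, which makes the covering in the Baire argument countable.\<close>

locale weakly_compact_cube_image = compact_ball_space +
  fixes F :: "('i::countable \<Rightarrow> complex) \<Rightarrow> complex \<Rightarrow> complex" and W
  assumes mem: "bounded_family a \<Longrightarrow> F a \<in> X"
    and F_add: "bounded_family a \<Longrightarrow> bounded_family b \<Longrightarrow>
      F (\<lambda>i. a i + b i) = (\<lambda>z. F a z + F b z)"
    and F_scale: "bounded_family a \<Longrightarrow> F (\<lambda>i. c * a i) = (\<lambda>z. c * F a z)"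
    and F_cont: "continuous_on cube F"
    and W: "compactin (weak_topology X N) W"
    and F_W: "F ` cube \<subseteq> W"
begin

lemma F_zero: "F (\<lambda>i. 0) = (\<lambda>z. 0)"
proof -
  have "bounded_family (\<lambda>i::'i. 0)" by (auto simp: bounded_family_def)
  then show ?thesis using F_scale[of "\<lambda>i. 0" 0] by simp
qed

lemma F_diff:
  assumes "bounded_family a" "bounded_family b"
  shows "F (\<lambda>i. a i - b i) = (\<lambda>z. F a z - F b z)"
  using F_add[OF assms(1) bounded_family_scale[OF assms(2)], of "-1"] F_scale[OF assms(2), of "-1"]
  by simp

lemma norm_finite_support:
  assumes "finite A" "\<And>i. i \<notin> A \<Longrightarrow> b i = 0"
  shows "N (F b) \<le> (\<Sum>i\<in>A. cmod (b i) * N (F (unit_coord i)))"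
  using assms
proof (induction A arbitrary: b)
  case empty
  then have "b = (\<lambda>i. 0)" by auto
  then have "F b = (\<lambda>z. 0)" using F_zero by simp
  then show ?case using norm_eq_zero[OF zero_mem] by simp
next
  case (insert i A)
  have fin: "finite {j. b j \<noteq> 0}"
    by (rule finite_subset[of _ "insert i A"]) (use insert in auto)
  have u: "bounded_family (unit_coord i)"
    by (auto simp: bounded_family_def unit_coord_def intro!: exI[of _ 1])
  have bf: "bounded_family (b(i := 0))"
    by (intro bounded_family_finite_support finite_subset[OF _ fin]) auto
  have "b = (\<lambda>j. (b(i := 0)) j + b i * unit_coord i j)"
    by (auto simp: unit_coord_def)
  then have "F b = (\<lambda>z. F (b(i := 0)) z + b i * F (unit_coord i) z)"
    using F_add[OF bf bounded_family_scale[OF u]] F_scale[OF u] by metis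
  then have "N (F b) \<le> N (F (b(i := 0))) + N (\<lambda>z. b i * F (unit_coord i) z)"
    using norm_triangle[OF mem[OF bf] scale_mem[OF mem[OF u]]] by simp
  also have "N (\<lambda>z. b i * F (unit_coord i) z) = cmod (b i) * N (F (unit_coord i))"
    by (rule norm_scale[OF mem[OF u]])
  also have "N (F (b(i := 0))) \<le> (\<Sum>j\<in>A. cmod ((b(i := 0)) j) * N (F (unit_coord j)))"
    using insert by (intro insert.IH) auto
  also have "\<dots> = (\<Sum>j\<in>A. cmod (b j) * N (F (unit_coord j)))"
    using insert by (intro sum.cong) auto
  finally show ?case using insert by simp
qed

text \<open>On families supported in a fixed finite set, \<open>F\<close> is Lipschitz for a weighted
  \<open>\<ell>\<^sup>1\<close>-distance, and the bounded ones form a compact set.\<close>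

lemma finite_net:
  assumes A: "finite A" and e: "e > 0"
  shows "\<exists>K. finite K \<and> K \<subseteq> X \<and>
    (\<forall>b. (\<forall>i. i \<notin> A \<longrightarrow> b i = 0) \<and> (\<forall>i. cmod (b i) \<le> R) \<longrightarrow> (\<exists>g\<in>K. N (\<lambda>z. g z - F b z) \<le> e))"
proof -
  define S :: "('i \<Rightarrow> complex) set" where "S = Pi UNIV (\<lambda>i. if i \<in> A then cball 0 R else {0})"
  have S: "compact S" unfolding S_def by (rule compact_product) auto
  have bS: "bounded_family b" if "b \<in> S" for b
    by (intro bounded_family_finite_support finite_subset[OF _ A])
      (use that in \<open>auto simp: S_def Pi_iff split: if_splits\<close>)
  define U where "U b = {c. (\<Sum>i\<in>A. cmod (b i - c i) * N (F (unit_coord i))) < e}" for b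
  have "open (U b)" for b
    unfolding U_def by (intro open_Collect_less continuous_intros continuous_on_product_coordinates)
  moreover have "S \<subseteq> (\<Union>b\<in>S. U b)" using e by (auto simp: U_def)
  ultimately obtain C where C: "C \<subseteq> S" "finite C" "S \<subseteq> (\<Union>b\<in>C. U b)"
    using compactE_image[OF S, of S U] by metis
  have "\<exists>g\<in>F ` C. N (\<lambda>z. g z - F b z) \<le> e"
    if b: "\<And>i. i \<notin> A \<Longrightarrow> b i = 0" "\<And>i. cmod (b i) \<le> R" for b
  proof -
    have "b \<in> S" using b by (auto simp: S_def)
    then obtain c where c: "c \<in> C" "b \<in> U c" using C by blast
    have cS: "c \<in> S" using c C by auto
    have "N (F (\<lambda>i. c i - b i)) \<le> (\<Sum>i\<in>A. cmod (c i - b i) * N (F (unit_coord i)))"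
      using cS b by (intro norm_finite_support A) (auto simp: S_def Pi_iff split: if_splits)
    also have "\<dots> \<le> e" using c by (simp add: U_def)
    finally show ?thesis using F_diff[OF bS[OF cS] bS[OF \<open>b \<in> S\<close>]] c by auto
  qed
  moreover have "F ` C \<subseteq> X" using C bS mem by blast
  ultimately show ?thesis using C(2) by (intro exI[of _ "F ` C"]) auto
qed

text \<open>This is where weak compactness is used. A functional \<open>\<phi>\<close> that vanishes on all finitely
  supported values need not be continuous for pointwise convergence, but its zero set in \<open>W\<close> is
  weakly compact and so pointwise closed; it contains the finite sections of \<open>F a\<close>, hence
  \<open>F a\<close> itself. For the identity of \<open>\<ell>\<^sup>\<infinity>\<close>, which is not weakly compact, the conclusion
  fails.\<close>

lemma finite_support_norm_dense:
  assumes a: "a \<in> cube" and e: "e > 0"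
  shows "\<exists>b. finite {i. b i \<noteq> 0} \<and> N (\<lambda>z. F a z - F b z) < e"
proof (rule ccontr)
  assume far: "\<not> ?thesis"
  define M where "M = F ` {b. finite {i. b i \<noteq> 0}}"
  have "\<exists>\<phi>\<in>dual X N. (\<forall>m\<in>M. \<phi> m = 0) \<and> \<phi> (F a) \<noteq> 0"
  proof (rule separating_functional[OF _ _ _ _ mem[OF bounded_family_cube[OF a]] e])
    show "M \<subseteq> X" by (auto simp: M_def intro: mem bounded_family_finite_support)
    show "(\<lambda>z. 0) \<in> M" unfolding M_def using F_zero by (intro image_eqI[of _ _ "\<lambda>i. 0"]) auto
    show "e \<le> N (\<lambda>z. F a z - m z)" if "m \<in> M" for m
      using that far by (auto simp: M_def not_less)
    show "(\<lambda>z. f z + g z) \<in> M" if "f \<in> M" "g \<in> M" for f g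
    proof -
      obtain b c where bc: "f = F b" "g = F c" "finite {i. b i \<noteq> 0}" "finite {i. c i \<noteq> 0}"
        using \<open>f \<in> M\<close> \<open>g \<in> M\<close> by (auto simp: M_def)
      have "finite {i. b i + c i \<noteq> 0}"
        by (rule finite_subset[OF _ finite_UnI[OF bc(3,4)]]) auto
      then show ?thesis
        using F_add[OF bc(3,4)[THEN bounded_family_finite_support]] bc unfolding M_def
        by (intro image_eqI[of _ _ "\<lambda>i. b i + c i"]) auto
    qed
    show "(\<lambda>z. c * f z) \<in> M" if "f \<in> M" for f c
    proof -
      obtain b where b: "f = F b" "finite {i. b i \<noteq> 0}" using \<open>f \<in> M\<close> by (auto simp: M_def)
      have "finite {i. c * b i \<noteq> 0}"
        by (rule finite_subset[OF _ b(2)]) auto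
      then show ?thesis
        using F_scale[OF b(2)[THEN bounded_family_finite_support]] b unfolding M_def
        by (intro image_eqI[of _ _ "\<lambda>i. c * b i"]) auto
    qed
  qed
  then obtain \<phi> where \<phi>: "\<phi> \<in> dual X N" "\<And>m. m \<in> M \<Longrightarrow> \<phi> m = 0" "\<phi> (F a) \<noteq> 0" by blast
  define C where "C = {w \<in> W. \<phi> w = 0}"
  have WX: "W \<subseteq> X" using compactin_subset_topspace[OF W] by (simp add: topspace_weak_topology)
  have "closedin (weak_topology X N) {w \<in> topspace (weak_topology X N). \<phi> w \<in> {0}}"
    by (rule closedin_continuous_map_preimage[OF continuous_map_dual_weak[OF \<phi>(1)]]) simp
  then have "compactin (weak_topology X N) (W \<inter> {w \<in> X. \<phi> w \<in> {0}})"
    by (intro compact_Int_closedin W) (simp add: topspace_weak_topology)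
  moreover have "W \<inter> {w \<in> X. \<phi> w \<in> {0}} = C" using WX by (auto simp: C_def)
  ultimately have "compactin (weak_topology X N) C" by simp
  then have "compact (id ` C)"
    using image_compactin[OF _ continuous_map_weak_pointwise] by fastforce
  then have "closed C" by (simp add: compact_imp_closed_pointwise)
  then have "F a \<in> C"
  proof (rule finite_sections_dense[OF F_cont _ a])
    fix A :: "'i set" assume "finite A"
    then have "F (cut A a) \<in> M" unfolding M_def using finite_support_cut by blast
    moreover have "F (cut A a) \<in> W" using cut_cube[OF a] F_W by blast
    ultimately show "F (cut A a) \<in> C" using \<phi>(2) by (simp add: C_def)
  qed
  then show False using \<phi>(3) by (simp add: C_def)
qed

lemma closed_norm_ball_preimage:
  assumes g: "g \<in> X" and e: "e > 0"
  shows "closed {a\<in>cube. N (\<lambda>z. F a z - g z) \<le> e}"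
proof -
  define G where "G a z = complex_of_real (1 / e) * (F a z - g z)" for a z
  have "continuous_on cube (\<lambda>a. F a z)" for z
    using F_cont by (rule continuous_on_product_then_coordinatewise)
  then have G: "continuous_on cube G"
    unfolding G_def by (intro continuous_on_coordinatewise_then_product continuous_intros)
  have "N (\<lambda>z. F a z - g z) \<le> e \<longleftrightarrow> G a \<in> unit_ball X N" if a: "a \<in> cube" for a
  proof -
    have d: "(\<lambda>z. F a z - g z) \<in> X" by (intro diff_mem g mem bounded_family_cube a)
    have "N (G a) = N (\<lambda>z. F a z - g z) / e"
      unfolding G_def using norm_scale[OF d, of "complex_of_real (1 / e)"] e by (simp del: of_real_divide)
    moreover have "G a \<in> X" unfolding G_def by (rule scale_mem[OF d])
    ultimately show ?thesis using e by (simp add: unit_ball_def)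
  qed
  then have "{a\<in>cube. N (\<lambda>z. F a z - g z) \<le> e} = cube \<inter> G -` unit_ball X N" by auto
  then show ?thesis
    using continuous_closed_preimage[OF G closed_cube compact_imp_closed_pointwise[OF compact_ball]]
    by (simp add: Int_commute)
qed

text \<open>The finite nets of all finite-dimensional cubes form a countable set \<open>D\<close>, and the image of the
  cube is contained in the closed balls around \<open>D\<close>. One of them contains the image of a cylinder, and
  every family that vanishes on the base of the cylinder is a difference of two of its points.\<close>

lemma small_tails:
  assumes e: "e > 0"
  shows "\<exists>A. finite A \<and> (\<forall>x\<in>cube. (\<forall>i\<in>A. x i = 0) \<longrightarrow> N (F x) \<le> e)"
proof -
  define net where "net A n = (SOME K. finite K \<and> K \<subseteq> X \<and>
    (\<forall>b. (\<forall>i. i \<notin> A \<longrightarrow> b i = 0) \<and> (\<forall>i. cmod (b i) \<le> real n) \<longrightarrow>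
      (\<exists>g\<in>K. N (\<lambda>z. g z - F b z) \<le> e / 4)))" for A :: "'i set" and n
  have net: "finite (net A n)" "net A n \<subseteq> X"
    "\<And>b. (\<forall>i. i \<notin> A \<longrightarrow> b i = 0) \<Longrightarrow> (\<forall>i. cmod (b i) \<le> real n) \<Longrightarrow>
      \<exists>g\<in>net A n. N (\<lambda>z. g z - F b z) \<le> e / 4" if "finite A" for A n
    using someI_ex[OF finite_net[OF that, of "e / 4" "real n"]] e unfolding net_def[symmetric] by auto
  define D where "D = (\<Union>A\<in>Collect finite. \<Union>n. net A n)"
  have D: "countable D"
    unfolding D_def
    by (intro countable_UN countable_Collect_finite) (auto intro: countable_finite net)
  have DX: "D \<subseteq> X" unfolding D_def using net(2) by blast
  define E where "E g = {a\<in>cube. N (\<lambda>z. F a z - g z) \<le> e / 2}" for g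
  have "\<exists>g\<in>D. \<exists>a\<in>cube. \<exists>A. finite A \<and> (\<forall>b\<in>cube. (\<forall>i\<in>A. b i = a i) \<longrightarrow> b \<in> E g)"
  proof (rule Baire_cube[OF D])
    show "closed (E g) \<and> E g \<subseteq> cube" if "g \<in> D" for g
      unfolding E_def using closed_norm_ball_preimage[of g "e / 2"] DX that e by auto
    show "cube \<subseteq> (\<Union>g\<in>D. E g)"
    proof
      fix a :: "'i \<Rightarrow> complex" assume a: "a \<in> cube"
      obtain b where b: "finite {i. b i \<noteq> 0}" "N (\<lambda>z. F a z - F b z) < e / 4"
        using finite_support_norm_dense[OF a, of "e / 4"] e by auto
      obtain R where R: "\<And>i. cmod (b i) \<le> R"
        using bounded_family_finite_support[OF b(1)] by (auto simp: bounded_family_def)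
      obtain n where n: "R \<le> real n" using real_arch_simple by blast
      obtain g where g: "g \<in> net {i. b i \<noteq> 0} n" "N (\<lambda>z. g z - F b z) \<le> e / 4"
        using net(3)[OF b(1), of b n] R n order_trans by blast
      have gD: "g \<in> D" unfolding D_def using b(1) g(1) by blast
      have m: "F a \<in> X" "F b \<in> X" "g \<in> X"
        using mem bounded_family_cube[OF a] bounded_family_finite_support[OF b(1)] gD DX by auto
      have "N (\<lambda>z. F a z - g z) \<le> N (\<lambda>z. F a z - F b z) + N (\<lambda>z. F b z - g z)"
        using norm_triangle[OF diff_mem[OF m(1,2)] diff_mem[OF m(2,3)]] by simp
      also have "N (\<lambda>z. F b z - g z) = N (\<lambda>z. g z - F b z)"
        using norm_scale[OF diff_mem[OF m(3,2)], of "-1"] by simp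
      finally show "a \<in> (\<Union>g\<in>D. E g)" using a b g gD by (intro UN_I[of g]) (auto simp: E_def)
    qed
  qed
  then obtain g a A where g: "g \<in> D" and a: "a \<in> cube" and A: "finite A"
    and E: "\<And>b. b \<in> cube \<Longrightarrow> (\<forall>i\<in>A. b i = a i) \<Longrightarrow> b \<in> E g" by blast
  have "N (F x) \<le> e" if x: "x \<in> cube" "\<forall>i\<in>A. x i = 0" for x
  proof -
    \<comment> \<open>Two points of the cylinder through \<open>a\<close> that differ by \<open>x\<close>.\<close>
    define b where "b i = (if i \<in> A then a i else x i)" for i
    have b: "b \<in> E g" by (rule E) (use a x in \<open>auto simp: b_def cube_def\<close>)
    have c: "cut A a \<in> E g" by (rule E) (use cut_cube[OF a] in \<open>auto simp: cut_def\<close>)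
    have bc: "b \<in> cube" "cut A a \<in> cube" using b c by (auto simp: E_def)
    note m = mem[OF bounded_family_cube[OF bc(1)]] mem[OF bounded_family_cube[OF bc(2)]]
    have gX: "g \<in> X" using g DX by blast
    have "x = (\<lambda>i. b i - cut A a i)" using x by (auto simp: b_def cut_def)
    then have "F x = (\<lambda>z. F b z - F (cut A a) z)"
      using F_diff bc bounded_family_cube by metis
    then have "N (F x) \<le> N (\<lambda>z. F b z - g z) + N (\<lambda>z. g z - F (cut A a) z)"
      using norm_triangle[OF diff_mem[OF m(1) gX] diff_mem[OF gX m(2)]] by simp
    also have "N (\<lambda>z. g z - F (cut A a) z) = N (\<lambda>z. F (cut A a) z - g z)"
      using norm_scale[OF diff_mem[OF m(2) gX], of "-1"] by simp
    finally show ?thesis using b c by (simp add: E_def)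
  qed
  then show ?thesis using A by blast
qed

lemma totally_bounded_image:
  assumes e: "e > 0"
  shows "\<exists>K. finite K \<and> K \<subseteq> X \<and> (\<forall>a\<in>cube. \<exists>g\<in>K. N (\<lambda>z. g z - F a z) \<le> e)"
proof -
  obtain A where A: "finite A" "\<And>x. x \<in> cube \<Longrightarrow> (\<forall>i\<in>A. x i = 0) \<Longrightarrow> N (F x) \<le> e / 2"
    using small_tails[of "e / 2"] e by auto
  obtain K where K: "finite K" "K \<subseteq> X"
    "\<And>b. (\<forall>i. i \<notin> A \<longrightarrow> b i = 0) \<Longrightarrow> (\<forall>i. cmod (b i) \<le> 1) \<Longrightarrow> \<exists>g\<in>K. N (\<lambda>z. g z - F b z) \<le> e / 2"
    using finite_net[OF A(1), of "e / 2" 1] e by auto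
  have "\<exists>g\<in>K. N (\<lambda>z. g z - F a z) \<le> e" if a: "a \<in> cube" for a
  proof -
    have c: "cut A a \<in> cube" "cut (- A) a \<in> cube" using cut_cube[OF a] by auto
    obtain g where g: "g \<in> K" "N (\<lambda>z. g z - F (cut A a) z) \<le> e / 2"
      using K(3)[of "cut A a"] c(1) by (auto simp: cut_def cube_def)
    note m = mem[OF bounded_family_cube[OF c(1)]] mem[OF bounded_family_cube[OF c(2)]]
    have gX: "g \<in> X" using g K by blast
    have "a = (\<lambda>i. cut A a i + cut (- A) a i)" by (auto simp: cut_def)
    then have "F a = (\<lambda>z. F (cut A a) z + F (cut (- A) a) z)"
      using F_add c bounded_family_cube by metis
    then have "(\<lambda>z. g z - F a z) = (\<lambda>z. (g z - F (cut A a) z) + (-1) * F (cut (- A) a) z)"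
      by auto
    then have "N (\<lambda>z. g z - F a z)
        \<le> N (\<lambda>z. g z - F (cut A a) z) + N (\<lambda>z. (-1) * F (cut (- A) a) z)"
      using norm_triangle[OF diff_mem[OF gX m(1)] scale_mem[OF m(2), of "-1"]] by simp
    also have "N (\<lambda>z. (-1) * F (cut (- A) a) z) = N (F (cut (- A) a))"
      using norm_scale[OF m(2), of "-1"] by simp
    also have "\<dots> \<le> e / 2" by (rule A(2)[OF c(2)]) (simp add: cut_def)
    finally show ?thesis using g by (intro bexI[of _ g]) auto
  qed
  then show ?thesis using K(1,2) by blast
qed

end

text \<open>A representation of a function space as a quotient of \<open>\<ell>\<^sup>\<infinity>\<close> that respects the
  weak-star topologies: on bounded sets these are the product topology and the compact open
  topology.\<close>

definition cube_quotient ::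
    "(complex \<Rightarrow> complex) set \<Rightarrow> ((complex \<Rightarrow> complex) \<Rightarrow> real) \<Rightarrow>
     (('i \<Rightarrow> complex) \<Rightarrow> complex \<Rightarrow> complex) \<Rightarrow> real \<Rightarrow> bool" where
  "cube_quotient Z NZ P C \<longleftrightarrow>
     (\<forall>a. bounded_family a \<longrightarrow> P a \<in> Z) \<and>
     (\<forall>a b. bounded_family a \<longrightarrow> bounded_family b \<longrightarrow>
        P (\<lambda>i. a i + b i) = (\<lambda>z. P a z + P b z)) \<and>
     (\<forall>a c. bounded_family a \<longrightarrow> P (\<lambda>i. c * a i) = (\<lambda>z. c * P a z)) \<and>
     P ` cube \<subseteq> unit_ball Z NZ \<and>
     continuous_map (top_of_set cube) co_topology P \<and>
     C > 0 \<and> (\<forall>f\<in>unit_ball Z NZ. \<exists>a\<in>cube. f = (\<lambda>z. complex_of_real C * P a z))"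

lemma continuous_map_co_eval: "continuous_map co_topology euclidean (\<lambda>f. f z)"
proof (cases "z \<in> disc")
  case True
  show ?thesis
    unfolding continuous_map topspace_co_topology openin_co_topology
  proof (intro conjI allI impI)
    fix U :: "complex set" assume "openin euclidean U"
    then have U: "open U" by simp
    show "co_open {f \<in> HD. f z \<in> U}"
      unfolding co_open_def
    proof (intro conjI ballI)
      fix f assume "f \<in> {f \<in> HD. f z \<in> U}"
      then obtain e where e: "e > 0" "ball (f z) e \<subseteq> U" using U by (auto elim: openE)
      have "{g\<in>HD. \<forall>w\<in>{z}. cmod (g w - f w) < e} \<subseteq> {f \<in> HD. f z \<in> U}"
        using e(2) by (auto simp: dist_norm norm_minus_commute)
      then show "\<exists>K e. compact K \<and> K \<subseteq> disc \<and> e > 0 \<and>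
          {g\<in>HD. \<forall>w\<in>K. cmod (g w - f w) < e} \<subseteq> {f \<in> HD. f z \<in> U}"
        using True e(1) by (intro exI[of _ "{z}"] exI[of _ e]) simp
    qed auto
  qed auto
next
  case False
  have "continuous_map co_topology euclidean (\<lambda>f. 0 :: complex)" by simp
  then show ?thesis
    by (rule continuous_map_eq) (use False in \<open>auto simp: topspace_co_topology HD_def\<close>)
qed

lemma continuous_map_co_pointwise: "continuous_map co_topology euclidean id"
  unfolding euclidean_product_topology[symmetric] continuous_map_componentwise_UNIV
  using continuous_map_co_eval by simp

lemma compactin_co_imp_compact: "compactin co_topology S \<Longrightarrow> compact S"
  using image_compactin[OF _ continuous_map_co_pointwise] by fastforce

context compact_ball_space
begin

text \<open>Total boundedness passes from the image of the cube to the image of the unit ball, which is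
  contained in a multiple of it.\<close>

theorem weakly_compact_imp_compact:
  fixes P :: "('i::countable \<Rightarrow> complex) \<Rightarrow> complex \<Rightarrow> complex"
  assumes quot: "cube_quotient Z NZ P C" and T: "linear_operator Z X T"
    and cont: "continuous_map (subtopology co_topology (unit_ball Z NZ)) co_topology T"
    and weak: "weakly_compact_operator Z NZ X N T"
  shows "compact_operator Z NZ X N T"
proof -
  have PZ: "\<And>a. bounded_family a \<Longrightarrow> P a \<in> Z"
    and P_add: "\<And>a b. bounded_family a \<Longrightarrow> bounded_family b \<Longrightarrow> P (\<lambda>i. a i + b i) = (\<lambda>z. P a z + P b z)"
    and P_scale: "\<And>a c. bounded_family a \<Longrightarrow> P (\<lambda>i. c * a i) = (\<lambda>z. c * P a z)"
    and P_ball: "P ` cube \<subseteq> unit_ball Z NZ"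
    and P_cont: "continuous_map (top_of_set cube) co_topology P"
    and C: "C > 0"
    and P_onto: "\<And>f. f \<in> unit_ball Z NZ \<Longrightarrow> \<exists>a\<in>cube. f = (\<lambda>z. complex_of_real C * P a z)"
    using quot by (auto simp: cube_quotient_def)
  have TX: "\<And>f. f \<in> Z \<Longrightarrow> T f \<in> X"
    and T_add: "\<And>f g. f \<in> Z \<Longrightarrow> g \<in> Z \<Longrightarrow> T (\<lambda>z. f z + g z) = (\<lambda>z. T f z + T g z)"
    and T_scale: "\<And>f c. f \<in> Z \<Longrightarrow> T (\<lambda>z. c * f z) = (\<lambda>z. c * T f z)"
    using T by (auto simp: linear_operator_def)
  have ball_Z: "unit_ball Z NZ \<subseteq> Z" by (auto simp: unit_ball_def)
  define W where "W = weak_topology X N closure_of (T ` unit_ball Z NZ)"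
  have W: "compactin (weak_topology X N) W"
    using weak by (simp add: weakly_compact_operator_def W_def)
  have TW: "T ` unit_ball Z NZ \<subseteq> W"
    unfolding W_def using TX ball_Z by (intro closure_of_subset) (auto simp: topspace_weak_topology)
  have "continuous_map (top_of_set cube) (subtopology co_topology (unit_ball Z NZ)) P"
    using P_cont P_ball by (auto simp: continuous_map_in_subtopology)
  then have "continuous_map (top_of_set cube) euclidean (id \<circ> (T \<circ> P))"
    by (intro continuous_map_compose[OF continuous_map_compose[OF _ cont] continuous_map_co_pointwise])
  then have F_cont: "continuous_on cube (\<lambda>a. T (P a))" by (simp add: o_def)
  interpret F: weakly_compact_cube_image X N "\<lambda>a. T (P a)" W
  proof
    show "continuous_on cube (\<lambda>a. T (P a))" by (rule F_cont)
    show "compactin (weak_topology X N) W" by (rule W)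
    show "(\<lambda>a. T (P a)) ` cube \<subseteq> W" using TW P_ball by blast
  qed (simp_all add: PZ P_add P_scale TX T_add T_scale)
  have "T ` unit_ball Z NZ \<subseteq> X" using TX ball_Z by auto
  then show ?thesis
    unfolding compact_operator_def
  proof (rule totally_bounded_imp_compact)
    fix e :: real assume e: "e > 0"
    obtain K where K: "finite K" "K \<subseteq> X" "\<And>a. a \<in> cube \<Longrightarrow> \<exists>g\<in>K. N (\<lambda>z. g z - T (P a) z) \<le> e / C"
      using F.totally_bounded_image[of "e / C"] e C by auto
    have "\<exists>g\<in>(\<lambda>g z. complex_of_real C * g z) ` K. N (\<lambda>z. g z - T f z) \<le> e"
      if f: "f \<in> unit_ball Z NZ" for f
    proof -
      obtain a where a: "a \<in> cube" "f = (\<lambda>z. complex_of_real C * P a z)" using P_onto[OF f] by blast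
      obtain g where g: "g \<in> K" "N (\<lambda>z. g z - T (P a) z) \<le> e / C" using K(3)[OF a(1)] by blast
      have m: "P a \<in> Z" by (intro PZ bounded_family_cube a)
      have d: "(\<lambda>z. g z - T (P a) z) \<in> X" using g K TX[OF m] by (intro diff_mem) auto
      have "T f = (\<lambda>z. complex_of_real C * T (P a) z)"
        unfolding a(2) by (rule T_scale[OF m])
      then have "(\<lambda>z. complex_of_real C * g z - T f z)
          = (\<lambda>z. complex_of_real C * (g z - T (P a) z))"
        by (simp add: algebra_simps)
      then have "N (\<lambda>z. complex_of_real C * g z - T f z) \<le> e"
        using norm_scale[OF d, of "complex_of_real C"] g(2) C by (simp add: field_simps)
      then show ?thesis using g(1) by (intro bexI[OF _ imageI]) auto
    qed
    then show "\<exists>K. finite K \<and> K \<subseteq> X \<and> (\<forall>f\<in>T ` unit_ball Z NZ. \<exists>g\<in>K. N (\<lambda>z. g z - f z) \<le> e)"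
      using K by (intro exI[of _ "(\<lambda>g z. complex_of_real C * g z) ` K"]) (auto intro: scale_mem)
  qed
qed

theorem compact_iff_weakly_compact:
  fixes P :: "('i::countable \<Rightarrow> complex) \<Rightarrow> complex \<Rightarrow> complex"
  assumes "cube_quotient Z NZ P C" and T: "linear_operator Z X T"
    and "continuous_map (subtopology co_topology (unit_ball Z NZ)) co_topology T"
  shows "compact_operator Z NZ X N T \<longleftrightarrow> weakly_compact_operator Z NZ X N T"
proof
  have "T ` unit_ball Z NZ \<subseteq> X" using T by (auto simp: linear_operator_def unit_ball_def)
  then show "compact_operator Z NZ X N T \<Longrightarrow> weakly_compact_operator Z NZ X N T"
    unfolding compact_operator_def weakly_compact_operator_def by (rule compact_imp_weakly_compact)
qed (rule weakly_compact_imp_compact[OF assms])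

end

section \<open>Kernels sampled at roots of unity and delayed means\<close>

lemma sum_rotate:
  "(\<Sum>j\<in>A. \<Sum>a\<in>B. \<Sum>b\<in>C. f j a b) = (\<Sum>a\<in>B. \<Sum>b\<in>C. \<Sum>j\<in>A. f j a b)"
proof -
  have "(\<Sum>j\<in>A. \<Sum>a\<in>B. \<Sum>b\<in>C. f j a b) = (\<Sum>a\<in>B. \<Sum>j\<in>A. \<Sum>b\<in>C. f j a b)"
    by (rule sum.swap)
  also have "\<dots> = (\<Sum>a\<in>B. \<Sum>b\<in>C. \<Sum>j\<in>A. f j a b)"
    by (intro sum.cong refl sum.swap)
  finally show ?thesis .
qed

definition geom :: "nat \<Rightarrow> complex \<Rightarrow> complex" where
  "geom n u = (\<Sum>i<n. u ^ i)"

lemma geom_mult: "geom n u * geom L u = (\<Sum>a<n. \<Sum>b<L. u ^ (a + b))"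
  unfolding geom_def by (simp only: sum_product power_add)

definition unity_root :: "nat \<Rightarrow> nat \<Rightarrow> complex" where
  "unity_root M j = exp (2 * of_real pi * \<i> * of_nat j / of_nat M)"

lemma norm_unity_root [simp]: "cmod (unity_root M j) = 1"
proof -
  have "2 * of_real pi * \<i> * of_nat j / of_nat M = \<i> * of_real (2 * pi * real j / real M)"
    by simp
  then show ?thesis unfolding unity_root_def using norm_exp_i_times by metis
qed

lemma unity_root_orthogonal:
  assumes "i < M" "l < M"
  shows "(\<Sum>j<M. unity_root M j ^ i * cnj (unity_root M j) ^ l) = (if i = l then of_nat M else 0)"
proof -
  define x where "x = unity_root M i / unity_root M l"
  have M: "M \<noteq> 0" using assms by simp
  have ur: "unity_root M j ^ i = unity_root M i ^ j" for i j
    by (simp add: unity_root_def mult_ac flip: exp_of_nat_mult)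
  have inv: "cnj (unity_root M j) = 1 / unity_root M j" for j
    using complex_div_cnj[of 1 "unity_root M j"] by simp
  have "unity_root M j ^ i * cnj (unity_root M j) ^ l = x ^ j" for j
    unfolding inv x_def power_divide by (simp add: ur power_one_over)
  then have eq: "(\<Sum>j<M. unity_root M j ^ i * cnj (unity_root M j) ^ l) = (\<Sum>j<M. x ^ j)"
    by simp
  show ?thesis
  proof (cases "i = l")
    case True
    then have "x = 1" by (simp add: x_def unity_root_def)
    then show ?thesis using eq True by simp
  next
    case False
    have "unity_root M i \<noteq> unity_root M l"
      using complex_root_unity_eq[of M i l] M assms False
      by (simp add: unity_root_def cong_def)
    then have "x \<noteq> 1" by (simp add: x_def unity_root_def)
    moreover have "x ^ M = 1"
      unfolding x_def power_divide unity_root_def using complex_root_unity[OF M] by simp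
    ultimately show ?thesis
      using eq False by (simp add: sum_gp_strict)
  qed
qed

text \<open>Discrete Fourier inversion: \<open>M\<close> samples determine the coefficients of a polynomial of degree
  below \<open>M\<close>.\<close>

lemma unity_root_coefficient:
  assumes "d \<le> M" "l < M"
  shows "(\<Sum>j<M. (\<Sum>i<d. c i * unity_root M j ^ i) * cnj (unity_root M j) ^ l)
    = of_nat M * (if l < d then c l else 0)"
proof -
  have "(\<Sum>j<M. (\<Sum>i<d. c i * unity_root M j ^ i) * cnj (unity_root M j) ^ l)
      = (\<Sum>j<M. \<Sum>i<d. c i * (unity_root M j ^ i * cnj (unity_root M j) ^ l))"
    by (simp add: sum_distrib_right mult.assoc)
  also have "\<dots> = (\<Sum>i<d. c i * (\<Sum>j<M. unity_root M j ^ i * cnj (unity_root M j) ^ l))"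
    by (subst sum.swap) (simp add: sum_distrib_left)
  also have "\<dots> = (\<Sum>i<d. if i = l then of_nat M * c i else 0)"
    using assms by (intro sum.cong) (auto simp: unity_root_orthogonal)
  also have "\<dots> = of_nat M * (if l < d then c l else 0)" by simp
  finally show ?thesis .
qed

lemma geom_parseval:
  assumes "n \<le> M"
  shows "(\<Sum>j<M. cmod (geom n (u * cnj (unity_root M j))) ^ 2) = real M * (\<Sum>i<n. cmod u ^ (2 * i))"
proof -
  have "complex_of_real (cmod (geom n (u * cnj (unity_root M j))) ^ 2)
      = (\<Sum>l<n. u ^ l * ((\<Sum>i<n. cnj u ^ i * unity_root M j ^ i) * cnj (unity_root M j) ^ l))" for j
  proof -
    have "complex_of_real (cmod (geom n (u * cnj (unity_root M j))) ^ 2)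
        = geom n (u * cnj (unity_root M j)) * cnj (geom n (u * cnj (unity_root M j)))"
      by (simp only: complex_norm_square)
    also have "cnj (geom n (u * cnj (unity_root M j))) = (\<Sum>i<n. cnj u ^ i * unity_root M j ^ i)"
      by (simp add: geom_def power_mult_distrib)
    finally show ?thesis
      by (simp add: geom_def power_mult_distrib sum_distrib_right mult_ac)
  qed
  then have "complex_of_real (\<Sum>j<M. cmod (geom n (u * cnj (unity_root M j))) ^ 2)
      = (\<Sum>j<M. \<Sum>l<n. u ^ l * ((\<Sum>i<n. cnj u ^ i * unity_root M j ^ i) * cnj (unity_root M j) ^ l))"
    by (simp only: of_real_sum)
  also have "\<dots> = (\<Sum>l<n. u ^ l * (\<Sum>j<M. (\<Sum>i<n. cnj u ^ i * unity_root M j ^ i) * cnj (unity_root M j) ^ l))"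
    by (subst sum.swap) (simp only: sum_distrib_left)
  also have "\<dots> = (\<Sum>l<n. u ^ l * (of_nat M * cnj u ^ l))"
    using assms by (intro sum.cong refl) (subst unity_root_coefficient, auto)
  also have "\<dots> = (\<Sum>l<n. of_nat M * (u * cnj u) ^ l)"
    by (simp add: power_mult_distrib mult_ac)
  also have "\<dots> = complex_of_real (real M * (\<Sum>i<n. cmod u ^ (2 * i)))"
    by (simp add: sum_distrib_left power_mult flip: complex_norm_square)
  finally show ?thesis by (simp only: of_real_eq_iff)
qed

text \<open>The inequality of the arithmetic and geometric mean reduces the absolute mean of the product to
  the quadratic means, which are computed by Parseval's identity.\<close>

lemma geom_product_mean:
  assumes "n \<le> M" "L \<le> M"
  shows "(\<Sum>j<M. cmod (geom n (u * cnj (unity_root M j))) * cmod (geom L (u * cnj (unity_root M j))))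
    \<le> real M * ((\<Sum>i<n. cmod u ^ (2 * i)) + (\<Sum>i<L. cmod u ^ (2 * i))) / 2"
proof -
  have am: "x * y \<le> (x ^ 2 + y ^ 2) / 2" for x y :: real
    using sum_squares_bound[of x y] by simp
  have "(\<Sum>j<M. cmod (geom n (u * cnj (unity_root M j))) * cmod (geom L (u * cnj (unity_root M j))))
      \<le> (\<Sum>j<M. (cmod (geom n (u * cnj (unity_root M j))) ^ 2
          + cmod (geom L (u * cnj (unity_root M j))) ^ 2) / 2)"
    by (intro sum_mono am)
  also have "\<dots> = ((\<Sum>j<M. cmod (geom n (u * cnj (unity_root M j))) ^ 2)
          + (\<Sum>j<M. cmod (geom L (u * cnj (unity_root M j))) ^ 2)) / 2"
    by (simp only: sum_divide_distrib[symmetric] sum.distrib)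
  finally show ?thesis by (simp only: geom_parseval[OF assms(1)] geom_parseval[OF assms(2)] distrib_left)
qed

text \<open>The coefficients form a trapezoid: they rise linearly from index \<open>m\<close>, equal \<open>1\<close> from
  \<open>m + n - 1\<close> to \<open>m + L - 1\<close> (for \<open>n \<le> L\<close>), and then descend. The product form keeps the mean of the absolute value
  bounded in terms of \<open>L / n\<close>, in contrast to a sharp cutoff.\<close>

definition plateau_kernel :: "nat \<Rightarrow> nat \<Rightarrow> nat \<Rightarrow> complex \<Rightarrow> complex" where
  "plateau_kernel m n L u = u ^ m * geom n u * geom L u / of_nat n"

text \<open>For each shift \<open>a < n\<close> the window \<open>[m + a, m + a + L)\<close> contains every frequency at which \<open>c\<close> does
  not vanish, so each of the \<open>n\<close> windows that make up the trapezoid reproduces the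
  polynomial. The samples are taken on the circle of radius \<open>|\<rho>|\<close>.\<close>

lemma plateau_kernel_reproduces:
  assumes "n > 0" "d \<le> m + L" "m + n + L \<le> M" "\<rho> \<noteq> 0"
    and c: "\<And>i. i + 1 < m + n \<Longrightarrow> c i = 0"
  shows "(\<Sum>j<M. (\<Sum>i<d. c i * (\<rho> * unity_root M j) ^ i) * plateau_kernel m n L (z * cnj (unity_root M j) / \<rho>))
    = of_nat M * (\<Sum>i<d. c i * z ^ i)"
proof -
  let ?w = "unity_root M"
  let ?p = "\<lambda>j. \<Sum>i<d. c i * (\<rho> * ?w j) ^ i"
  define c' where "c' i = (if i < d then c i * z ^ i else 0)" for i
  have expand: "plateau_kernel m n L (z * cnj (?w j) / \<rho>)
      = (\<Sum>a<n. \<Sum>b<L. (z / \<rho>) ^ (m + a + b) * cnj (?w j) ^ (m + a + b)) / of_nat n" for j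
  proof -
    have u: "z * cnj (?w j) / \<rho> = (z / \<rho>) * cnj (?w j)" by simp
    have prod: "x ^ m * geom n x * geom L x = (\<Sum>a<n. \<Sum>b<L. x ^ (m + a + b))" for x
      by (simp only: mult.assoc geom_mult sum_distrib_left) (simp only: power_add mult.assoc)
    show ?thesis
      unfolding plateau_kernel_def u prod by (simp only: power_mult_distrib)
  qed
  have coeff: "(\<Sum>j<M. ?p j * ((z / \<rho>) ^ l * cnj (?w j) ^ l)) = of_nat M * c' l" if l: "l < M" for l
  proof -
    have "(\<Sum>j<M. ?p j * ((z / \<rho>) ^ l * cnj (?w j) ^ l))
        = (z / \<rho>) ^ l * (\<Sum>j<M. (\<Sum>i<d. (c i * \<rho> ^ i) * ?w j ^ i) * cnj (?w j) ^ l)"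
      by (simp add: sum_distrib_left power_mult_distrib mult_ac)
    also have "\<dots> = (z / \<rho>) ^ l * (of_nat M * (if l < d then c l * \<rho> ^ l else 0))"
      using assms l by (subst unity_root_coefficient) auto
    also have "\<dots> = of_nat M * c' l"
      using assms(4) by (simp add: c'_def power_divide)
    finally show ?thesis .
  qed
  have window: "(\<Sum>b<L. c' (m + a + b)) = (\<Sum>i<d. c i * z ^ i)" if a: "a < n" for a
  proof -
    have "(\<Sum>b<L. c' (m + a + b)) = (\<Sum>i\<in>{m + a..<m + a + L}. c' i)"
      by (rule sum.reindex_bij_witness[of _ "\<lambda>i. i - (m + a)" "\<lambda>b. m + a + b"]) auto
    also have "\<dots> = (\<Sum>i<d. c' i)"
      using a assms(2) by (intro sum.mono_neutral_cong) (auto simp: c'_def c)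
    also have "\<dots> = (\<Sum>i<d. c i * z ^ i)" by (simp add: c'_def)
    finally show ?thesis .
  qed
  have "(\<Sum>j<M. ?p j * plateau_kernel m n L (z * cnj (?w j) / \<rho>))
      = (\<Sum>j<M. \<Sum>a<n. \<Sum>b<L. ?p j * ((z / \<rho>) ^ (m + a + b) * cnj (?w j) ^ (m + a + b))) / of_nat n"
    by (simp only: expand times_divide_eq_right sum_distrib_left sum_divide_distrib)
  also have "(\<Sum>j<M. \<Sum>a<n. \<Sum>b<L. ?p j * ((z / \<rho>) ^ (m + a + b) * cnj (?w j) ^ (m + a + b)))
      = (\<Sum>a<n. \<Sum>b<L. \<Sum>j<M. ?p j * ((z / \<rho>) ^ (m + a + b) * cnj (?w j) ^ (m + a + b)))"
    by (rule sum_rotate)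
  also have "\<dots> = (\<Sum>a<n. \<Sum>b<L. of_nat M * c' (m + a + b))"
    using assms(3) by (intro sum.cong refl coeff) auto
  also have "\<dots> = (\<Sum>a<n. of_nat M * (\<Sum>i<d. c i * z ^ i))"
    by (intro sum.cong refl) (simp add: window flip: sum_distrib_left)
  also have "\<dots> / of_nat n = of_nat M * (\<Sum>i<d. c i * z ^ i)"
    using assms(1) by simp
  finally show ?thesis .
qed

text \<open>The bound allows \<open>u\<close> to lie slightly outside of the unit disc, since
  the atoms below evaluate the kernel at \<open>z / \<rho>\<close>.\<close>

lemma plateau_kernel_mean:
  assumes "n > 0" "n \<le> L" "L \<le> M" "t \<ge> 1" "cmod u \<le> t"
  shows "(\<Sum>j<M. cmod (plateau_kernel m n L (u * cnj (unity_root M j))))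
    \<le> real M * cmod u ^ m * (real L / real n) * t ^ (2 * L)"
proof -
  have gb: "(\<Sum>i<q. cmod u ^ (2 * i)) \<le> real L * t ^ (2 * L)" if "q \<le> L" for q
  proof -
    have "(\<Sum>i<q. cmod u ^ (2 * i)) \<le> (\<Sum>i<q. t ^ (2 * L))"
    proof (rule sum_mono)
      fix i assume "i \<in> {..<q}"
      then have "t ^ (2 * i) \<le> t ^ (2 * L)" using that assms(4) by (intro power_increasing) auto
      then show "cmod u ^ (2 * i) \<le> t ^ (2 * L)" using power_mono[OF assms(5), of "2 * i"] by simp
    qed
    also have "\<dots> = real q * t ^ (2 * L)" by simp
    also have "\<dots> \<le> real L * t ^ (2 * L)"
      using that assms(4) by (intro mult_right_mono) auto
    finally show ?thesis .
  qed
  have "(\<Sum>j<M. cmod (plateau_kernel m n L (u * cnj (unity_root M j))))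
      = cmod u ^ m / real n *
        (\<Sum>j<M. cmod (geom n (u * cnj (unity_root M j))) * cmod (geom L (u * cnj (unity_root M j))))"
    unfolding plateau_kernel_def
    by (simp add: norm_mult norm_divide norm_power sum_distrib_left mult_ac)
  also have "\<dots> \<le> cmod u ^ m / real n *
      (real M * ((\<Sum>i<n. cmod u ^ (2 * i)) + (\<Sum>i<L. cmod u ^ (2 * i))) / 2)"
    using assms by (intro mult_left_mono geom_product_mean) auto
  also have "\<dots> \<le> cmod u ^ m / real n * (real M * (real L * t ^ (2 * L) + real L * t ^ (2 * L)) / 2)"
    using assms gb[of n] gb[of L]
    by (intro mult_left_mono divide_right_mono add_mono) auto
  finally show ?thesis by (simp add: mult_ac)
qed

text \<open>The de la Vallee Poussin mean: the average of the partial sums of lengths \<open>N + 1, \<dots>, 2 N\<close>.\<close>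

definition delayed_mean :: "(nat \<Rightarrow> complex) \<Rightarrow> nat \<Rightarrow> complex \<Rightarrow> complex" where
  "delayed_mean c N z = (\<Sum>a<N. \<Sum>i<2 * N - a. c i * z ^ i) / of_nat N"

text \<open>The mean is the convolution of the polynomial with
  \<open>u\<^bsup>-(N-1)\<^esup> geom N u * geom (2 N) u / N\<close>, whose plateau covers the frequencies from \<open>0\<close>
  to \<open>N\<close>. On the unit circle this kernel has absolute mean at most \<open>(N + 2 N) / (2 N) = 3 / 2\<close>.\<close>

lemma delayed_mean_poly_bound:
  assumes N: "N > 0" and d: "2 * N \<le> d"
    and S: "\<And>\<zeta>. cmod \<zeta> = cmod z \<Longrightarrow> cmod (\<Sum>i<d. c i * \<zeta> ^ i) \<le> S"
  shows "cmod (delayed_mean c N z) \<le> 3 / 2 * S"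
proof -
  \<comment> \<open>More points than the degree of the shifted polynomial and of the kernel: no aliasing.\<close>
  define M where "M = d + 3 * N"
  let ?w = "unity_root M"
  let ?p = "\<lambda>j. \<Sum>i<d. c i * (z * ?w j) ^ i"
  have M: "M > 0" "N \<le> M" "2 * N \<le> M" using N by (auto simp: M_def)
  have coeff: "(\<Sum>j<M. ?p j * ?w j ^ (N - 1) * cnj (?w j) ^ l)
      = of_nat M * (if N - 1 \<le> l then c (l - (N - 1)) * z ^ (l - (N - 1)) else 0)"
    if l: "l < d + (N - 1)" for l
  proof -
    define e where "e i = (if N - 1 \<le> i then c (i - (N - 1)) * z ^ (i - (N - 1)) else 0)" for i
    have "?p j * ?w j ^ (N - 1) = (\<Sum>i<d + (N - 1). e i * ?w j ^ i)" for j
    proof -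
      have "?p j * ?w j ^ (N - 1) = (\<Sum>i<d. e (i + (N - 1)) * ?w j ^ (i + (N - 1)))"
        by (simp add: e_def sum_distrib_right power_mult_distrib power_add mult.assoc)
      also have "\<dots> = (\<Sum>i\<in>{N - 1..<d + (N - 1)}. e i * ?w j ^ i)"
        by (rule sum.reindex_bij_witness[of _ "\<lambda>i. i - (N - 1)" "\<lambda>i. i + (N - 1)"]) auto
      also have "\<dots> = (\<Sum>i<d + (N - 1). e i * ?w j ^ i)"
        by (intro sum.mono_neutral_left) (auto simp: e_def)
      finally show ?thesis .
    qed
    then have "(\<Sum>j<M. ?p j * ?w j ^ (N - 1) * cnj (?w j) ^ l)
        = (\<Sum>j<M. (\<Sum>i<d + (N - 1). e i * ?w j ^ i) * cnj (?w j) ^ l)" by simp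
    also have "\<dots> = of_nat M * (if l < d + (N - 1) then e l else 0)"
      by (rule unity_root_coefficient) (use l M_def in auto)
    finally show ?thesis using l by (simp add: e_def)
  qed
  have window: "(\<Sum>b<2 * N. if N - 1 \<le> a + b then c (a + b - (N - 1)) * z ^ (a + b - (N - 1)) else 0)
      = (\<Sum>i<2 * N - (N - 1 - a). c i * z ^ i)" if a: "a < N" for a
  proof -
    have "(\<Sum>b<2 * N. if N - 1 \<le> a + b then c (a + b - (N - 1)) * z ^ (a + b - (N - 1)) else 0)
        = (\<Sum>b\<in>{N - 1 - a..<2 * N}. c (a + b - (N - 1)) * z ^ (a + b - (N - 1)))"
      by (intro sum.mono_neutral_cong_right) auto
    also have "\<dots> = (\<Sum>i<2 * N - (N - 1 - a). c i * z ^ i)"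
      using a by (intro sum.reindex_bij_witness[of _ "\<lambda>i. i + (N - 1 - a)" "\<lambda>b. b - (N - 1 - a)"])
        (auto simp: add.commute)
    finally show ?thesis .
  qed
  have "(\<Sum>j<M. ?p j * ?w j ^ (N - 1) * (geom N (cnj (?w j)) * geom (2 * N) (cnj (?w j))))
      = (\<Sum>j<M. \<Sum>a<N. \<Sum>b<2 * N. ?p j * ?w j ^ (N - 1) * cnj (?w j) ^ (a + b))"
    by (simp only: geom_mult sum_distrib_left)
  also have "\<dots> = (\<Sum>a<N. \<Sum>b<2 * N. \<Sum>j<M. ?p j * ?w j ^ (N - 1) * cnj (?w j) ^ (a + b))"
    by (rule sum_rotate)
  also have "\<dots> = (\<Sum>a<N. \<Sum>b<2 * N. of_nat M *
      (if N - 1 \<le> a + b then c (a + b - (N - 1)) * z ^ (a + b - (N - 1)) else 0))"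
    using d by (intro sum.cong refl coeff) auto
  also have "\<dots> = (\<Sum>a<N. of_nat M * (\<Sum>i<2 * N - (N - 1 - a). c i * z ^ i))"
    by (intro sum.cong refl) (simp only: window sum_distrib_left[symmetric] lessThan_iff)
  also have "\<dots> = of_nat M * (\<Sum>a<N. \<Sum>i<2 * N - (N - 1 - a). c i * z ^ i)"
    by (simp only: sum_distrib_left)
  also have "(\<Sum>a<N. \<Sum>i<2 * N - (N - 1 - a). c i * z ^ i) = (\<Sum>a<N. \<Sum>i<2 * N - a. c i * z ^ i)"
    using sum.nat_diff_reindex[of "\<lambda>a. \<Sum>i<2 * N - a. c i * z ^ i" N] by simp
  also have "\<dots> = of_nat N * delayed_mean c N z" using N by (simp add: delayed_mean_def)
  finally have eq: "of_nat M * (of_nat N * delayed_mean c N z)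
      = (\<Sum>j<M. ?p j * ?w j ^ (N - 1) * (geom N (cnj (?w j)) * geom (2 * N) (cnj (?w j))))" ..
  have "real M * (real N * cmod (delayed_mean c N z))
      = cmod (of_nat M * (of_nat N * delayed_mean c N z))" by (simp add: norm_mult)
  also have "\<dots> \<le> (\<Sum>j<M. cmod (?p j * ?w j ^ (N - 1) * (geom N (cnj (?w j)) * geom (2 * N) (cnj (?w j)))))"
    unfolding eq by (rule norm_sum)
  also have "\<dots> \<le> (\<Sum>j<M. S * (cmod (geom N (cnj (?w j))) * cmod (geom (2 * N) (cnj (?w j)))))"
  proof (rule sum_mono)
    fix j
    have "cmod (?p j) \<le> S" by (rule S) (simp add: norm_mult)
    then show "cmod (?p j * ?w j ^ (N - 1) * (geom N (cnj (?w j)) * geom (2 * N) (cnj (?w j))))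
        \<le> S * (cmod (geom N (cnj (?w j))) * cmod (geom (2 * N) (cnj (?w j))))"
      by (simp add: norm_mult norm_power mult_right_mono)
  qed
  also have "\<dots> = S * (\<Sum>j<M. cmod (geom N (1 * cnj (?w j))) * cmod (geom (2 * N) (1 * cnj (?w j))))"
    by (simp add: sum_distrib_left)
  also have "\<dots> \<le> S * (real M * ((\<Sum>i<N. cmod 1 ^ (2 * i)) + (\<Sum>i<2 * N. cmod 1 ^ (2 * i))) / 2)"
    using order_trans[OF norm_ge_zero S[OF refl]] M by (intro mult_left_mono geom_product_mean) auto
  also have "\<dots> = real M * (real N * (3 / 2 * S))" by simp
  finally show ?thesis using M N by simp
qed

text \<open>Long Taylor polynomials have the same delayed mean as the series and nearly the same maximum on
  the circle.\<close>

lemma delayed_mean_bound: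
  assumes N: "N > 0" and c: "summable (\<lambda>i. cmod (c i) * cmod z ^ i)"
    and S: "\<And>\<zeta>. cmod \<zeta> = cmod z \<Longrightarrow> cmod (\<Sum>i. c i * \<zeta> ^ i) \<le> S"
  shows "cmod (delayed_mean c N z) \<le> 3 / 2 * S"
proof -
  define R where "R d = (\<Sum>i. cmod (c (i + d)) * cmod z ^ (i + d))" for d
  have "R \<longlonglongrightarrow> 0" unfolding R_def by (rule suminf_exist_split2[OF c])
  then have lim: "(\<lambda>d. 3 / 2 * (S + R d)) \<longlonglongrightarrow> 3 / 2 * (S + 0)"
    by (intro tendsto_intros)
  have "cmod (delayed_mean c N z) \<le> 3 / 2 * (S + R d)" if d: "d \<ge> 2 * N" for d
  proof (rule delayed_mean_poly_bound[OF N d])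
    fix \<zeta> assume z: "cmod \<zeta> = cmod z"
    have s: "summable (\<lambda>i. cmod (c i * \<zeta> ^ i))" using c z by (simp add: norm_mult norm_power)
    have "(\<Sum>i. c i * \<zeta> ^ i) = (\<Sum>i. c (i + d) * \<zeta> ^ (i + d)) + (\<Sum>i<d. c i * \<zeta> ^ i)"
      by (rule suminf_split_initial_segment[OF summable_norm_cancel[OF s]])
    then have "cmod (\<Sum>i<d. c i * \<zeta> ^ i)
        \<le> cmod (\<Sum>i. c i * \<zeta> ^ i) + cmod (\<Sum>i. c (i + d) * \<zeta> ^ (i + d))"
      by (metis add_diff_cancel_left' norm_triangle_ineq4)
    also have "cmod (\<Sum>i. c (i + d) * \<zeta> ^ (i + d)) \<le> (\<Sum>i. cmod (c (i + d) * \<zeta> ^ (i + d)))"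
      using summable_ignore_initial_segment[OF s, of d] by (rule summable_norm)
    also have "\<dots> = R d" by (simp add: R_def norm_mult norm_power z)
    finally show "cmod (\<Sum>i<d. c i * \<zeta> ^ i) \<le> S + R d" using S[OF z] by simp
  qed
  then have "\<forall>\<^sub>F d in sequentially. cmod (delayed_mean c N z) \<le> 3 / 2 * (S + R d)"
    unfolding eventually_sequentially by blast
  then show ?thesis using tendsto_lowerbound[OF lim] by simp
qed

lemma delayed_mean_tendsto:
  assumes "(\<lambda>i. c i * z ^ i) sums s" and N: "filterlim N at_top sequentially"
  shows "(\<lambda>k. delayed_mean c (N k) z) \<longlonglongrightarrow> s"
proof (rule LIMSEQ_I)
  fix e :: real assume e: "e > 0"
  have "(\<lambda>n. \<Sum>i<n. c i * z ^ i) \<longlonglongrightarrow> s" using assms(1) by (simp add: sums_def)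
  then obtain n0 where n0: "\<And>n. n \<ge> n0 \<Longrightarrow> cmod ((\<Sum>i<n. c i * z ^ i) - s) < e / 2"
    using LIMSEQ_D[of _ s "e / 2"] e by auto
  have "\<forall>\<^sub>F k in sequentially. N k \<ge> Suc n0"
    using N unfolding filterlim_at_top by blast
  then obtain k0 where k0: "\<And>k. k \<ge> k0 \<Longrightarrow> N k \<ge> Suc n0" by (auto simp: eventually_sequentially)
  have "cmod (delayed_mean c (N k) z - s) < e" if k: "k \<ge> k0" for k
  proof -
    have pos: "N k > 0" "N k \<ge> n0" using k0[OF k] by auto
    have "delayed_mean c (N k) z - s = (\<Sum>a<N k. (\<Sum>i<2 * N k - a. c i * z ^ i) - s) / of_nat (N k)"
      using pos by (simp add: delayed_mean_def sum_subtractf field_simps)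
    then have "cmod (delayed_mean c (N k) z - s)
        \<le> (\<Sum>a<N k. cmod ((\<Sum>i<2 * N k - a. c i * z ^ i) - s)) / real (N k)"
      by (simp add: norm_divide divide_right_mono norm_sum)
    also have "\<dots> \<le> (\<Sum>a<N k. e / 2) / real (N k)"
      using pos by (intro divide_right_mono sum_mono less_imp_le n0) auto
    also have "\<dots> < e" using pos e by simp
    finally show ?thesis .
  qed
  then show "\<exists>k0. \<forall>k\<ge>k0. cmod (delayed_mean c (N k) z - s) < e" by blast
qed

lemma delayed_mean_coefficients:
  assumes "N > 0"
  shows "\<exists>\<mu>. (\<forall>i\<le>N. \<mu> i = 1) \<and> (\<forall>i\<ge>2 * N. \<mu> i = 0) \<and>
    (\<forall>d c z. 2 * N \<le> d \<longrightarrow> delayed_mean c N z = (\<Sum>i<d. \<mu> i * c i * z ^ i))"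
proof -
  define \<mu> :: "nat \<Rightarrow> complex" where "\<mu> i = (\<Sum>a<N. if i < 2 * N - a then 1 else 0) / of_nat N" for i
  have "delayed_mean c N z = (\<Sum>i<d. \<mu> i * c i * z ^ i)" if d: "2 * N \<le> d" for d c z
  proof -
    have "(\<Sum>a<N. \<Sum>i<2 * N - a. c i * z ^ i)
        = (\<Sum>a<N. \<Sum>i<d. (if i < 2 * N - a then 1 else 0) * (c i * z ^ i))"
      using d by (intro sum.cong refl sum.mono_neutral_cong_left) auto
    also have "\<dots> = (\<Sum>i<d. (\<Sum>a<N. if i < 2 * N - a then 1 else 0) * (c i * z ^ i))"
      by (subst sum.swap) (simp only: sum_distrib_right)
    finally show ?thesis 
      by (simp only: delayed_mean_def \<mu>_def sum_divide_distrib[where A = "{..<d}"]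
          times_divide_eq_left mult.assoc)
  qed
  moreover have "\<mu> i = 1" if "i \<le> N" for i
  proof -
    have "(\<Sum>a<N. if i < 2 * N - a then 1 else 0) = (\<Sum>a<N. 1 :: complex)"
      using that by (intro sum.cong) auto
    then show ?thesis using assms by (simp add: \<mu>_def)
  qed
  moreover have "\<mu> i = 0" if "i \<ge> 2 * N" for i
    using that by (auto simp: \<mu>_def intro!: sum.neutral)
  ultimately show ?thesis by blast
qed

section \<open>Sums over dyadic radii of a normal weight\<close>

text \<open>The shift by one keeps the radius of the first block away from \<open>0\<close>.\<close>

definition block_radius :: "nat \<Rightarrow> real" where
  "block_radius k = 1 - (1 / 2) ^ (k + 1)"

definition block_order :: "nat \<Rightarrow> nat" where
  "block_order k = (if k = 0 then 0 else 2 ^ (k - 1))"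

text \<open>Writing \<open>s n\<close> for the sum, the contraction gives \<open>s (n + q) \<le> \<theta> * s n + q\<close>, so that the
  bound \<open>q / (1 - \<theta>)\<close> propagates.\<close>

lemma ratio_sums_bounded:
  fixes w :: "nat \<Rightarrow> real"
  assumes pos: "\<And>n. w n > 0" and dec: "\<And>m n. m \<le> n \<Longrightarrow> w n \<le> w m"
    and \<theta>: "0 \<le> \<theta>" "\<theta> < 1" and contr: "\<And>n. n \<ge> n0 \<Longrightarrow> w (n + q) \<le> \<theta> * w n"
  shows "\<exists>B. \<forall>n. (\<Sum>k\<le>n. w n / w k) \<le> B"
proof -
  define s where "s n = (\<Sum>k\<le>n. w n / w k)" for n
  have q: "q > 0"
  proof (rule ccontr)
    assume "\<not> q > 0"
    then have "w n0 \<le> \<theta> * w n0" using contr[of n0] by simp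
    then show False using pos[of n0] \<theta> by simp
  qed
  have step: "s (n + q) \<le> \<theta> * s n + real q" if n: "n \<ge> n0" for n
  proof -
    have "s (n + q) = (\<Sum>k\<le>n. w (n + q) / w k) + (\<Sum>k\<in>{n<..n + q}. w (n + q) / w k)"
    proof -
      have "{..n + q} = {..n} \<union> {n<..n + q}" by auto
      then show ?thesis unfolding s_def by (simp add: sum.union_disjoint ivl_disj_int)
    qed
    also have "(\<Sum>k\<le>n. w (n + q) / w k) \<le> (\<Sum>k\<le>n. \<theta> * w n / w k)"
      using contr[OF n] pos by (intro sum_mono divide_right_mono) (auto intro: less_imp_le)
    also have "\<dots> = \<theta> * s n" by (simp add: s_def sum_distrib_left)
    also have "(\<Sum>k\<in>{n<..n + q}. w (n + q) / w k) \<le> (\<Sum>k\<in>{n<..n + q}. 1)"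
      using dec pos by (intro sum_mono) (auto simp: divide_le_eq_1)
    finally show ?thesis by simp
  qed
  define B where "B = Max (insert (real q / (1 - \<theta>)) (s ` {..n0 + q}))"
  have Bq: "real q / (1 - \<theta>) \<le> B" unfolding B_def by (rule Max_ge) auto
  have Bs: "s n \<le> B" if "n \<le> n0 + q" for n unfolding B_def using that by (intro Max_ge) auto
  have "s n \<le> B" for n
  proof (induction n rule: less_induct)
    case (less n)
    show ?case
    proof (cases "n \<le> n0 + q")
      case False
      then have n: "n - q \<ge> n0" "n - q < n" "n = (n - q) + q" using q by auto
      have "s n \<le> \<theta> * s (n - q) + real q" using step[OF n(1)] n(3) by simp
      also have "\<dots> \<le> \<theta> * B + real q" using less[OF n(2)] \<theta> by (intro add_mono mult_left_mono) auto
      also have "\<dots> \<le> B" using Bq \<theta> by (simp add: field_simps)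
      finally show ?thesis .
    qed (rule Bs)
  qed
  then show ?thesis unfolding s_def by blast
qed

lemma summable_power_exp:
  fixes A :: real
  assumes A: "A \<ge> 1"
  shows "summable (\<lambda>j. A ^ (j + 2) * exp (- (2 ^ j / 2)))"
proof -
  obtain J :: nat where J: "4 * A \<le> real J" using real_arch_simple by blast
  show ?thesis
  proof (rule summable_ratio_test)
    fix j assume j: "j \<ge> J"
    have "2 * A \<le> 2 ^ j / 2"
    proof -
      have "real j \<le> 2 ^ j" by (rule of_nat_less_two_power[THEN less_imp_le])
      moreover have "real J \<le> real j" using j by simp
      ultimately show ?thesis using J by linarith
    qed
    also have "\<dots> \<le> exp (2 ^ j / 2)" using exp_ge_add_one_self[of "2 ^ j / 2 :: real"] by linarith
    finally have le: "A * exp (- (2 ^ j / 2)) \<le> 1 / 2" by (simp add: exp_minus field_simps)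
    have "exp (- (2 ^ Suc j / 2)) = exp (- (2 ^ j / 2)) * exp (- (2 ^ j / 2) :: real)"
      by (simp flip: exp_add)
    then have "A ^ (Suc j + 2) * exp (- (2 ^ Suc j / 2))
        = (A * exp (- (2 ^ j / 2))) * (A ^ (j + 2) * exp (- (2 ^ j / 2)))" by simp
    also have "\<dots> \<le> (1 / 2) * (A ^ (j + 2) * exp (- (2 ^ j / 2)))"
      using le A by (intro mult_right_mono) auto
    finally show "norm (A ^ (Suc j + 2) * exp (- (2 ^ Suc j / 2)))
        \<le> 1 / 2 * norm (A ^ (j + 2) * exp (- (2 ^ j / 2)))" using A by (simp add: abs_mult)
  qed simp
qed

lemma power_le_exp:
  fixes x :: real
  assumes "0 \<le> x" "x \<le> 1"
  shows "(1 - x) ^ n \<le> exp (- (real n * x))"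
proof -
  have "(1 - x) ^ n \<le> exp (- x) ^ n"
    using exp_ge_add_one_self[of "- x"] assms by (intro power_mono) auto
  then show ?thesis by (simp flip: exp_of_nat_mult)
qed

lemma normal_weight_pos: "normal_weight v \<Longrightarrow> z \<in> disc \<Longrightarrow> v z > 0"
  unfolding normal_weight_def weight_def by blast

lemma normal_weight_mono:
  "normal_weight v \<Longrightarrow> z \<in> disc \<Longrightarrow> w \<in> disc \<Longrightarrow> cmod z \<le> cmod w \<Longrightarrow> v w \<le> v z"
  unfolding normal_weight_def by blast

lemma block_radius_bounds: "1 / 2 \<le> block_radius k" "block_radius k < 1"
proof -
  have "(1 / 2 :: real) ^ (k + 1) \<le> (1 / 2) ^ 1" by (rule power_decreasing) auto
  then show "1 / 2 \<le> block_radius k" by (simp add: block_radius_def)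
qed (simp add: block_radius_def)

lemma dyadic_disc: "complex_of_real (1 - (1 / 2) ^ n) \<in> disc"
proof -
  have "(1 / 2 :: real) ^ n \<le> 1" by (simp add: power_le_one)
  then show ?thesis by (simp del: of_real_diff of_real_power of_real_divide)
qed

text \<open>Let \<open>w n = v (1 - 2\<^sup>-\<^sup>n)\<close> and \<open>1 - 2\<^sup>-\<^sup>N \<le> |z| < 1 - 2\<^sup>-\<^sup>N\<^sup>-\<^sup>1\<close>, so that
  \<open>v z \<le> w N\<close>. For \<open>k \<le> N\<close> the terms are controlled by the ratios \<open>w N / w k\<close>, whose
  sums are bounded since \<open>w\<close> decays geometrically along steps of length \<open>q\<close> (first condition of normality). For \<open>k = N + 1 + j\<close> the ratio
  grows at most like \<open>A\<^sup>j\<close> (second condition), which the doubly exponential decay of \<open>|z|\<^bsup>m(k)\<^esup>\<close>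
  beats.\<close>

lemma normal_weight_block_sums:
  assumes v: "normal_weight v"
  shows "\<exists>C. \<forall>z\<in>disc. \<forall>K. v z * (\<Sum>k<K. cmod z ^ block_order k / v (of_real (block_radius k))) \<le> C"
proof -
  define w where "w n = v (of_real (1 - (1 / 2) ^ n))" for n
  have w_eq: "v (1 - (1 / 2) ^ n) = w n" for n by (simp add: w_def)
  have pos: "w n > 0" for n unfolding w_def by (intro normal_weight_pos[OF v] dyadic_disc)
  have norm_dy: "cmod (complex_of_real (1 - (1 / 2) ^ n)) = 1 - (1 / 2) ^ n" for n
    using power_le_one[of "1 / 2 :: real" n] by (simp del: of_real_diff of_real_power of_real_divide)
  have dec: "w n \<le> w m" if "m \<le> n" for m n
    unfolding w_def using power_decreasing[OF that, of "1 / 2 :: real"]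
    by (intro normal_weight_mono[OF v] dyadic_disc) (simp only: norm_dy, simp)
  have "(INF k. limsup (\<lambda>n. ereal (w (n + k) / w n))) < 1"
    using v unfolding normal_weight_def w_eq by (elim conjE)
  then obtain q where "limsup (\<lambda>n. ereal (w (n + q) / w n)) < 1" by (auto simp: INF_less_iff)
  then obtain \<theta> where \<theta>: "limsup (\<lambda>n. ereal (w (n + q) / w n)) < ereal \<theta>" "ereal \<theta> < 1"
    using ereal_dense2 by blast
  then have "\<forall>\<^sub>F n in sequentially. ereal (w (n + q) / w n) < ereal \<theta>"
    using Limsup_lessD by blast
  then obtain n0 where n0: "\<And>n. n \<ge> n0 \<Longrightarrow> w (n + q) / w n < \<theta>"
    by (auto simp: eventually_sequentially)
  have contr: "w (n + q) \<le> \<theta> * w n" if "n \<ge> n0" for n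
    using n0[OF that] pos[of n] by (simp add: pos_divide_less_eq)
  have "0 < \<theta> * w n0" using contr[of n0] pos[of "n0 + q"] by simp
  then have \<theta>0: "0 \<le> \<theta>" using pos[of n0] by (simp add: zero_less_mult_iff)
  have \<theta>1: "\<theta> < 1" using \<theta>(2) by simp
  obtain B where B: "\<And>n. (\<Sum>k\<le>n. w n / w k) \<le> B"
    using ratio_sums_bounded[of w, OF pos dec \<theta>0 \<theta>1 contr] by blast
  have "(SUP n. ereal (w n / w (n + 1))) < \<infinity>"
    using v unfolding normal_weight_def w_eq by (elim conjE)
  then obtain A where A: "\<And>n. w n / w (n + 1) \<le> A"
  proof -
    assume *: "\<And>A. (\<And>n. w n / w (n + 1) \<le> A) \<Longrightarrow> thesis"
    define S where "S = (SUP n. ereal (w n / w (n + 1)))"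
    have le: "ereal (w n / w (n + 1)) \<le> S" for n unfolding S_def by (rule SUP_upper) simp
    have "S < \<infinity>" using \<open>(SUP n. ereal (w n / w (n + 1))) < \<infinity>\<close> by (simp add: S_def)
    then obtain A where "S = ereal A" using le[of 0] by (cases S) auto
    then have "w n / w (n + 1) \<le> A" for n using le[of n] by (simp only: ereal_less_eq)
    then show thesis by (rule *)
  qed
  have A1: "A \<ge> 1"
  proof -
    have "1 \<le> w 0 / w (0 + 1)" using pos[of "0 + 1"] dec[of 0 "0 + 1"] by (simp only: le_divide_eq_1_pos)
    then show ?thesis using A[of 0] by linarith
  qed
  have growth: "w n / w (n + j) \<le> A ^ j" for n j
  proof (induction j)
    case 0 then show ?case using pos[of n] by simp
  next
    case (Suc j)
    have "w n / w (n + Suc j) = (w n / w (n + j)) * (w (n + j) / w (n + j + 1))"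
      using pos[of "n + j"] by simp
    also have "\<dots> \<le> A ^ j * A"
      using Suc A pos A1 by (intro mult_mono) (auto intro: less_imp_le)
    finally show ?case by (simp add: mult.commute)
  qed
  define g where "g j = A ^ (j + 2) * exp (- (2 ^ j / 2))" for j :: nat
  have g: "summable g" unfolding g_def by (rule summable_power_exp[OF A1])
  have g0: "g j \<ge> 0" for j using A1 by (simp add: g_def)
  have split: "(\<Sum>k<n + m. f k) = (\<Sum>k<n. f k) + (\<Sum>j<m. f (n + j))" for f :: "nat \<Rightarrow> real" and n m
    by (induction m) auto
  have "v z * (\<Sum>k<K. cmod z ^ block_order k / v (of_real (block_radius k))) \<le> A * B + suminf g"
    if z: "z \<in> disc" for z K
  proof -
    define t where "t k = v z * (cmod z ^ block_order k / w (k + 1))" for k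
    have t0: "t k \<ge> 0" for k using normal_weight_pos[OF v z] pos by (simp add: t_def less_imp_le)
    have "(\<lambda>n. 1 - (1 / 2 :: real) ^ (n + 1)) \<longlonglongrightarrow> 1 - 0"
      by (intro tendsto_intros LIMSEQ_ignore_initial_segment LIMSEQ_power_zero) simp
    moreover have "cmod z < 1 - 0" using z by simp
    ultimately have "\<exists>n. cmod z < 1 - (1 / 2) ^ (n + 1)"
      using eventually_happens[OF order_tendstoD(1)] by fastforce
    define N where "N = (LEAST n. cmod z < 1 - (1 / 2) ^ (n + 1))"
    have Nu: "cmod z < 1 - (1 / 2) ^ (N + 1)"
      unfolding N_def using \<open>\<exists>n. cmod z < 1 - (1 / 2) ^ (n + 1)\<close> by (rule LeastI_ex)
    have Nl: "1 - (1 / 2) ^ N \<le> cmod z"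
    proof (cases N)
      case (Suc n)
      then have "\<not> cmod z < 1 - (1 / 2) ^ (n + 1)" unfolding N_def by (intro not_less_Least) simp
      then show ?thesis using Suc by simp
    qed simp
    have vz: "v z \<le> w N"
      unfolding w_def by (intro normal_weight_mono[OF v] z dyadic_disc) (simp only: norm_dy Nl)
    have low: "t k \<le> A * (w N / w k)" if "k \<le> N" for k
    proof -
      have "t k \<le> w N * (1 / w (k + 1))"
        unfolding t_def using vz pos z normal_weight_pos[OF v z]
        by (intro mult_mono divide_right_mono) (auto simp: power_le_one less_imp_le)
      also have "\<dots> = (w N / w k) * (w k / w (k + 1))" using pos[of k] by simp
      also have "\<dots> \<le> (w N / w k) * A"
        using A pos by (intro mult_left_mono) (auto intro: less_imp_le)
      finally show ?thesis by (simp add: mult.commute)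
    qed
    have high: "t (N + 1 + j) \<le> g j" for j
    proof -
      have "cmod z ^ (2 ^ (N + j)) \<le> (1 - (1 / 2) ^ (N + 1)) ^ (2 ^ (N + j))"
        using Nu by (intro power_mono) auto
      also have "\<dots> \<le> exp (- (real (2 ^ (N + j)) * (1 / 2) ^ (N + 1)))"
        by (rule power_le_exp[OF _ power_le_one]) auto
      also have "real (2 ^ (N + j)) * (1 / 2) ^ (N + 1) = 2 ^ j / 2"
        by (simp add: power_add power_divide)
      finally have zp: "cmod z ^ (2 ^ (N + j)) \<le> exp (- (2 ^ j / 2))" .
      have "t (N + 1 + j) = v z * (cmod z ^ (2 ^ (N + j)) / w (N + (j + 2)))"
        by (simp add: t_def block_order_def add_ac)
      also have "\<dots> \<le> w N * (exp (- (2 ^ j / 2)) / w (N + (j + 2)))"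
        using vz zp pos normal_weight_pos[OF v z]
        by (intro mult_mono divide_right_mono) (auto simp: less_imp_le)
      also have "\<dots> = (w N / w (N + (j + 2))) * exp (- (2 ^ j / 2))" by simp
      also have "\<dots> \<le> A ^ (j + 2) * exp (- (2 ^ j / 2))" by (intro mult_right_mono growth) simp
      finally show ?thesis by (simp add: g_def)
    qed
    have "v z * (\<Sum>k<K. cmod z ^ block_order k / v (of_real (block_radius k))) = (\<Sum>k<K. t k)"
      unfolding sum_distrib_left t_def w_def block_radius_def ..
    also have "\<dots> \<le> (\<Sum>k<Suc N + K. t k)" using t0 by (intro sum_mono2) auto
    also have "\<dots> = (\<Sum>k<Suc N. t k) + (\<Sum>j<K. t (Suc N + j))" by (rule split)
    also have "(\<Sum>j<K. t (Suc N + j)) \<le> (\<Sum>j<K. g j)" using high by (intro sum_mono) simp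
    also have "\<dots> \<le> suminf g" using g g0 by (intro sum_le_suminf) auto
    also have "(\<Sum>k<Suc N. t k) \<le> (\<Sum>k\<le>N. A * (w N / w k))"
      unfolding lessThan_Suc_atMost by (intro sum_mono low) simp
    also have "\<dots> = A * (\<Sum>k\<le>N. w N / w k)" by (simp only: sum_distrib_left)
    also have "\<dots> \<le> A * B" using B A1 by (intro mult_left_mono) auto
    finally show ?thesis by simp
  qed
  then show ?thesis by blast
qed

text \<open>With \<open>x = 2\<^sup>-\<^sup>k\<^sup>-\<^sup>2\<close> the step is \<open>1 - 2 x \<le> (1 - x)\<^sup>2\<close>.\<close>

lemma block_radius_power: "1 / 4 \<le> block_radius k ^ (2 ^ (k + 1))"
proof (induction k)
  case (Suc k)
  define x :: real where "x = (1 / 2) ^ (k + 2)"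
  have x: "0 \<le> x" "x \<le> 1 / 2"
    using power_decreasing[of 1 "k + 2" "1 / 2 :: real"] by (auto simp: x_def)
  have r: "block_radius k = 1 - 2 * x" "block_radius (Suc k) = 1 - x"
    by (simp_all add: block_radius_def x_def)
  have "block_radius k \<le> block_radius (Suc k) ^ 2"
    unfolding r by (simp add: power2_eq_square algebra_simps)
  then have "block_radius k ^ (2 ^ (k + 1)) \<le> (block_radius (Suc k) ^ 2) ^ (2 ^ (k + 1))"
    using block_radius_bounds[of k] by (intro power_mono) auto
  then show ?case using Suc by (simp add: power_mult[symmetric])
qed (simp add: block_radius_def power2_eq_square)

section \<open>Synthesis of weighted spaces of holomorphic functions\<close>

lemma cubeD: "a \<in> cube \<Longrightarrow> cmod (a i) \<le> 1"
  by (simp add: cube_def)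

lemma cubeI: "(\<And>i. cmod (a i) \<le> 1) \<Longrightarrow> a \<in> cube"
  unfolding cube_def by blast

lemma compact_disc_radius:
  assumes "compact K" "K \<subseteq> disc"
  shows "\<exists>r. 0 < r \<and> r < 1 \<and> (\<forall>z\<in>K. cmod z \<le> r)"
proof (cases "K = {}")
  case False
  have "continuous_on K cmod" by (intro continuous_intros)
  then obtain w where w: "w \<in> K" "\<forall>z\<in>K. cmod z \<le> cmod w"
    using continuous_attains_sup[OF assms(1) False] by blast
  then show ?thesis using assms(2) by (intro exI[of _ "max (1 / 2) (cmod w)"]) fastforce
qed (auto intro: exI[of _ "1 / 2"])

lemma continuous_map_cube_co:
  fixes P :: "('i \<Rightarrow> complex) \<Rightarrow> complex \<Rightarrow> complex"
  assumes HD: "\<And>a. a \<in> cube \<Longrightarrow> P a \<in> HD"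
    and near: "\<And>a r e. a \<in> cube \<Longrightarrow> 0 < r \<Longrightarrow> r < 1 \<Longrightarrow> e > 0 \<Longrightarrow>
      \<exists>U. open U \<and> a \<in> U \<and> (\<forall>b\<in>cube \<inter> U. \<forall>z\<in>cball 0 r. cmod (P b z - P a z) < e)"
  shows "continuous_map (top_of_set cube) co_topology P"
  unfolding continuous_map topspace_co_topology openin_co_topology
proof (intro conjI allI impI)
  show "P ` topspace (top_of_set cube) \<subseteq> HD" using HD by auto
  fix V assume V: "co_open V"
  show "openin (top_of_set cube) {a \<in> topspace (top_of_set cube). P a \<in> V}"
  proof (subst openin_subopen, intro ballI)
    fix a assume "a \<in> {a \<in> topspace (top_of_set cube). P a \<in> V}"
    then have a: "a \<in> cube" "P a \<in> V" by auto
    obtain K e where K: "compact K" "K \<subseteq> disc" "e > 0"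
      "{g\<in>HD. \<forall>z\<in>K. cmod (g z - P a z) < e} \<subseteq> V"
      using V a(2) unfolding co_open_def by blast
    obtain r where r: "0 < r" "r < 1" "\<And>z. z \<in> K \<Longrightarrow> cmod z \<le> r"
      using compact_disc_radius[OF K(1,2)] by blast
    obtain U where U: "open U" "a \<in> U" "\<forall>b\<in>cube \<inter> U. \<forall>z\<in>cball 0 r. cmod (P b z - P a z) < e"
      using near[OF a(1) r(1,2) K(3)] by blast
    have "cube \<inter> U \<subseteq> {a \<in> topspace (top_of_set cube). P a \<in> V}"
    proof
      fix b assume b: "b \<in> cube \<inter> U"
      then have "P b \<in> {g\<in>HD. \<forall>z\<in>K. cmod (g z - P a z) < e}"
        using U(3) HD r(3) by simp
      then show "b \<in> {a \<in> topspace (top_of_set cube). P a \<in> V}" using K(4) b by auto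
    qed
    then show "\<exists>T. openin (top_of_set cube) T \<and> a \<in> T \<and> T \<subseteq> {a \<in> topspace (top_of_set cube). P a \<in> V}"
      using U a(1) by (intro exI[of _ "cube \<inter> U"]) (auto simp: openin_open_Int)
  qed
qed

lemma Hv_unit_ball_iff:
  "f \<in> unit_ball (Hv v) (Hv_norm v) \<longleftrightarrow> f \<in> HD \<and> (\<forall>z\<in>disc. v z * cmod (f z) \<le> 1)"
proof
  assume f: "f \<in> unit_ball (Hv v) (Hv_norm v)"
  have "v z * cmod (f z) \<le> Hv_norm v f" if "z \<in> disc" for z
    unfolding Hv_norm_def using f that by (intro cSUP_upper) (auto simp: unit_ball_def Hv_def)
  then show "f \<in> HD \<and> (\<forall>z\<in>disc. v z * cmod (f z) \<le> 1)"
    using f unfolding unit_ball_def Hv_def by force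
next
  assume f: "f \<in> HD \<and> (\<forall>z\<in>disc. v z * cmod (f z) \<le> 1)"
  then have "Hv_norm v f \<le> 1" unfolding Hv_norm_def by (intro cSUP_least) auto
  then show "f \<in> unit_ball (Hv v) (Hv_norm v)"
    using f by (auto simp: unit_ball_def Hv_def intro!: bdd_aboveI2[of _ _ 1])
qed

definition dyadic_block :: "(nat \<Rightarrow> complex) \<Rightarrow> nat \<Rightarrow> complex \<Rightarrow> complex" where
  "dyadic_block c k z =
     delayed_mean c (2 ^ (k + 1)) z - (if k = 0 then 0 else delayed_mean c (2 ^ k) z)"

text \<open>For \<open>k > 0\<close> both delayed means leave the coefficients up to \<open>2\<^sup>k\<close> unchanged, so these cancel. The frequencies
  of the block are thus on the plateau of the kernel with parameters \<open>block_order k\<close>,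
  \<open>2\<^bsup>k-1\<^esup>\<close> and \<open>8 * 2\<^bsup>k-1\<^esup>\<close>; truncated subtraction makes \<open>2\<^bsup>k-1\<^esup> = 1\<close> for \<open>k = 0\<close>.\<close>

lemma dyadic_block_coefficients:
  "\<exists>e. (\<forall>i. i + 1 < block_order k + 2 ^ (k - 1) \<longrightarrow> e i = 0) \<and>
    (\<forall>z. dyadic_block c k z = (\<Sum>i<2 ^ (k + 2). e i * z ^ i))"
proof -
  have "(2 :: nat) ^ (k + 1) > 0" by simp
  then obtain \<mu> where \<mu>: "\<And>i. i \<le> 2 ^ (k + 1) \<Longrightarrow> \<mu> i = 1"
    "\<And>d z. 2 * 2 ^ (k + 1) \<le> d \<Longrightarrow> delayed_mean c (2 ^ (k + 1)) z = (\<Sum>i<d. \<mu> i * c i * z ^ i)"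
    using delayed_mean_coefficients[of "2 ^ (k + 1)"] by blast
  show ?thesis
  proof (cases "k = 0")
    case True
    have "dyadic_block c k z = (\<Sum>i<2 ^ (k + 2). (\<mu> i * c i) * z ^ i)" for z
      using \<mu>(2)[of "2 ^ (k + 2)" z] True by (simp add: dyadic_block_def)
    then show ?thesis
      by (intro exI[of _ "\<lambda>i. \<mu> i * c i"]) (simp add: True block_order_def)
  next
    case False
    have "(2 :: nat) ^ k > 0" by simp
    then obtain \<nu> where \<nu>: "\<And>i. i \<le> 2 ^ k \<Longrightarrow> \<nu> i = 1"
      "\<And>d z. 2 * 2 ^ k \<le> d \<Longrightarrow> delayed_mean c (2 ^ k) z = (\<Sum>i<d. \<nu> i * c i * z ^ i)"
      using delayed_mean_coefficients[of "2 ^ k"] by blast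
    have "dyadic_block c k z = (\<Sum>i<2 ^ (k + 2). ((\<mu> i - \<nu> i) * c i) * z ^ i)" for z
      using \<mu>(2)[of "2 ^ (k + 2)" z] \<nu>(2)[of "2 ^ (k + 2)" z] False
      by (simp add: dyadic_block_def sum_subtractf left_diff_distrib)
    moreover have "(\<mu> i - \<nu> i) * c i = 0" if "i + 1 < block_order k + 2 ^ (k - 1)" for i
    proof -
      have "(2 :: nat) ^ k = 2 * 2 ^ (k - 1)" using False by (simp flip: power_Suc)
      then have "i \<le> 2 ^ k" using that False by (simp add: block_order_def)
      then show ?thesis using \<mu>(1)[of i] \<nu>(1)[of i] by simp
    qed
    ultimately show ?thesis by (intro exI[of _ "\<lambda>i. (\<mu> i - \<nu> i) * c i"]) simp
  qed
qed

lemma sum_dyadic_blocks: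
  "(\<Sum>k<Suc n. dyadic_block c k z) = delayed_mean c (2 ^ Suc n) z"
  by (induction n) (simp_all add: dyadic_block_def)

text \<open>Large enough to avoid aliasing: a block has degree below \<open>8 * 2\<^bsup>k-1\<^esup>\<close> and its kernel has degree below
  \<open>10 * 2\<^bsup>k-1\<^esup>\<close>.\<close>

definition block_points :: "nat \<Rightarrow> nat" where
  "block_points k = 16 * 2 ^ (k - 1)"

text \<open>The factor \<open>8\<close> is the ratio of the plateau parameters; \<open>4\<^sup>9\<close> bounds the powers of
  \<open>1 / block_radius k\<close> that arise from evaluating the kernel outside of the unit disc.\<close>

definition atom_const :: real where
  "atom_const = 8 * 4 ^ 9"

locale normal_weight_disc =
  fixes v :: "complex \<Rightarrow> real"
  assumes v: "normal_weight v"
begin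

definition weight_at :: "nat \<Rightarrow> real" where
  "weight_at k = v (of_real (block_radius k))"

definition atom :: "nat \<Rightarrow> nat \<Rightarrow> complex \<Rightarrow> complex" where
  "atom k j z = plateau_kernel (block_order k) (2 ^ (k - 1)) (8 * 2 ^ (k - 1))
       (z * cnj (unity_root (block_points k) j) / of_real (block_radius k))
     / of_real (real (block_points k) * weight_at k)"

definition block_term :: "(nat \<times> nat \<Rightarrow> complex) \<Rightarrow> nat \<Rightarrow> complex \<Rightarrow> complex" where
  "block_term a k z = (\<Sum>j<block_points k. a (k, j) * atom k j z)"

definition synthesis :: "(nat \<times> nat \<Rightarrow> complex) \<Rightarrow> complex \<Rightarrow> complex" where
  "synthesis a z = (if z \<in> disc then (\<Sum>k. block_term a k z) else 0)"

lemma weight_at_pos: "weight_at k > 0"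
  unfolding weight_at_def using block_radius_bounds[of k] by (intro normal_weight_pos[OF v]) simp

definition majorant :: "real \<Rightarrow> nat \<Rightarrow> real" where
  "majorant r k = atom_const * (r ^ block_order k / weight_at k)"

lemma majorant_nonneg: "0 \<le> r \<Longrightarrow> 0 \<le> majorant r k"
  using weight_at_pos[of k] by (simp add: majorant_def atom_const_def)

lemma majorant_mono: "0 \<le> r \<Longrightarrow> r \<le> s \<Longrightarrow> majorant r k \<le> majorant s k"
  unfolding majorant_def
  by (intro mult_left_mono divide_right_mono power_mono less_imp_le[OF weight_at_pos])
    (simp_all add: atom_const_def)

text \<open>Powers of \<open>1 / block_radius k\<close> with exponent of order \<open>2\<^sup>k\<close> are bounded by
  \<open>block_radius_power\<close>, so that the mean of the kernel is of size \<open>|z|\<^bsup>m(k)\<^esup>\<close>.\<close>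

lemma sum_atoms:
  assumes z: "z \<in> disc"
  shows "(\<Sum>j<block_points k. cmod (atom k j z)) \<le> majorant (cmod z) k"
proof -
  let ?M = "block_points k" and ?\<rho> = "block_radius k" and ?m = "block_order k"
  let ?L = "8 * 2 ^ (k - 1) :: nat"
  define t where "t = 1 / ?\<rho>"
  have t: "t \<ge> 1" using block_radius_bounds[of k] by (simp add: t_def)
  have M: "real ?M > 0" by (simp add: block_points_def)
  have tp: "t ^ (2 ^ (k + 1)) \<le> 4"
    using block_radius_power[of k] block_radius_bounds[of k]
    by (simp add: t_def power_one_over field_simps)
  have le: "2 ^ (k - 1) \<le> (2 ^ (k + 1) :: nat)" by (intro power_increasing) auto
  have "?m \<le> 2 ^ (k + 1)" using le by (simp add: block_order_def)
  then have tm: "t ^ ?m \<le> 4" using power_increasing[OF _ t, of ?m "2 ^ (k + 1)"] tp by simp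
  have "2 ^ (k - 1) \<le> (2 ^ k :: nat)" by (intro power_increasing) auto
  then have "2 * ?L \<le> 2 ^ (k + 1) * 8" by simp
  then have "t ^ (2 * ?L) \<le> t ^ (2 ^ (k + 1) * 8)" using t by (rule power_increasing)
  also have "\<dots> = (t ^ (2 ^ (k + 1))) ^ 8" by (rule power_mult)
  also have "\<dots> \<le> 4 ^ 8" using tp t by (intro power_mono) auto
  finally have tL: "t ^ (2 * ?L) \<le> 4 ^ 8" .
  define u where "u = z / of_real ?\<rho>"
  have nu: "cmod u = cmod z * t"
    using block_radius_bounds[of k] by (simp add: u_def t_def norm_divide)
  have "(\<Sum>j<?M. cmod (atom k j z))
      = (\<Sum>j<?M. cmod (plateau_kernel ?m (2 ^ (k - 1)) ?L (u * cnj (unity_root ?M j)))) / (real ?M * weight_at k)"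
    using weight_at_pos[of k] by (simp add: atom_def u_def norm_divide norm_mult sum_divide_distrib)
  also have "\<dots> \<le> (real ?M * cmod u ^ ?m * (real ?L / real (2 ^ (k - 1))) * t ^ (2 * ?L)) / (real ?M * weight_at k)"
    using weight_at_pos[of k] t z nu
    by (intro divide_right_mono plateau_kernel_mean) (auto simp: block_points_def mult_left_le_one_le)
  also have "\<dots> = (cmod z ^ ?m / weight_at k) * (8 * t ^ ?m * t ^ (2 * ?L))"
    using M by (simp add: nu power_mult_distrib)
  also have "\<dots> \<le> (cmod z ^ ?m / weight_at k) * (8 * 4 * 4 ^ 8)"
    using weight_at_pos[of k] tm tL t by (intro mult_left_mono mult_mono) (auto simp: less_imp_le)
  finally show ?thesis by (simp add: majorant_def atom_const_def mult.commute)
qed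

lemma atom_bound:
  assumes "z \<in> disc" "j < block_points k"
  shows "cmod (atom k j z) \<le> majorant (cmod z) k"
proof -
  have "cmod (atom k j z) \<le> (\<Sum>j<block_points k. cmod (atom k j z))"
    using assms(2) by (intro member_le_sum) auto
  then show ?thesis using sum_atoms[OF assms(1), of k] by linarith
qed

lemma block_term_bound:
  assumes z: "z \<in> disc" and a: "\<And>i. cmod (a i) \<le> R"
  shows "cmod (block_term a k z) \<le> R * majorant (cmod z) k"
proof -
  have "cmod (block_term a k z) \<le> (\<Sum>j<block_points k. cmod (a (k, j) * atom k j z))"
    unfolding block_term_def by (rule norm_sum)
  also have "\<dots> \<le> (\<Sum>j<block_points k. R * cmod (atom k j z))"
    by (intro sum_mono) (simp add: norm_mult a mult_right_mono)
  also have "\<dots> \<le> R * majorant (cmod z) k"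
    unfolding sum_distrib_left[symmetric]
    using sum_atoms[OF z] order_trans[OF norm_ge_zero a] by (intro mult_left_mono) auto
  finally show ?thesis .
qed

text \<open>The majorant of the blocks at \<open>z\<close> is summable and \<open>O(1 / v z)\<close>. This makes the synthesis of a
  bounded family both holomorphic and of finite weighted norm.\<close>

lemma ex_synthesis_const:
  "\<exists>C>0. \<forall>z\<in>disc. summable (majorant (cmod z)) \<and> v z * suminf (majorant (cmod z)) \<le> C"
proof -
  obtain C where C: "\<And>z K. z \<in> disc \<Longrightarrow>
      v z * (\<Sum>k<K. cmod z ^ block_order k / v (of_real (block_radius k))) \<le> C"
    using normal_weight_block_sums[OF v] by blast
  have le: "v z * (\<Sum>k<K. majorant (cmod z) k) \<le> atom_const * \<bar>C\<bar> + 1" if "z \<in> disc" for z K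
  proof -
    have "v z * (\<Sum>k<K. majorant (cmod z) k)
        = atom_const * (v z * (\<Sum>k<K. cmod z ^ block_order k / v (of_real (block_radius k))))"
      by (simp add: majorant_def weight_at_def sum_distrib_left mult_ac)
    also have "\<dots> \<le> atom_const * \<bar>C\<bar>"
      using C[OF that, of K] by (intro mult_left_mono) (auto simp: atom_const_def)
    finally show ?thesis by simp
  qed
  have "summable (majorant (cmod z)) \<and> v z * suminf (majorant (cmod z)) \<le> atom_const * \<bar>C\<bar> + 1"
    if z: "z \<in> disc" for z
  proof
    have pos: "v z > 0" by (rule normal_weight_pos[OF v z])
    have b: "(\<Sum>k<K. majorant (cmod z) k) \<le> (atom_const * \<bar>C\<bar> + 1) / v z" for K
      using le[OF z, of K] pos by (simp add: field_simps)
    show s: "summable (majorant (cmod z))"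
      using b by (intro summableI_nonneg_bounded majorant_nonneg) auto
    have "suminf (majorant (cmod z)) \<le> (atom_const * \<bar>C\<bar> + 1) / v z"
      using s b by (rule suminf_le_const)
    then show "v z * suminf (majorant (cmod z)) \<le> atom_const * \<bar>C\<bar> + 1"
      using pos by (simp add: field_simps)
  qed
  moreover have "atom_const * \<bar>C\<bar> + 1 > 0" by (simp add: atom_const_def add_nonneg_pos)
  ultimately show ?thesis by blast
qed

lemma summable_majorant:
  assumes "0 \<le> r" "r < 1"
  shows "summable (majorant r)"
proof -
  have "complex_of_real r \<in> disc" "cmod (complex_of_real r) = r" using assms by auto
  then show ?thesis using ex_synthesis_const by metis
qed

lemma summable_block_term:
  assumes z: "z \<in> disc" and a: "bounded_family a"
  shows "summable (\<lambda>k. block_term a k z)"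
proof -
  obtain R where "\<And>i. cmod (a i) \<le> R" using a by (auto simp: bounded_family_def)
  then have "cmod (block_term a k z) \<le> R * majorant (cmod z) k" for k
    by (rule block_term_bound[OF z])
  moreover have "summable (\<lambda>k. R * majorant (cmod z) k)"
    using z by (intro summable_mult summable_majorant) auto
  ultimately show ?thesis by (rule summable_comparison_test'[where N = 0, rotated])
qed

lemma norm_synthesis_le:
  assumes z: "z \<in> disc" and a: "\<And>i. cmod (a i) \<le> R"
  shows "cmod (synthesis a z) \<le> R * suminf (majorant (cmod z))"
proof -
  have s: "summable (majorant (cmod z))" using z by (intro summable_majorant) auto
  have "cmod (synthesis a z) \<le> (\<Sum>k. R * majorant (cmod z) k)"
    unfolding synthesis_def using z
    by (simp, intro norm_suminf_le block_term_bound z a summable_mult s)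
  then show ?thesis using suminf_mult[OF s] by simp
qed

lemma block_term_add: "block_term (\<lambda>i. a i + b i) k z = block_term a k z + block_term b k z"
  by (simp add: block_term_def distrib_right sum.distrib)

lemma block_term_scale: "block_term (\<lambda>i. c * a i) k z = c * block_term a k z"
  by (simp add: block_term_def sum_distrib_left mult.assoc)

lemma synthesis_add:
  assumes "bounded_family a" "bounded_family b"
  shows "synthesis (\<lambda>i. a i + b i) = (\<lambda>z. synthesis a z + synthesis b z)"
  using suminf_add[OF summable_block_term[OF _ assms(1)] summable_block_term[OF _ assms(2)]]
  by (auto simp: synthesis_def block_term_add)

lemma synthesis_scale:
  assumes "bounded_family a"
  shows "synthesis (\<lambda>i. c * a i) = (\<lambda>z. c * synthesis a z)"
  using suminf_mult[OF summable_block_term[OF _ assms]]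
  by (auto simp: synthesis_def block_term_scale)

lemma holomorphic_block_term: "block_term a k holomorphic_on disc"
proof -
  have "(\<lambda>z. block_term a k z) holomorphic_on disc"
    unfolding block_term_def atom_def plateau_kernel_def geom_def
    using weight_at_pos[of k] block_radius_bounds[of k]
    by (intro holomorphic_intros) (auto simp: block_points_def)
  then show ?thesis .
qed

text \<open>Weierstrass: on small closed balls the blocks are dominated by a convergent numerical series.\<close>

lemma synthesis_HD:
  assumes a: "bounded_family a"
  shows "synthesis a \<in> HD"
proof -
  obtain R where R: "\<And>i. cmod (a i) \<le> R" using a by (auto simp: bounded_family_def)
  have "(\<lambda>z. \<Sum>k. block_term a k z) holomorphic_on disc"
  proof (rule holomorphic_uniform_sequence)
    show "(\<lambda>z. \<Sum>k<n. block_term a k z) holomorphic_on disc" for n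
      by (intro holomorphic_on_sum holomorphic_block_term)
    fix x :: complex assume x: "x \<in> disc"
    define d where "d = (1 - cmod x) / 2"
    define r where "r = (1 + cmod x) / 2"
    have d: "d > 0" and r: "0 \<le> r" "r < 1" using x by (auto simp: d_def r_def)
    have ball: "cmod z \<le> r" if "z \<in> cball x d" for z
    proof -
      have "cmod z \<le> cmod x + cmod (x - z)"
        using norm_triangle_ineq4[of x "x - z"] by simp
      then show ?thesis using that by (simp add: d_def r_def dist_norm field_simps)
    qed
    then have sub: "cball x d \<subseteq> disc" using r(2) by force
    have "uniform_limit (cball x d) (\<lambda>n z. \<Sum>k<n. block_term a k z) (\<lambda>z. \<Sum>k. block_term a k z) sequentially"
    proof (rule Weierstrass_m_test)
      fix k z assume z: "z \<in> cball x d"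
      have "cmod (block_term a k z) \<le> R * majorant (cmod z) k"
        using z sub by (intro block_term_bound R) auto
      also have "\<dots> \<le> R * majorant r k"
        using ball[OF z] order_trans[OF norm_ge_zero R] by (intro mult_left_mono majorant_mono) auto
      finally show "cmod (block_term a k z) \<le> R * majorant r k" .
    qed (intro summable_mult summable_majorant r)
    then show "\<exists>d>0. cball x d \<subseteq> disc \<and>
        uniform_limit (cball x d) (\<lambda>n z. \<Sum>k<n. block_term a k z) (\<lambda>z. \<Sum>k. block_term a k z) sequentially"
      using d sub by blast
  qed simp
  then have "synthesis a holomorphic_on disc"
    by (rule holomorphic_transform) (simp add: synthesis_def)
  then show ?thesis by (auto simp: HD_def synthesis_def)
qed

text \<open>On the disc of radius \<open>r\<close> the blocks beyond some \<open>n\<close> are uniformly small on the cube; the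
  finitely many remaining coordinates can be kept close to those of \<open>a\<close>.\<close>

lemma synthesis_continuous:
  assumes a: "a \<in> cube" and r: "0 < r" "r < 1" and e: "e > 0"
  shows "\<exists>U. open U \<and> a \<in> U \<and> (\<forall>b\<in>cube \<inter> U. \<forall>z\<in>cball 0 r. cmod (synthesis b z - synthesis a z) < e)"
proof -
  have s: "summable (majorant r)" using r by (intro summable_majorant) auto
  have "(\<lambda>n. \<Sum>k. majorant r (k + n)) \<longlonglongrightarrow> 0" by (rule suminf_exist_split2[OF s])
  then obtain n where n: "(\<Sum>k. majorant r (k + n)) < e / 4"
    using order_tendstoD(2)[of _ 0 sequentially "e / 4"] e by (auto simp: eventually_sequentially)
  define D where "D b = (\<Sum>k<n. \<Sum>j<block_points k. cmod (b (k, j) - a (k, j)) * majorant r k)" for b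
  define U where "U = {b. D b < e / 2}"
  have "open U"
    unfolding U_def D_def by (intro open_Collect_less continuous_intros continuous_on_product_coordinates)
  moreover have "a \<in> U" using e by (simp add: U_def D_def)
  moreover have "cmod (synthesis b z - synthesis a z) < e" if b: "b \<in> cube" "b \<in> U" and z: "z \<in> cball 0 r" for b z
  proof -
    define d where "d i = b i + (-1) * a i" for i
    have zd: "z \<in> disc" "cmod z \<le> r" using z r by auto
    have bf: "bounded_family a" "bounded_family b" using a b by (auto intro: bounded_family_cube)
    have d2: "cmod (d i) \<le> 2" for i
      using norm_triangle_ineq4[of "b i" "a i"] cubeD[OF a, of i] cubeD[OF b(1), of i]
      by (simp add: d_def)
    have bd: "bounded_family d" using d2 by (auto simp: bounded_family_def)
    have "synthesis d = (\<lambda>z. synthesis b z - synthesis a z)"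
      unfolding d_def
      using synthesis_add[OF bf(2) bounded_family_scale[OF bf(1), of "-1"]] synthesis_scale[OF bf(1), of "-1"] by simp
    then have "synthesis b z - synthesis a z = synthesis d z" by simp
    also have "\<dots> = (\<Sum>k. block_term d (k + n) z) + (\<Sum>k<n. block_term d k z)"
      unfolding synthesis_def using zd(1) suminf_split_initial_segment[OF summable_block_term[OF zd(1) bd], of n] by simp
    finally have "cmod (synthesis b z - synthesis a z)
        \<le> cmod (\<Sum>k. block_term d (k + n) z) + cmod (\<Sum>k<n. block_term d k z)"
      using norm_triangle_ineq by simp
    also have "cmod (\<Sum>k. block_term d (k + n) z) \<le> (\<Sum>k. 2 * majorant r (k + n))"
    proof (rule norm_suminf_le)
      fix k
      have "cmod (block_term d (k + n) z) \<le> 2 * majorant (cmod z) (k + n)"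
        by (rule block_term_bound[OF zd(1) d2])
      also have "\<dots> \<le> 2 * majorant r (k + n)" using zd(2) by (intro mult_left_mono majorant_mono) auto
      finally show "cmod (block_term d (k + n) z) \<le> 2 * majorant r (k + n)" .
    qed (intro summable_mult summable_ignore_initial_segment s)
    also have "\<dots> = 2 * (\<Sum>k. majorant r (k + n))"
      by (intro suminf_mult summable_ignore_initial_segment s)
    also have "\<dots> < e / 2" using n by simp
    also have "cmod (\<Sum>k<n. block_term d k z) \<le> D b"
      unfolding D_def
    proof (intro order_trans[OF norm_sum] sum_mono)
      fix k
      have "cmod (block_term d k z) \<le> (\<Sum>j<block_points k. cmod (d (k, j) * atom k j z))"
        unfolding block_term_def by (rule norm_sum)
      also have "\<dots> \<le> (\<Sum>j<block_points k. cmod (b (k, j) - a (k, j)) * majorant r k)"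
      proof (rule sum_mono)
        fix j assume "j \<in> {..<block_points k}"
        then have "cmod (atom k j z) \<le> majorant r k"
          using atom_bound[OF zd(1)] majorant_mono[of "cmod z" r k] zd(2) by (force intro: order_trans)
        then show "cmod (d (k, j) * atom k j z) \<le> cmod (b (k, j) - a (k, j)) * majorant r k"
          by (simp add: norm_mult d_def mult_left_mono)
      qed
      finally show "cmod (block_term d k z) \<le> (\<Sum>j<block_points k. cmod (b (k, j) - a (k, j)) * majorant r k)" .
    qed
    also have "D b < e / 2" using b(2) by (simp add: U_def)
    finally show ?thesis by simp
  qed
  ultimately show ?thesis by blast
qed

text \<open>The normalising factor of the atoms cancels the weight in the coordinates, and the kernel
  recovers the block from its samples.\<close>

lemma block_term_reproduces:
  assumes a: "\<And>j. j < block_points k \<Longrightarrow>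
    a (k, j) = of_real (weight_at k) * dyadic_block c k (of_real (block_radius k) * unity_root (block_points k) j)"
  shows "block_term a k z = dyadic_block c k z"
proof -
  let ?M = "block_points k" and ?\<rho> = "complex_of_real (block_radius k)"
  let ?Q = "plateau_kernel (block_order k) (2 ^ (k - 1)) (8 * 2 ^ (k - 1))"
  obtain e where e0: "\<And>i. i + 1 < block_order k + 2 ^ (k - 1) \<Longrightarrow> e i = 0"
    and e: "\<And>z. dyadic_block c k z = (\<Sum>i<2 ^ (k + 2). e i * z ^ i)"
    using dyadic_block_coefficients[of k c] by blast
  have M: "?M > 0" by (simp add: block_points_def)
  have sizes: "2 ^ (k + 2) \<le> block_order k + 8 * 2 ^ (k - 1)"
    "block_order k + 2 ^ (k - 1) + 8 * 2 ^ (k - 1) \<le> ?M"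
    by (cases k; simp add: block_order_def block_points_def)+
  have "block_term a k z
      = (\<Sum>j<?M. dyadic_block c k (?\<rho> * unity_root ?M j) * ?Q (z * cnj (unity_root ?M j) / ?\<rho>)) / of_nat ?M"
    unfolding block_term_def sum_divide_distrib
    using weight_at_pos[of k] by (intro sum.cong refl) (simp add: a atom_def)
  also have "(\<Sum>j<?M. dyadic_block c k (?\<rho> * unity_root ?M j) * ?Q (z * cnj (unity_root ?M j) / ?\<rho>))
      = of_nat ?M * dyadic_block c k z"
    unfolding e
    by (rule plateau_kernel_reproduces) (use sizes block_radius_bounds[of k] e0 in auto)
  finally show ?thesis using M by simp
qed

text \<open>The coordinates are the values of the dyadic blocks of \<open>f\<close> at the sample points, multiplied by
  the weight. They are at most \<open>3\<close>, since each of the two delayed means in a block contributes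
  \<open>3 / 2\<close>.\<close>

lemma synthesis_onto:
  assumes f: "f \<in> unit_ball (Hv v) (Hv_norm v)"
  shows "\<exists>a\<in>cube. f = (\<lambda>z. 3 * synthesis a z)"
proof -
  have HD: "f holomorphic_on disc" "\<And>z. z \<notin> disc \<Longrightarrow> f z = 0"
    and fv: "\<And>z. z \<in> disc \<Longrightarrow> v z * cmod (f z) \<le> 1"
    using f unfolding Hv_unit_ball_iff by (auto simp: HD_def)
  define c where "c i = (deriv ^^ i) f 0 / fact i" for i
  have series: "(\<lambda>i. c i * z ^ i) sums f z" if "z \<in> disc" for z
    using holomorphic_power_series[OF HD(1) that] by (simp add: c_def)
  have abs_series: "summable (\<lambda>i. cmod (c i) * cmod z ^ i)" if z: "z \<in> disc" for z
  proof -
    \<comment> \<open>Absolute convergence at \<open>z\<close> from convergence at a real point between \<open>cmod z\<close> and \<open>1\<close>.\<close>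
    obtain x where x: "cmod z < x" "x < 1" using dense[of "cmod z" 1] z by auto
    then have x0: "0 \<le> x" using norm_ge_zero[of z] by linarith
    then have "complex_of_real x \<in> disc" using x by simp
    then have "summable (\<lambda>i. norm (c i * z ^ i))"
      by (rule powser_insidea[OF sums_summable[OF series]]) (use x x0 in simp)
    then show ?thesis by (simp add: norm_mult norm_power)
  qed
  have mean: "cmod (delayed_mean c N \<zeta>) \<le> 3 / 2 * (1 / weight_at k)"
    if "N > 0" and \<zeta>: "cmod \<zeta> = block_radius k" for N \<zeta> k
  proof (rule delayed_mean_bound[OF that(1)])
    have disc: "\<xi> \<in> disc" if "cmod \<xi> = cmod \<zeta>" for \<xi> using that \<zeta> block_radius_bounds[of k] by simp
    show "summable (\<lambda>i. cmod (c i) * cmod \<zeta> ^ i)" by (intro abs_series disc refl)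
    fix \<xi> assume \<xi>: "cmod \<xi> = cmod \<zeta>"
    have "of_real (block_radius k) \<in> disc" using block_radius_bounds[of k] by simp
    moreover have "cmod (of_real (block_radius k) :: complex) = cmod \<xi>"
      using \<xi> \<zeta> block_radius_bounds[of k] by simp
    ultimately have "weight_at k \<le> v \<xi>"
      unfolding weight_at_def using disc[OF \<xi>] by (intro normal_weight_mono[OF v]) auto
    then have "weight_at k * cmod (f \<xi>) \<le> v \<xi> * cmod (f \<xi>)" by (intro mult_right_mono) auto
    also have "\<dots> \<le> 1" by (rule fv[OF disc[OF \<xi>]])
    finally have "cmod (f \<xi>) \<le> 1 / weight_at k" using weight_at_pos[of k] by (simp add: field_simps)
    then show "cmod (\<Sum>i. c i * \<xi> ^ i) \<le> 1 / weight_at k"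
      using sums_unique[OF series[OF disc[OF \<xi>]]] by simp
  qed
  have block: "cmod (dyadic_block c k \<zeta>) \<le> 3 / weight_at k" if \<zeta>: "cmod \<zeta> = block_radius k" for k \<zeta>
  proof -
    have "cmod (dyadic_block c k \<zeta>) \<le> cmod (delayed_mean c (2 ^ (k + 1)) \<zeta>)
        + cmod (if k = 0 then 0 else delayed_mean c (2 ^ k) \<zeta>)"
      unfolding dyadic_block_def by (rule norm_triangle_ineq4)
    also have "\<dots> \<le> 3 / 2 * (1 / weight_at k) + 3 / 2 * (1 / weight_at k)"
      using mean[OF _ \<zeta>, of "2 ^ (k + 1)"] mean[OF _ \<zeta>, of "2 ^ k"] weight_at_pos[of k]
      by (intro add_mono) auto
    finally show ?thesis by simp
  qed
  define b where "b = (\<lambda>(k, j). of_real (weight_at k) *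
      dyadic_block c k (of_real (block_radius k) * unity_root (block_points k) j))"
  define a where "a i = of_real (1 / 3) * b i" for i
  have b3: "cmod (b i) \<le> 3" for i
  proof (cases i)
    case (Pair k j)
    have "cmod (b i) = weight_at k * cmod (dyadic_block c k (of_real (block_radius k) * unity_root (block_points k) j))"
      using Pair weight_at_pos[of k] by (simp add: b_def norm_mult)
    also have "\<dots> \<le> weight_at k * (3 / weight_at k)"
      using weight_at_pos[of k] block_radius_bounds[of k]
      by (intro mult_left_mono block) (auto simp: norm_mult)
    finally show ?thesis using weight_at_pos[of k] by simp
  qed
  then have bb: "bounded_family b" by (auto simp: bounded_family_def)
  have a_norm: "cmod (a i) = cmod (b i) / 3" for i by (simp add: a_def norm_divide)
  have a_cube: "a \<in> cube"
  proof (rule cubeI)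
    show "cmod (a i) \<le> 1" for i using b3[of i] a_norm[of i] by simp
  qed
  have terms: "block_term b k z = dyadic_block c k z" for k z
    by (rule block_term_reproduces) (simp add: b_def)
  have bf: "synthesis b z = f z" for z
  proof (cases "z \<in> disc")
    case True
    have "(\<lambda>n. \<Sum>k<n. block_term b k z) \<longlonglongrightarrow> synthesis b z"
      unfolding synthesis_def using True summable_LIMSEQ[OF summable_block_term[OF True bb]] by simp
    then have "(\<lambda>n. \<Sum>k<Suc n. dyadic_block c k z) \<longlonglongrightarrow> synthesis b z"
      unfolding terms by (rule LIMSEQ_Suc)
    then have "(\<lambda>n. delayed_mean c (2 ^ Suc n) z) \<longlonglongrightarrow> synthesis b z"
      unfolding sum_dyadic_blocks .
    moreover have "filterlim (\<lambda>n. 2 ^ Suc n :: nat) at_top sequentially"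
      by (rule filterlim_subseq) (simp add: strict_mono_Suc_iff)
    ultimately show ?thesis
      using delayed_mean_tendsto[OF series[OF True]] LIMSEQ_unique by blast
  qed (simp add: synthesis_def HD(2))
  have "synthesis a = (\<lambda>z. of_real (1 / 3) * synthesis b z)"
    unfolding a_def by (rule synthesis_scale[OF bb])
  then have "f = (\<lambda>z. 3 * synthesis a z)" by (simp add: bf)
  with a_cube show ?thesis by blast
qed

text \<open>Dividing the synthesis by its norm \<open>C\<close> puts the image of the cube into the unit ball; the factor \<open>3\<close> is the
  bound for the coordinates of a function in the unit ball.\<close>

theorem Hv_cube_quotient:
  "\<exists>(P :: (nat \<times> nat \<Rightarrow> complex) \<Rightarrow> complex \<Rightarrow> complex) C. cube_quotient (Hv v) (Hv_norm v) P C"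
proof -
  obtain C where C: "C > 0" "\<And>z. z \<in> disc \<Longrightarrow> v z * suminf (majorant (cmod z)) \<le> C"
    using ex_synthesis_const by blast
  define P where "P a z = of_real (1 / C) * synthesis a z" for a z
  have wb: "v z * cmod (P a z) \<le> R" if "z \<in> disc" "\<And>i. cmod (a i) \<le> R" for a R z
  proof -
    have "R \<ge> 0" using order_trans[OF norm_ge_zero that(2)] by blast
    have "v z * cmod (synthesis a z) \<le> v z * (R * suminf (majorant (cmod z)))"
      using normal_weight_pos[OF v that(1)] by (intro mult_left_mono norm_synthesis_le that) auto
    also have "\<dots> = R * (v z * suminf (majorant (cmod z)))" by simp
    also have "\<dots> \<le> R * C" using C(2)[OF that(1)] \<open>R \<ge> 0\<close> by (rule mult_left_mono)
    finally show ?thesis using C(1) by (simp add: P_def norm_mult norm_divide field_simps)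
  qed
  have PHD: "P a \<in> HD" if "bounded_family a" for a
  proof -
    have "(\<lambda>z. of_real (1 / C) * synthesis a z) holomorphic_on disc"
      using synthesis_HD[OF that] by (intro holomorphic_intros) (simp add: HD_def)
    moreover have "P a = (\<lambda>z. of_real (1 / C) * synthesis a z)" by (rule ext) (simp add: P_def)
    ultimately show ?thesis using synthesis_HD[OF that] by (simp add: HD_def)
  qed
  have "cube_quotient (Hv v) (Hv_norm v) P (3 * C)"
    unfolding cube_quotient_def
  proof (intro conjI allI impI ballI)
    fix a b :: "nat \<times> nat \<Rightarrow> complex" and c
    assume a: "bounded_family a"
    obtain R where "\<And>i. cmod (a i) \<le> R" using a by (auto simp: bounded_family_def)
    then show "P a \<in> Hv v"
      using wb[of _ a R] PHD[OF a] by (auto simp: Hv_def intro!: bdd_aboveI2[of _ _ R])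
    show "P (\<lambda>i. c * a i) = (\<lambda>z. c * P a z)"
      using synthesis_scale[OF a] by (simp add: P_def fun_eq_iff)
    assume b: "bounded_family b"
    show "P (\<lambda>i. a i + b i) = (\<lambda>z. P a z + P b z)"
      using synthesis_add[OF a b] by (simp add: P_def fun_eq_iff distrib_left add_divide_distrib)
  next
    show "P ` cube \<subseteq> unit_ball (Hv v) (Hv_norm v)"
      using wb[OF _ cubeD] PHD[OF bounded_family_cube] by (auto simp: Hv_unit_ball_iff)
    show "continuous_map (top_of_set cube) co_topology P"
    proof (rule continuous_map_cube_co)
      show "P a \<in> HD" if "a \<in> cube" for a by (intro PHD bounded_family_cube that)
      fix a and r e :: real assume a: "a \<in> (cube :: (nat \<times> nat \<Rightarrow> complex) set)" and r: "0 < r" "r < 1" and e: "e > 0"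
      obtain U where U: "open U" "a \<in> U"
        "\<forall>b\<in>cube \<inter> U. \<forall>z\<in>cball 0 r. cmod (synthesis b z - synthesis a z) < e * C"
        using synthesis_continuous[OF a r, of "e * C"] e C(1) by auto
      have "cmod (P b z - P a z) = cmod (synthesis b z - synthesis a z) / C" for b z
        using C(1) by (simp add: P_def norm_divide flip: diff_divide_distrib)
      then have "\<forall>b\<in>cube \<inter> U. \<forall>z\<in>cball 0 r. cmod (P b z - P a z) < e"
        using U(3) C(1) by (simp only: pos_divide_less_eq)
      then show "\<exists>U. open U \<and> a \<in> U \<and> (\<forall>b\<in>cube \<inter> U. \<forall>z\<in>cball 0 r. cmod (P b z - P a z) < e)"
        using U(1,2) by blast
    qed
    show "3 * C > 0" using C by simp
    fix f assume "f \<in> unit_ball (Hv v) (Hv_norm v)"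
    then obtain a where "a \<in> cube" "f = (\<lambda>z. 3 * synthesis a z)" using synthesis_onto by blast
    then show "\<exists>a\<in>cube. f = (\<lambda>z. complex_of_real (3 * C) * P a z)"
      using C(1) by (intro bexI[of _ a]) (auto simp: P_def)
  qed
  then show ?thesis by blast
qed

end

section \<open>Bloch-type spaces by integration\<close>

lemma HD_add: "f \<in> HD \<Longrightarrow> g \<in> HD \<Longrightarrow> (\<lambda>z. f z + g z) \<in> HD"
  by (auto simp: HD_def intro: holomorphic_intros)

lemma HD_scale: "f \<in> HD \<Longrightarrow> (\<lambda>z. c * f z) \<in> HD"
  by (auto simp: HD_def intro: holomorphic_intros)

text \<open>The tool that turns identities between derivatives into linearity of \<open>primitive\<close>
  and into surjectivity in the Bloch-type case.\<close>

lemma HD_eqI: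
  assumes f: "f \<in> HD" and g: "g \<in> HD" and "f 0 = g 0"
    and df: "\<And>z. z \<in> disc \<Longrightarrow> (f has_field_derivative d z) (at z)"
    and dg: "\<And>z. z \<in> disc \<Longrightarrow> (g has_field_derivative d z) (at z)"
  shows "f = g"
proof
  fix z
  have "\<exists>c. \<forall>x\<in>disc. f x - g x = c"
  proof (rule has_field_derivative_zero_constant)
    fix x :: complex assume x: "x \<in> disc"
    show "((\<lambda>x. f x - g x) has_field_derivative 0) (at x within disc)"
      using DERIV_diff[OF df[OF x] dg[OF x]] by (simp add: has_field_derivative_at_within)
  qed simp
  then obtain c where c: "\<And>x. x \<in> disc \<Longrightarrow> f x - g x = c" by blast
  have "c = 0" using c[of 0] assms(3) by simp
  then show "f z = g z" using c[of z] f g by (cases "z \<in> disc") (auto simp: HD_def)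
qed

lemma ex_primitive:
  assumes g: "g \<in> HD"
  shows "\<exists>G\<in>HD. G 0 = 0 \<and> (\<forall>z\<in>disc. (G has_field_derivative g z) (at z))"
proof -
  have "g holomorphic_on disc" using g by (simp add: HD_def)
  then obtain G where G: "\<And>x. x \<in> disc \<Longrightarrow> (G has_field_derivative g x) (at x within disc)"
    using holomorphic_convex_primitive'[OF convex_ball open_ball] by blast
  define H where "H z = (if z \<in> disc then G z - G 0 else 0)" for z
  have H: "(H has_field_derivative g z) (at z)" if z: "z \<in> disc" for z
  proof -
    have "(G has_field_derivative g z) (at z)" using G[OF z] at_within_open[OF z open_ball] by simp
    then have "((\<lambda>z. G z - G 0) has_field_derivative g z) (at z)"
      using DERIV_diff[OF _ DERIV_const] by fastforce
    then show ?thesis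
      by (rule has_field_derivative_transform_within_open[OF _ open_ball z]) (simp add: H_def)
  qed
  then have "H holomorphic_on disc"
    unfolding holomorphic_on_open[OF open_ball] by blast
  then have "H \<in> HD" by (auto simp: HD_def H_def)
  then show ?thesis using H by (intro bexI[of _ H]) (auto simp: H_def)
qed

definition primitive :: "(complex \<Rightarrow> complex) \<Rightarrow> complex \<Rightarrow> complex" where
  "primitive g = (SOME G. G \<in> HD \<and> G 0 = 0 \<and> (\<forall>z\<in>disc. (G has_field_derivative g z) (at z)))"

lemma primitive:
  assumes "g \<in> HD"
  shows "primitive g \<in> HD" "primitive g 0 = 0"
    "z \<in> disc \<Longrightarrow> (primitive g has_field_derivative g z) (at z)"
proof -
  have "\<exists>G. G \<in> HD \<and> G 0 = 0 \<and> (\<forall>z\<in>disc. (G has_field_derivative g z) (at z))"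
    using ex_primitive[OF assms] by blast
  from someI_ex[OF this, folded primitive_def]
  show "primitive g \<in> HD" "primitive g 0 = 0"
    "z \<in> disc \<Longrightarrow> (primitive g has_field_derivative g z) (at z)" by blast+
qed

lemma primitive_add:
  assumes "f \<in> HD" "g \<in> HD"
  shows "primitive (\<lambda>z. f z + g z) = (\<lambda>z. primitive f z + primitive g z)"
  by (rule HD_eqI[where d = "\<lambda>z. f z + g z"])
    (use primitive[OF HD_add[OF assms]] primitive[OF assms(1)] primitive[OF assms(2)] in
      \<open>auto intro!: HD_add DERIV_add\<close>)

lemma primitive_scale:
  assumes "f \<in> HD"
  shows "primitive (\<lambda>z. c * f z) = (\<lambda>z. c * primitive f z)"
  by (rule HD_eqI[where d = "\<lambda>z. c * f z"])
    (use primitive[OF HD_scale[OF assms]] primitive[OF assms] in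
      \<open>auto intro!: HD_scale DERIV_cmult\<close>)

text \<open>Integration does not increase the distance on discs of radius at most \<open>1\<close>; this transfers
  \<open>co\<close>-continuity from the derivative to the function.\<close>

lemma primitive_diff_bound:
  assumes f: "f \<in> HD" and g: "g \<in> HD" and r: "r < 1" and z: "cmod z \<le> r"
    and B: "\<And>w. w \<in> cball 0 r \<Longrightarrow> cmod (f w - g w) \<le> B"
  shows "cmod (primitive f z - primitive g z) \<le> B"
proof -
  have r0: "0 \<le> r" using order_trans[OF norm_ge_zero z] .
  have B0: "0 \<le> B" using order_trans[OF norm_ge_zero B[of 0]] r0 by simp
  have "norm ((primitive f z - primitive g z) - (primitive f 0 - primitive g 0)) \<le> B * norm (z - 0)"
  proof (rule field_differentiable_bound[of "cball 0 r" _ "\<lambda>w. f w - g w"])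
    fix w :: complex assume w: "w \<in> cball 0 r"
    then have "w \<in> disc" using r by auto
    then have "((\<lambda>w. primitive f w - primitive g w) has_field_derivative f w - g w) (at w)"
      by (intro DERIV_diff primitive f g)
    then show "((\<lambda>w. primitive f w - primitive g w) has_field_derivative f w - g w) (at w within cball 0 r)"
      by (rule has_field_derivative_at_within)
  qed (use B z r0 in auto)
  then have "cmod (primitive f z - primitive g z) \<le> B * cmod z"
    by (simp add: primitive f g)
  also have "\<dots> \<le> B" using B0 z r by (intro mult_left_le) auto
  finally show ?thesis .
qed

lemma continuous_map_cube_co_near:
  fixes P :: "('i \<Rightarrow> complex) \<Rightarrow> complex \<Rightarrow> complex"
  assumes P: "continuous_map (top_of_set cube) co_topology P" and a: "a \<in> cube"
    and r: "r < 1" and e: "e > 0"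
  shows "\<exists>U. open U \<and> a \<in> U \<and> (\<forall>b\<in>cube \<inter> U. \<forall>z\<in>cball 0 r. cmod (P b z - P a z) < e)"
proof -
  have "limitin co_topology P (P a) (atin (top_of_set cube) a)"
    using P a by (simp add: continuous_map_atin)
  then have "uniform_limit (cball 0 r) P (P a) (atin (top_of_set cube) a)"
    using r unfolding limitin_co_topology by (auto simp: cball_subset_ball_iff)
  then have "\<forall>\<^sub>F b in atin (top_of_set cube) a. \<forall>z\<in>cball 0 r. dist (P b z) (P a z) < e"
    using e by (rule uniform_limitD)
  then obtain V where V: "openin (top_of_set cube) V" "a \<in> V"
    "\<And>b. b \<in> V - {a} \<Longrightarrow> \<forall>z\<in>cball 0 r. dist (P b z) (P a z) < e"
    using a unfolding eventually_atin by auto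
  obtain U where U: "open U" "V = cube \<inter> U" using V(1) by (auto simp: openin_open)
  have "cmod (P b z - P a z) < e" if "b \<in> cube \<inter> U" "z \<in> cball 0 r" for b z
    using V(3)[of b] that U(2) e by (cases "b = a") (auto simp: dist_norm)
  then show ?thesis using U V(2) by blast
qed

text \<open>The norm is a sum of two terms, each of which takes half of the unit.\<close>

lemma Bv_unit_ball_I:
  assumes "f \<in> HD" "cmod (f 0) \<le> 1 / 2" "\<And>z. z \<in> disc \<Longrightarrow> v z * cmod (deriv f z) \<le> 1 / 2"
  shows "f \<in> unit_ball (Bv v) (Bv_norm v)"
proof -
  have "(SUP z\<in>disc. v z * cmod (deriv f z)) \<le> 1 / 2" by (intro cSUP_least assms(3)) auto
  then show ?thesis
    using assms by (auto simp: unit_ball_def Bv_def Bv_norm_def intro!: bdd_aboveI2[of _ _ "1 / 2"])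
qed

lemma Bv_unit_ball_D:
  assumes f: "f \<in> unit_ball (Bv v) (Bv_norm v)" and v: "v 0 \<ge> 0"
  shows "f \<in> HD" "cmod (f 0) \<le> 1" "z \<in> disc \<Longrightarrow> v z * cmod (deriv f z) \<le> 1"
proof -
  let ?S = "SUP z\<in>disc. v z * cmod (deriv f z)"
  show "f \<in> HD" using f by (simp add: unit_ball_def Bv_def)
  have S: "v z * cmod (deriv f z) \<le> ?S" if "z \<in> disc" for z
    using f that by (intro cSUP_upper) (auto simp: unit_ball_def Bv_def)
  have n: "cmod (f 0) + ?S \<le> 1" using f by (simp add: unit_ball_def Bv_norm_def)
  have "0 \<le> v 0 * cmod (deriv f 0)" using v by simp
  also have "\<dots> \<le> ?S" by (rule S) simp
  finally show "cmod (f 0) \<le> 1" using n by simp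
  show "v z * cmod (deriv f z) \<le> 1" if "z \<in> disc" using S[OF that] n norm_ge_zero[of "f 0"] by linarith
qed

text \<open>The index \<open>None\<close> carries the value at \<open>0\<close>, the others carry the derivative. Rescaling by
  \<open>D = max 1 C\<close> keeps both within the cube when a function is represented.\<close>

lemma Bv_cube_quotient:
  fixes P :: "('i \<Rightarrow> complex) \<Rightarrow> complex \<Rightarrow> complex"
  assumes P: "cube_quotient (Hv v) (Hv_norm v) P C" and v0: "v 0 \<ge> 0"
  shows "\<exists>(Q :: ('i option \<Rightarrow> complex) \<Rightarrow> complex \<Rightarrow> complex) D. cube_quotient (Bv v) (Bv_norm v) Q D"
proof -
  have PZ: "\<And>a. bounded_family a \<Longrightarrow> P a \<in> Hv v"
    and P_add: "\<And>a b. bounded_family a \<Longrightarrow> bounded_family b \<Longrightarrow> P (\<lambda>i. a i + b i) = (\<lambda>z. P a z + P b z)"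
    and P_scale: "\<And>a c. bounded_family a \<Longrightarrow> P (\<lambda>i. c * a i) = (\<lambda>z. c * P a z)"
    and P_ball: "P ` cube \<subseteq> unit_ball (Hv v) (Hv_norm v)"
    and P_cont: "continuous_map (top_of_set cube) co_topology P"
    and C: "C > 0"
    and P_onto: "\<And>f. f \<in> unit_ball (Hv v) (Hv_norm v) \<Longrightarrow> \<exists>a\<in>cube. f = (\<lambda>z. complex_of_real C * P a z)"
    using P by (auto simp: cube_quotient_def)
  have PHD: "P a \<in> HD" if "bounded_family a" for a using PZ[OF that] by (simp add: Hv_def)
  define tail where "tail a = (\<lambda>i. a (Some i))" for a :: "'i option \<Rightarrow> complex"
  have tail_bf: "bounded_family (tail a)" if "bounded_family a" for a
    using that unfolding bounded_family_def tail_def by blast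
  have tail_cube: "tail a \<in> cube" if "a \<in> cube" for a
    using that by (simp add: cube_def tail_def)
  define one where "one z = (if z \<in> disc then 1 else 0 :: complex)" for z
  have one: "one \<in> HD"
  proof -
    have "one holomorphic_on disc"
      by (rule holomorphic_transform[OF holomorphic_on_const[of 1]]) (simp add: one_def)
    then show ?thesis by (auto simp: HD_def one_def)
  qed
  define Q where "Q a z = 1 / 2 * (a None * one z + primitive (P (tail a)) z)" for a z
  have Q_HD: "Q a \<in> HD" if "bounded_family a" for a
  proof -
    have "(\<lambda>z. 1 / 2 * (a None * one z + primitive (P (tail a)) z)) \<in> HD"
      by (intro HD_scale HD_add one primitive PHD tail_bf that)
    then show ?thesis unfolding Q_def[abs_def] .
  qed
  have Q0: "Q a 0 = a None / 2" if "bounded_family a" for a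
    using primitive(2)[OF PHD[OF tail_bf[OF that]]] by (simp add: Q_def one_def)
  have Q_deriv: "(Q a has_field_derivative P (tail a) z / 2) (at z)"
    if "bounded_family a" and z: "z \<in> disc" for a z
  proof -
    have "(primitive (P (tail a)) has_field_derivative P (tail a) z) (at z)"
      by (intro primitive PHD tail_bf that)
    then have "((\<lambda>w. 1 / 2 * (a None * 1 + primitive (P (tail a)) w)) has_field_derivative P (tail a) z / 2) (at z)"
      by (auto intro!: derivative_eq_intros)
    then show ?thesis
      by (rule has_field_derivative_transform_within_open[OF _ open_ball z]) (simp add: Q_def one_def)
  qed
  define D where "D = max 1 C"
  have D: "D \<ge> 1" "D \<ge> C" "D > 0" by (auto simp: D_def)
  have "cube_quotient (Bv v) (Bv_norm v) Q (2 * D)"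
    unfolding cube_quotient_def
  proof (intro conjI allI impI ballI)
    fix a b :: "'i option \<Rightarrow> complex" and c
    assume a: "bounded_family a"
    have "bdd_above ((\<lambda>z. v z * cmod (P (tail a) z)) ` disc)"
      using PZ[OF tail_bf[OF a]] by (simp add: Hv_def)
    then obtain R where R: "\<And>z. z \<in> disc \<Longrightarrow> v z * cmod (P (tail a) z) \<le> R"
      unfolding bdd_above_def by blast
    have "v z * cmod (deriv (Q a) z) \<le> R / 2" if "z \<in> disc" for z
      using R[OF that] by (simp add: DERIV_imp_deriv[OF Q_deriv[OF a that]] norm_divide)
    then show "Q a \<in> Bv v"
      using Q_HD[OF a] by (auto simp: Bv_def intro!: bdd_aboveI2[of _ _ "R / 2"])
    show "Q (\<lambda>i. c * a i) = (\<lambda>z. c * Q a z)"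
    proof
      have t: "tail (\<lambda>i. c * a i) = (\<lambda>i. c * tail a i)" by (simp add: tail_def)
      show "Q (\<lambda>i. c * a i) z = c * Q a z" for z
        unfolding Q_def t P_scale[OF tail_bf[OF a]] primitive_scale[OF PHD[OF tail_bf[OF a]]]
        by (simp add: algebra_simps)
    qed
    assume b: "bounded_family b"
    show "Q (\<lambda>i. a i + b i) = (\<lambda>z. Q a z + Q b z)"
    proof
      have t: "tail (\<lambda>i. a i + b i) = (\<lambda>i. tail a i + tail b i)" by (simp add: tail_def)
      show "Q (\<lambda>i. a i + b i) z = Q a z + Q b z" for z
        unfolding Q_def t P_add[OF tail_bf[OF a] tail_bf[OF b]]
          primitive_add[OF PHD[OF tail_bf[OF a]] PHD[OF tail_bf[OF b]]]
        by (simp add: algebra_simps add_divide_distrib)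
    qed
  next
    show "Q ` cube \<subseteq> unit_ball (Bv v) (Bv_norm v)"
    proof (rule image_subsetI)
      fix a :: "'i option \<Rightarrow> complex" assume a: "a \<in> cube"
      note bf = bounded_family_cube[OF a]
      have "P (tail a) \<in> unit_ball (Hv v) (Hv_norm v)" using P_ball tail_cube[OF a] by blast
      then have P1: "v z * cmod (P (tail a) z) \<le> 1" if "z \<in> disc" for z
        using that by (simp add: Hv_unit_ball_iff)
      show "Q a \<in> unit_ball (Bv v) (Bv_norm v)"
      proof (rule Bv_unit_ball_I[OF Q_HD[OF bf]])
        show "cmod (Q a 0) \<le> 1 / 2" using cubeD[OF a, of None] by (simp add: Q0[OF bf] norm_divide)
        show "v z * cmod (deriv (Q a) z) \<le> 1 / 2" if "z \<in> disc" for z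
          using P1[OF that] by (simp add: DERIV_imp_deriv[OF Q_deriv[OF bf that]] norm_divide)
      qed
    qed
    show "continuous_map (top_of_set cube) co_topology Q"
    proof (rule continuous_map_cube_co)
      show "Q a \<in> HD" if "a \<in> cube" for a by (intro Q_HD bounded_family_cube that)
      fix a and r e :: real
      assume a: "a \<in> (cube :: ('i option \<Rightarrow> complex) set)" and r: "0 < r" "r < 1" and e: "e > 0"
      obtain U where U: "open U" "tail a \<in> U"
        "\<forall>b\<in>cube \<inter> U. \<forall>z\<in>cball 0 r. cmod (P b z - P (tail a) z) < e"
        using continuous_map_cube_co_near[OF P_cont tail_cube[OF a] r(2) e] by blast
      define V where "V = tail -` U \<inter> {b. cmod (b None - a None) < e}"
      have "continuous_on UNIV tail"
        unfolding tail_def by (intro continuous_on_coordinatewise_then_product continuous_on_product_coordinates)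
      then have "open (tail -` U)" using U(1) by (simp add: continuous_on_open_vimage)
      moreover have "open {b :: 'i option \<Rightarrow> complex. cmod (b None - a None) < e}"
        by (intro open_Collect_less continuous_intros continuous_on_product_coordinates)
      ultimately have "open V" unfolding V_def by (rule open_Int)
      moreover have "a \<in> V" using U(2) e by (simp add: V_def)
      moreover have "cmod (Q b z - Q a z) < e" if b: "b \<in> cube \<inter> V" and z: "z \<in> cball 0 r" for b z
      proof -
        have bc: "b \<in> cube" "tail b \<in> cube \<inter> U" "cmod (b None - a None) < e"
          using b tail_cube by (auto simp: V_def)
        \<comment> \<open>Both parts are within \<open>e\<close>; the factor \<open>1 / 2\<close> in \<open>Q\<close> absorbs the sum.\<close>
        have "cmod (primitive (P (tail b)) z - primitive (P (tail a)) z) \<le> e"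
          using U(3) bc z r a
          by (intro primitive_diff_bound[of _ _ r] PHD tail_bf) (auto intro: bounded_family_cube less_imp_le)
        moreover have "z \<in> disc" using z r by auto
        then have "Q b z - Q a z = 1 / 2 * ((b None - a None)
            + (primitive (P (tail b)) z - primitive (P (tail a)) z))"
          by (simp add: Q_def one_def algebra_simps)
        then have "cmod (Q b z - Q a z) = 1 / 2 * cmod ((b None - a None)
            + (primitive (P (tail b)) z - primitive (P (tail a)) z))"
          by (simp only: norm_mult) (simp add: norm_divide)
        ultimately show ?thesis
          using norm_triangle_ineq[of "b None - a None" "primitive (P (tail b)) z - primitive (P (tail a)) z"] bc(3)
          by linarith
      qed
      ultimately show "\<exists>U. open U \<and> a \<in> U \<and> (\<forall>b\<in>cube \<inter> U. \<forall>z\<in>cball 0 r. cmod (Q b z - Q a z) < e)"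
        by blast
    qed
    show "2 * D > 0" using D by simp
    fix f assume f: "f \<in> unit_ball (Bv v) (Bv_norm v)"
    note f' = Bv_unit_ball_D[OF f v0]
    have hol: "f holomorphic_on disc" using f'(1) by (simp add: HD_def)
    define g where "g z = (if z \<in> disc then deriv f z else 0)" for z
    have "g holomorphic_on disc"
      by (rule holomorphic_transform[OF holomorphic_deriv[OF hol open_ball]]) (simp add: g_def)
    then have "g \<in> unit_ball (Hv v) (Hv_norm v)"
      using f'(3) by (auto simp: Hv_unit_ball_iff HD_def g_def)
    then obtain b where b: "b \<in> cube" "g = (\<lambda>z. complex_of_real C * P b z)" using P_onto by blast
    define a where "a = case_option (f 0 / of_real D) (\<lambda>i. of_real (C / D) * b i)"
    have a: "a \<in> cube"
    proof (rule cubeI)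
      fix i show "cmod (a i) \<le> 1"
      proof (cases i)
        case None
        then show ?thesis using f'(2) D by (simp add: a_def norm_divide)
      next
        case (Some j)
        have "cmod (a i) = C / D * cmod (b j)" using Some C D by (simp add: a_def norm_mult norm_divide)
        also have "\<dots> \<le> 1" using cubeD[OF b(1), of j] C D by (intro mult_le_one) auto
        finally show ?thesis .
      qed
    qed
    note abf = bounded_family_cube[OF a]
    have "tail a = (\<lambda>i. of_real (C / D) * b i)" by (simp add: tail_def a_def)
    then have "P (tail a) = (\<lambda>z. of_real (C / D) * P b z)"
      by (simp only: P_scale[OF bounded_family_cube[OF b(1)]])
    then have Pt: "of_real D * P (tail a) z = g z" for z using b(2) D by simp
    have "f = (\<lambda>z. complex_of_real (2 * D) * Q a z)"
    proof (rule HD_eqI[where d = g])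
      show "(\<lambda>z. complex_of_real (2 * D) * Q a z) \<in> HD" by (intro HD_scale Q_HD abf)
      show "f 0 = complex_of_real (2 * D) * Q a 0" unfolding Q0[OF abf] using D by (simp add: a_def)
      fix z :: complex assume z: "z \<in> disc"
      show "(f has_field_derivative g z) (at z)"
        using holomorphic_derivI[OF hol open_ball z] z by (simp add: g_def)
      have "((\<lambda>z. complex_of_real (2 * D) * Q a z) has_field_derivative
          complex_of_real (2 * D) * (P (tail a) z / 2)) (at z)"
        by (intro DERIV_cmult Q_deriv abf z)
      then show "((\<lambda>z. complex_of_real (2 * D) * Q a z) has_field_derivative g z) (at z)"
        using Pt[of z] by simp
    qed (rule f'(1))
    then show "\<exists>a\<in>cube. f = (\<lambda>z. complex_of_real (2 * D) * Q a z)" using a by blast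
  qed
  then show ?thesis by blast
qed

section \<open>Compactness and weak compactness\<close>

theorem theorem3p5:
  fixes v :: "complex \<Rightarrow> real"
    and Y :: "(complex \<Rightarrow> complex) set"
    and N :: "(complex \<Rightarrow> complex) \<Rightarrow> real"
  assumes "normal_weight v"
    and "banach_fun_space Y N"
    and "Y \<subseteq> HD"
    and "compactin co_topology (unit_ball Y N)"
  shows "(\<forall>T. linear_operator (Hv v) Y T \<and>
            continuous_map (subtopology co_topology (unit_ball (Hv v) (Hv_norm v))) co_topology T \<longrightarrow>
            (compact_operator (Hv v) (Hv_norm v) Y N T \<longleftrightarrow>
             weakly_compact_operator (Hv v) (Hv_norm v) Y N T)) \<and>
         (\<forall>T. linear_operator (Bv v) Y T \<and>
            continuous_map (subtopology co_topology (unit_ball (Bv v) (Bv_norm v))) co_topology T \<longrightarrow>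
            (compact_operator (Bv v) (Bv_norm v) Y N T \<longleftrightarrow>
             weakly_compact_operator (Bv v) (Bv_norm v) Y N T))"
proof -
  interpret Y: compact_ball_space Y N
    by (intro compact_ball_space.intro compact_ball_space_axioms.intro assms(2)
        compactin_co_imp_compact assms(4))
  interpret v: normal_weight_disc v by (rule normal_weight_disc.intro[OF assms(1)])
  obtain P :: "(nat \<times> nat \<Rightarrow> complex) \<Rightarrow> complex \<Rightarrow> complex" and C
    where P: "cube_quotient (Hv v) (Hv_norm v) P C"
    using v.Hv_cube_quotient by blast
  have "v 0 \<ge> 0" using normal_weight_pos[OF assms(1), of 0] by simp
  then obtain Q :: "((nat \<times> nat) option \<Rightarrow> complex) \<Rightarrow> complex \<Rightarrow> complex" and D
    where Q: "cube_quotient (Bv v) (Bv_norm v) Q D"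
    using Bv_cube_quotient[OF P] by blast
  show ?thesis
    using Y.compact_iff_weakly_compact[OF P] Y.compact_iff_weakly_compact[OF Q] by blast
qed

end
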